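(* Let $0<m\le n$ with $(m,n)\ne(1,1),(1,2)$, and let $\mathcal{E}$ be a Monge equation $$y^{(m)}=F\bigl(x,y,y',\dots,y^{(m-1)},z,z',\dots,z^{(n)}\bigr)$$ with $F_{z^{(n)}z^{(n)}}\ne0$. Then the algebra of internal symmetries of $\mathcal{E}$ coincides with the algebra of external symmetries of $\mathcal{E}$, i.e. those induced on $\mathcal{E}$ by (infinitesimal) Lie transformations of the ambient mixed jet space $J^{m,n}(\mathbb{R},\mathbb{R}^2)$.
   Context: Here $y=y(x)$, $z=z(x)$ and all considerations are local. The mixed jet space $J^{m,n}(\mathbb{R},\mathbb{R}^2)\simeq\mathbb{R}^{m+n+3}$ has coordinates $(x,y=y_0,y_1,\dots,y_m,z=z_0,z_1,\dots,z_n)$ and carries the canonical rank 3 (Cartan) distribution $$\mathcal{C}=\operatorname{Ann}\{dy_i-y_{i+1}\,dx,\ dz_j-z_{j+1}\,dx \mid 0\le i<m,\ 0\le j<n\}.$$ The equation $\mathcal{E}$ is the hypersurface $\{y_m=F(x,y,\dots,y_{m-1},z,\dots,z_n)\}\subset J^{m,n}(\mathbb{R},\mathbb{R}^2)$, and $\Delta=\mathcal{C}\cap T\mathcal{E}$ is the induced rank 2 distribution on $\mathcal{E}$. An internal symmetry of $\mathcal{E}$ is an (infinitesimal) symmetry of the pair $(\mathcal{E},\Delta)$, i.e. a vector field on $\mathcal{E}$ whose flow preserves $\Delta$. A Lie transformation of $J^{m,n}(\mathbb{R},\mathbb{R}^2)$ is a (local) diffeomorphism preserving $\mathcal{C}$;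 an infinitesimal Lie transformation is a vector field whose flow consists of Lie transformations. An external symmetry of $\mathcal{E}$ is an infinitesimal Lie transformation tangent to $\mathcal{E}$, and it induces an internal symmetry by restriction to $\mathcal{E}$. The condition $F_{z^{(n)}z^{(n)}}\neq0$ is required at every point. *)

theory Defs
  imports "HOL-Analysis.Analysis"
begin

section \<open>Smooth maps, vector fields and flows on subsets of Euclidean space\<close>

primrec Ck_on :: "nat \<Rightarrow> 'a::euclidean_space set \<Rightarrow> ('a \<Rightarrow> 'b::euclidean_space) \<Rightarrow> bool" where
  "Ck_on 0 S f \<longleftrightarrow> continuous_on S f"
| "Ck_on (Suc k) S f \<longleftrightarrow>
     (\<forall>x\<in>S. f differentiable (at x)) \<and> (\<forall>v. Ck_on k S (\<lambda>x. frechet_derivative f (at x) v))"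

text \<open>
  The set below need not be open: as usual for submanifolds of Euclidean space, a map is smooth
  if it locally extends to a smooth map on an open set of the ambient space.
\<close>

definition smooth_on :: "'a::euclidean_space set \<Rightarrow> ('a \<Rightarrow> 'b::euclidean_space) \<Rightarrow> bool" where
  "smooth_on S f \<longleftrightarrow>
     (\<forall>p\<in>S. \<exists>W g. open W \<and> p \<in> W \<and> (\<forall>k. Ck_on k W g) \<and> (\<forall>q\<in>S \<inter> W. g q = f q))"

definition tangent_space :: "'a::euclidean_space set \<Rightarrow> 'a \<Rightarrow> 'a set" where
  "tangent_space M p =
     {v. \<exists>\<gamma> \<epsilon>. 0 < \<epsilon> \<and> \<gamma> ` {-\<epsilon><..<\<epsilon>} \<subseteq> M \<and> \<gamma> 0 = p \<and> (\<gamma> has_vector_derivative v) (at (0::real))}"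

definition vector_field_on :: "'a::euclidean_space set \<Rightarrow> ('a \<Rightarrow> 'a) \<Rightarrow> bool" where
  "vector_field_on M X \<longleftrightarrow> smooth_on M X \<and> (\<forall>p\<in>M. X p \<in> tangent_space M p)"

definition local_flow ::
  "'a::euclidean_space set \<Rightarrow> ('a \<Rightarrow> 'a) \<Rightarrow> real \<Rightarrow> 'a set \<Rightarrow> (real \<Rightarrow> 'a \<Rightarrow> 'a) \<Rightarrow> bool" where
  "local_flow M X \<epsilon> N \<phi> \<longleftrightarrow>
     0 < \<epsilon> \<and> openin (top_of_set M) N \<and>
     smooth_on ({-\<epsilon><..<\<epsilon>} \<times> N) (\<lambda>(t, q). \<phi> t q) \<and>
     (\<forall>q\<in>N. \<phi> 0 q = q \<and>
       (\<forall>t\<in>{-\<epsilon><..<\<epsilon>}. \<phi> t q \<in> M \<and> ((\<lambda>s. \<phi> s q) has_vector_derivative X (\<phi> t q)) (at t)))"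

definition local_diffeo :: "'a::euclidean_space set \<Rightarrow> 'a set \<Rightarrow> ('a \<Rightarrow> 'a) \<Rightarrow> bool" where
  "local_diffeo M N f \<longleftrightarrow>
     openin (top_of_set M) N \<and> openin (top_of_set M) (f ` N) \<and> smooth_on N f \<and>
     (\<exists>g. smooth_on (f ` N) g \<and> (\<forall>q\<in>N. g (f q) = q))"

text \<open>
  A distribution on \<open>M\<close> is a map \<open>D\<close> assigning to \<open>q\<close> a subspace of the tangent space of \<open>M\<close> at \<open>q\<close>.
  The derivative \<open>A\<close> of \<open>f\<close> within \<open>N\<close> is only determined on that tangent space, hence in
  particular on \<open>D q\<close>.
\<close>

definition local_symmetry ::
  "'a::euclidean_space set \<Rightarrow> ('a \<Rightarrow> 'a set) \<Rightarrow> 'a set \<Rightarrow> ('a \<Rightarrow> 'a) \<Rightarrow> bool" where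
  "local_symmetry M D N f \<longleftrightarrow>
     local_diffeo M N f \<and>
     (\<forall>q\<in>N. \<exists>A. (f has_derivative A) (at q within N) \<and> A ` D q = D (f q))"

definition infinitesimal_symmetry ::
  "'a::euclidean_space set \<Rightarrow> ('a \<Rightarrow> 'a set) \<Rightarrow> ('a \<Rightarrow> 'a) \<Rightarrow> bool" where
  "infinitesimal_symmetry M D X \<longleftrightarrow>
     vector_field_on M X \<and>
     (\<forall>p\<in>M. \<exists>\<epsilon> N \<phi>. p \<in> N \<and> local_flow M X \<epsilon> N \<phi> \<and>
        (\<forall>t\<in>{-\<epsilon><..<\<epsilon>}. local_symmetry M D N (\<phi> t)))"


section \<open>The mixed jet space\<close>

text \<open>
  The space of the arguments \<open>(x, y\<^sub>0, \<dots>, y\<^sub>m\<^sub>-\<^sub>1, z\<^sub>0, \<dots>, z\<^sub>n)\<close> of \<open>F\<close> is \<open>real ^ 'e\<close>, where the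
  \<open>m + n + 2\<close> elements of \<open>'e\<close> are named by a labelling \<open>l\<close>.  The mixed jet space is
  \<open>(real ^ 'e) \<times> real\<close>, whose last component is the remaining coordinate \<open>y\<^sub>m\<close>.
\<close>

datatype jet_coord = CX | CY nat | CZ nat

definition jet_labelling :: "nat \<Rightarrow> nat \<Rightarrow> (jet_coord \<Rightarrow> 'e::finite) \<Rightarrow> bool" where
  "jet_labelling m n l \<longleftrightarrow> bij_betw l ({CX} \<union> CY ` {..<m} \<union> CZ ` {..n}) UNIV"

lemma card_jet_labelling:
  fixes l :: "jet_coord \<Rightarrow> 'e::finite"
  assumes "jet_labelling m n l"
  shows "CARD('e) = m + n + 2"
proof -
  have "card ({CX} \<union> CY ` {..<m} \<union> CZ ` {..n}) = m + n + 2"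
  proof -
    have "card (CY ` {..<m}) = m" "card (CZ ` {..n}) = n + 1"
      by (simp_all add: card_image inj_on_def)
    moreover have "card (CY ` {..<m} \<union> CZ ` {..n}) = card (CY ` {..<m}) + card (CZ ` {..n})"
      by (rule card_Un_disjoint) auto
    moreover have "CX \<notin> CY ` {..<m} \<union> CZ ` {..n}" by auto
    ultimately show ?thesis by simp
  qed
  then show ?thesis
    using assms bij_betw_same_card unfolding jet_labelling_def by metis
qed

type_synonym 'e jet = "(real ^ 'e) \<times> real"

definition jet_coordinate :: "nat \<Rightarrow> (jet_coord \<Rightarrow> 'e::finite) \<Rightarrow> jet_coord \<Rightarrow> 'e jet \<Rightarrow> real" where
  "jet_coordinate m l c p = (if c = CY m then snd p else fst p $ l c)"

text \<open>The coordinates are linear, so they are also the components of their differentials.\<close>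

definition cartan :: "nat \<Rightarrow> nat \<Rightarrow> (jet_coord \<Rightarrow> 'e::finite) \<Rightarrow> 'e jet \<Rightarrow> 'e jet set" where
  "cartan m n l p = (let u = jet_coordinate m l in
     {v. (\<forall>i<m. u (CY i) v - u (CY (Suc i)) p * u CX v = 0) \<and>
         (\<forall>j<n. u (CZ j) v - u (CZ (Suc j)) p * u CX v = 0)})"

definition lie_field :: "nat \<Rightarrow> nat \<Rightarrow> (jet_coord \<Rightarrow> 'e::finite) \<Rightarrow> 'e jet set \<Rightarrow>
    ('e jet \<Rightarrow> 'e jet) \<Rightarrow> bool" where
  "lie_field m n l W Y \<longleftrightarrow> open W \<and> infinitesimal_symmetry W (cartan m n l) Y"


section \<open>Monge equations and their symmetries\<close>

definition partial_deriv :: "'e::finite \<Rightarrow> (real ^ 'e \<Rightarrow> real) \<Rightarrow> real ^ 'e \<Rightarrow> real" where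
  "partial_deriv i f q = frechet_derivative f (at q) (axis i 1)"

definition monge_equation :: "(real ^ 'e::finite) set \<Rightarrow> (real ^ 'e \<Rightarrow> real) \<Rightarrow> 'e jet set" where
  "monge_equation U F = {(q, y). q \<in> U \<and> y = F q}"

definition monge_distribution ::
  "nat \<Rightarrow> nat \<Rightarrow> (jet_coord \<Rightarrow> 'e::finite) \<Rightarrow> 'e jet set \<Rightarrow> 'e jet \<Rightarrow> 'e jet set" where
  "monge_distribution m n l E p = cartan m n l p \<inter> tangent_space E p"

definition internal_symmetries ::
  "nat \<Rightarrow> nat \<Rightarrow> (jet_coord \<Rightarrow> 'e::finite) \<Rightarrow> 'e jet set \<Rightarrow> 'e jet set \<Rightarrow> ('e jet \<Rightarrow> 'e jet) set" where
  "internal_symmetries m n l E V = {X. infinitesimal_symmetry V (monge_distribution m n l E) X}"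

definition external_symmetry ::
  "nat \<Rightarrow> nat \<Rightarrow> (jet_coord \<Rightarrow> 'e::finite) \<Rightarrow> 'e jet set \<Rightarrow> 'e jet set \<Rightarrow> ('e jet \<Rightarrow> 'e jet) \<Rightarrow> bool" where
  "external_symmetry m n l E W Y \<longleftrightarrow>
     lie_field m n l W Y \<and> (\<forall>q\<in>E \<inter> W. Y q \<in> tangent_space E q)"

text \<open>
  Fields on \<open>V\<close>, an open part of \<open>E\<close>, that are locally restrictions of external symmetries.
\<close>

definition induced_symmetries ::
  "nat \<Rightarrow> nat \<Rightarrow> (jet_coord \<Rightarrow> 'e::finite) \<Rightarrow> 'e jet set \<Rightarrow> 'e jet set \<Rightarrow> ('e jet \<Rightarrow> 'e jet) set" where
  "induced_symmetries m n l E V =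
     {X. \<forall>p\<in>V. \<exists>W Y. p \<in> W \<and> E \<inter> W \<subseteq> V \<and> external_symmetry m n l E W Y \<and>
           (\<forall>q\<in>E \<inter> W. X q = Y q)}"

end

theory Submission
  imports Defs
begin

text \<open>
  Forgetting \<open>y\<^sub>m\<close> identifies the equation with the open set \<open>U\<close>.  There the induced distribution
  is spanned by \<open>\<partial> = \<partial>/\<partial>z\<^sub>n\<close> and the total derivative \<open>D\<close>, and its brackets are
  \<open>[\<partial>, D] = E\<close> with \<open>E = \<partial>/\<partial>z\<^sub>n\<^sub>-\<^sub>1 + F\<^sub>z P\<close>, and \<open>[\<partial>, E] = F\<^sub>z\<^sub>z P\<close>, where \<open>P = \<partial>/\<partial>y\<^sub>m\<^sub>-\<^sub>1\<close> and
  \<open>z\<close> stands for \<open>z\<^sub>n\<close>.  The operators \<open>\<partial>, D, E, P\<close> are \<open>Dz\<close>, \<open>total_deriv\<close>, \<open>bracket_deriv\<close>, \<open>Dp\<close> below.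

  Suppose that an internal symmetry preserves the line field of \<open>\<partial>\<close>.  Because \<open>F\<^sub>z\<^sub>z\<close> has no zero, it
  then preserves the span of \<open>D, \<partial>, E, P\<close>.  This is the preimage of the Cartan distribution of
  \<open>J\<^bsup>m-1,n-1\<^esup>\<close> under the projection of the equation along \<open>\<partial>\<close>.  So the symmetry descends to a Lie field
  on \<open>J\<^bsup>m-1,n-1\<^esup>\<close>.  A point of \<open>J\<^bsup>m,n\<^esup>\<close> is a point of \<open>J\<^bsup>m-1,n-1\<^esup>\<close> with a horizontal line in the Cartan
  distribution, and a Lie field acts on such lines.  This prolongation to \<open>J\<^bsup>m,n\<^esup>\<close> is a Lie field, and
  on the equation it is the given symmetry, since a point of the equation is the line to which the
  distribution projects (\<open>prolong_field_on_equation\<close>).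

  It remains to see that \<open>\<partial>\<close> is preserved, that is, that the \<open>x\<close>-component \<open>\<xi>\<close> of the symmetry satisfies
  \<open>\<partial> \<xi> = 0\<close>.  This is where the two pairs \<open>(m, n)\<close> are excluded.  Subtracting the multiple \<open>\<xi> D\<close>
  from the symmetry leaves generating functions: their successive total derivatives are again
  generating functions, and \<open>\<partial>\<close> kills all of them but the last of each chain, where it gives
  \<open>- F\<^sub>z \<xi>\<close> and \<open>- \<xi>\<close>.  Commuting \<open>\<partial>\<close> with \<open>D\<close> and \<open>E\<close> turns this into \<open>\<partial> \<xi> = 0\<close>, either by comparing
  the two chains if \<open>m \<ge> 2\<close> (\<open>fibre_preserved_if_two_dependent\<close>), or by going three steps along the
  chain of \<open>z\<close> if \<open>m = 1\<close> and \<open>n \<ge> 3\<close> (\<open>fibre_preserved_if_one_dependent\<close>).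

  Symmetries are defined by their flows, so each step also has to be made for flows.  The flow of
  the prolongation is the explicit prolongation of the given flow, so its existence comes from the
  hypothesis.  Uniqueness of integral curves comes from the estimate
  \<open>\<parallel>u'\<parallel> \<le> K \<parallel>u\<parallel>\<close> (\<open>zero_if_derivative_bounded\<close>).  The same estimate shows that the flow of an external
  symmetry preserves the equation (\<open>flow_preserves_monge_equation\<close>), which gives the converse
  inclusion.
\<close>

section \<open>Calculus of smooth maps\<close>

lemma Ck_on_subset: "Ck_on k T f \<Longrightarrow> S \<subseteq> T \<Longrightarrow> Ck_on k S f"
  by (induction k arbitrary: f) (auto intro: continuous_on_subset)

lemma Ck_on_cong:
  assumes "open S" "\<And>x. x \<in> S \<Longrightarrow> f x = g x" "Ck_on k S f"
  shows "Ck_on k S g"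
  using assms(2,3)
proof (induction k arbitrary: f g)
  case 0
  then show ?case using continuous_on_cong[of S S f g] by simp
next
  case (Suc k)
  have der: "(g has_derivative frechet_derivative f (at x)) (at x)" if "x \<in> S" for x
  proof -
    have "(f has_derivative frechet_derivative f (at x)) (at x)"
      using that Suc.prems(2) by (simp add: frechet_derivative_works[symmetric])
    then show ?thesis
      using has_derivative_transform_within_open[OF _ \<open>open S\<close> that] Suc.prems(1) by blast
  qed
  have "Ck_on k S (\<lambda>x. frechet_derivative g (at x) v)" for v
    by (rule Suc.IH[of "\<lambda>x. frechet_derivative f (at x) v"])
      (use Suc.prems(2) frechet_derivative_at[OF der] in simp_all)
  then show ?case
    using der by (auto simp: differentiable_def)
qed

lemma Ck_on_Suc_derivI:
  assumes "open S"
    and der: "\<And>x. x \<in> S \<Longrightarrow> (f has_derivative f' x) (at x)"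
    and Ck: "\<And>v. Ck_on k S (\<lambda>x. f' x v)"
  shows "Ck_on (Suc k) S f"
proof -
  have "Ck_on k S (\<lambda>x. frechet_derivative f (at x) v)" for v
    by (rule Ck_on_cong[OF \<open>open S\<close> _ Ck[of v]]) (metis der frechet_derivative_at)
  then show ?thesis
    using der by (auto simp: differentiable_def)
qed

lemma Ck_on_Suc_has_derivative:
  "Ck_on (Suc k) S f \<Longrightarrow> x \<in> S \<Longrightarrow> (f has_derivative frechet_derivative f (at x)) (at x)"
  by (simp add: frechet_derivative_works[symmetric])

lemma Ck_on_SucD: "Ck_on (Suc k) S f \<Longrightarrow> Ck_on k S f"
proof (induction k arbitrary: f)
  case 0
  then show ?case
    by (auto intro!: differentiable_imp_continuous_on simp: differentiable_on_def
        differentiable_at_withinI)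
next
  case (Suc k)
  then show ?case by (metis Ck_on.simps(2))
qed

lemma Ck_on_local:
  assumes "\<And>x. x \<in> S \<Longrightarrow> \<exists>W. open W \<and> x \<in> W \<and> Ck_on k W f"
  shows "Ck_on k S f"
  using assms
proof (induction k arbitrary: f)
  case 0
  have "isCont f x" if "x \<in> S" for x
    using 0[OF that] continuous_on_eq_continuous_at by auto
  then show ?case by (simp add: continuous_at_imp_continuous_on)
next
  case (Suc k)
  have "f differentiable (at x)" if "x \<in> S" for x
    using Suc.prems[OF that] by auto
  moreover have "Ck_on k S (\<lambda>x. frechet_derivative f (at x) v)" for v
  proof (rule Suc.IH)
    fix x assume "x \<in> S"
    then obtain W where "open W" "x \<in> W" "Ck_on (Suc k) W f" using Suc.prems by blast
    then show "\<exists>W. open W \<and> x \<in> W \<and> Ck_on k W (\<lambda>x. frechet_derivative f (at x) v)" by auto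
  qed
  ultimately show ?case by simp
qed

lemma Ck_on_const: "Ck_on k S (\<lambda>_. c)"
  by (induction k arbitrary: c) auto

lemma Ck_on_bounded_linear:
  assumes "open S" "bounded_linear L" "Ck_on k S f"
  shows "Ck_on k S (\<lambda>x. L (f x))"
  using assms(3)
proof (induction k arbitrary: f)
  case 0
  then show ?case by (simp add: assms(2) bounded_linear.continuous_on)
next
  case (Suc k)
  show ?case
  proof (rule Ck_on_Suc_derivI[OF \<open>open S\<close>])
    show "((\<lambda>x. L (f x)) has_derivative (\<lambda>v. L (frechet_derivative f (at x) v))) (at x)" if "x \<in> S" for x
      by (rule bounded_linear.has_derivative[OF assms(2) Ck_on_Suc_has_derivative[OF Suc.prems that]])
    show "Ck_on k S (\<lambda>x. L (frechet_derivative f (at x) v))" for v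
      using Suc by simp
  qed
qed

lemma Ck_on_add:
  assumes "open S" "Ck_on k S f" "Ck_on k S g"
  shows "Ck_on k S (\<lambda>x. f x + g x)"
  using assms(2,3)
proof (induction k arbitrary: f g)
  case 0
  then show ?case by (simp add: continuous_on_add)
next
  case (Suc k)
  show ?case
  proof (rule Ck_on_Suc_derivI[OF \<open>open S\<close>])
    show "((\<lambda>x. f x + g x) has_derivative
        (\<lambda>v. frechet_derivative f (at x) v + frechet_derivative g (at x) v)) (at x)" if "x \<in> S" for x
      by (rule has_derivative_add[OF Ck_on_Suc_has_derivative[OF Suc.prems(1) that]
            Ck_on_Suc_has_derivative[OF Suc.prems(2) that]])
    show "Ck_on k S (\<lambda>x. frechet_derivative f (at x) v + frechet_derivative g (at x) v)" for v
      using Suc by simp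
  qed
qed

lemma Ck_on_sum:
  assumes "open S" "\<And>i. i \<in> I \<Longrightarrow> Ck_on k S (f i)"
  shows "Ck_on k S (\<lambda>x. \<Sum>i\<in>I. f i x)"
  using assms(2)
  by (induction I rule: infinite_finite_induct)
    (auto intro!: Ck_on_const Ck_on_add \<open>open S\<close>)

lemma Ck_on_bilinear:
  assumes "open S" "bounded_bilinear B" "Ck_on k S f" "Ck_on k S g"
  shows "Ck_on k S (\<lambda>x. B (f x) (g x))"
  using assms(3,4)
proof (induction k arbitrary: f g)
  case 0
  then show ?case using assms(2) by (simp add: bounded_bilinear.continuous_on)
next
  case (Suc k)
  show ?case
  proof (rule Ck_on_Suc_derivI[OF \<open>open S\<close>])
    show "((\<lambda>x. B (f x) (g x)) has_derivative
        (\<lambda>v. B (f x) (frechet_derivative g (at x) v) + B (frechet_derivative f (at x) v) (g x))) (at x)"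
      if "x \<in> S" for x
      by (rule bounded_bilinear.FDERIV[OF assms(2) Ck_on_Suc_has_derivative[OF Suc.prems(1) that]
            Ck_on_Suc_has_derivative[OF Suc.prems(2) that]])
    show "Ck_on k S (\<lambda>x. B (f x) (frechet_derivative g (at x) v) + B (frechet_derivative f (at x) v) (g x))" for v
      using Suc.prems[THEN Ck_on_SucD] Suc.prems by (intro Ck_on_add \<open>open S\<close> Suc.IH) simp_all
  qed
qed

lemma linear_eq_sum_Basis:
  fixes h :: "'a::euclidean_space \<Rightarrow> 'b::real_vector"
  assumes "linear h"
  shows "h v = (\<Sum>b\<in>Basis. (v \<bullet> b) *\<^sub>R h b)"
proof -
  have "h v = h (\<Sum>b\<in>Basis. (v \<bullet> b) *\<^sub>R b)" by (simp add: euclidean_representation)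
  also have "\<dots> = (\<Sum>b\<in>Basis. (v \<bullet> b) *\<^sub>R h b)"
    using assms by (simp add: linear_sum linear_scale)
  finally show ?thesis .
qed

lemma Ck_on_compose:
  assumes "open S" "open T" "f ` S \<subseteq> T" "Ck_on k S f" "Ck_on k T g"
  shows "Ck_on k S (\<lambda>x. g (f x))"
  using assms(4,5)
proof (induction k arbitrary: g)
  case 0
  then show ?case using continuous_on_compose2[of T g S f] assms(3) by simp
next
  case (Suc k)
  let ?f' = "\<lambda>x v. frechet_derivative f (at x) v" and ?g' = "\<lambda>x v. frechet_derivative g (at x) v"
  show ?case
  proof (rule Ck_on_Suc_derivI[OF \<open>open S\<close>])
    fix x assume x: "x \<in> S"
    then have fx: "f x \<in> T" using assms(3) by auto
    have "((\<lambda>x. g (f x)) has_derivative (\<lambda>v. ?g' (f x) (?f' x v))) (at x)"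
      by (rule has_derivative_compose[OF Ck_on_Suc_has_derivative[OF Suc.prems(1) x]
            Ck_on_Suc_has_derivative[OF Suc.prems(2) fx]])
    moreover have "?g' (f x) w = (\<Sum>b\<in>Basis. (w \<bullet> b) *\<^sub>R ?g' (f x) b)" for w
      using Suc.prems(2) fx by (intro linear_eq_sum_Basis linear_frechet_derivative) simp
    ultimately show "((\<lambda>x. g (f x)) has_derivative
        (\<lambda>v. \<Sum>b\<in>Basis. (?f' x v \<bullet> b) *\<^sub>R ?g' (f x) b)) (at x)"
      by (metis (no_types, lifting) ext)
  next
    show "Ck_on k S (\<lambda>x. \<Sum>b\<in>Basis. (?f' x v \<bullet> b) *\<^sub>R ?g' (f x) b)" for v
    proof (rule Ck_on_sum[OF \<open>open S\<close>], rule Ck_on_bilinear[OF \<open>open S\<close> bounded_bilinear_scaleR])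
      fix b :: 'b
      show "Ck_on k S (\<lambda>x. ?f' x v \<bullet> b)"
        using Suc.prems(1)
        by (simp add: Ck_on_bounded_linear[OF \<open>open S\<close> bounded_linear_inner_left])
      show "Ck_on k S (\<lambda>x. ?g' (f x) b)"
        using Ck_on_SucD[OF Suc.prems(1)] Suc.prems(2) by (intro Suc.IH) simp_all
    qed
  qed
qed

lemma Ck_on_inverse: "Ck_on k {x::real. x \<noteq> 0} inverse"
proof (induction k)
  case 0
  then show ?case by (auto intro!: continuous_intros)
next
  case (Suc k)
  have open': "open {x::real. x \<noteq> 0}" by (simp add: open_Collect_neq continuous_on_const continuous_on_id)
  show ?case
  proof (rule Ck_on_Suc_derivI[OF open'])
    show "(inverse has_derivative (\<lambda>v. - v * (inverse x * inverse x))) (at x)"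
      if "x \<in> {x::real. x \<noteq> 0}" for x
      using that by (auto intro!: derivative_eq_intros simp: algebra_simps)
    show "Ck_on k {x::real. x \<noteq> 0} (\<lambda>x. - v * (inverse x * inverse x))" for v
      by (rule Ck_on_bilinear[OF open' bounded_bilinear_mult Ck_on_const
            Ck_on_bilinear[OF open' bounded_bilinear_mult Suc Suc]])
  qed
qed

text \<open>
  On an open set the local extensions agree with the map itself, and being \<open>C\<^sup>k\<close> is a local property.
  So the recursive definition can be used directly, and all closure properties come from it.
\<close>

lemma smooth_on_open: "open S \<Longrightarrow> smooth_on S f \<longleftrightarrow> (\<forall>k. Ck_on k S f)"
proof (intro iffI allI)
  fix k assume S: "open S" and f: "smooth_on S f"
  show "Ck_on k S f"
  proof (rule Ck_on_local)
    fix x assume "x \<in> S"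
    then obtain W g where W: "open W" "x \<in> W" "Ck_on k W g" "\<And>q. q \<in> S \<inter> W \<Longrightarrow> g q = f q"
      using f unfolding smooth_on_def by metis
    have "Ck_on k (S \<inter> W) f"
      by (rule Ck_on_cong[of _ g]) (use W S in \<open>auto intro: Ck_on_subset\<close>)
    then show "\<exists>W. open W \<and> x \<in> W \<and> Ck_on k W f"
      using W S \<open>x \<in> S\<close> by (intro exI[of _ "S \<inter> W"]) auto
  qed
next
  assume "open S" "\<forall>k. Ck_on k S f"
  then show "smooth_on S f"
    unfolding smooth_on_def by (intro ballI exI[of _ S] exI[of _ f]) simp
qed

lemma smooth_onI_local:
  assumes "\<And>x. x \<in> S \<Longrightarrow> \<exists>W g. open W \<and> x \<in> W \<and> smooth_on W g \<and> (\<forall>q\<in>S \<inter> W. g q = f q)"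
  shows "smooth_on S f"
  unfolding smooth_on_def
proof
  fix p assume "p \<in> S"
  then obtain W g where "open W" "p \<in> W" "smooth_on W g" "\<forall>q\<in>S \<inter> W. g q = f q"
    using assms by blast
  then show "\<exists>W g. open W \<and> p \<in> W \<and> (\<forall>k. Ck_on k W g) \<and> (\<forall>q\<in>S \<inter> W. g q = f q)"
    by (intro exI[of _ W] exI[of _ g]) (simp add: smooth_on_open)
qed

lemma smooth_on_cong_subset:
  assumes "smooth_on T f" "S \<subseteq> T" "\<And>x. x \<in> S \<Longrightarrow> f x = g x"
  shows "smooth_on S g"
  unfolding smooth_on_def
proof
  fix p assume "p \<in> S"
  then obtain W h where "open W" "p \<in> W" "\<forall>k. Ck_on k W h" "\<forall>q\<in>T \<inter> W. h q = f q"
    using assms(1,2) unfolding smooth_on_def by (metis subsetD)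
  then show "\<exists>W h. open W \<and> p \<in> W \<and> (\<forall>k. Ck_on k W h) \<and> (\<forall>q\<in>S \<inter> W. h q = g q)"
    using assms(2,3) by (intro exI[of _ W] exI[of _ h]) auto
qed

lemma smooth_on_subset: "smooth_on T f \<Longrightarrow> S \<subseteq> T \<Longrightarrow> smooth_on S f"
  by (rule smooth_on_cong_subset) auto

lemma smooth_on_cong: "smooth_on S f \<Longrightarrow> (\<And>x. x \<in> S \<Longrightarrow> f x = g x) \<Longrightarrow> smooth_on S g"
  by (rule smooth_on_cong_subset[OF _ order_refl])

lemma smooth_on_compose:
  assumes "smooth_on S f" "smooth_on T g" "f ` S \<subseteq> T"
  shows "smooth_on S (\<lambda>x. g (f x))"
  unfolding smooth_on_def
proof
  fix p assume p: "p \<in> S"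
  obtain W f1 where W: "open W" "p \<in> W" "\<And>k. Ck_on k W f1" "\<And>q. q \<in> S \<inter> W \<Longrightarrow> f1 q = f q"
    using assms(1) p unfolding smooth_on_def by metis
  have fp: "f p \<in> T" using assms(3) p by auto
  obtain W' g1 where W': "open W'" "f p \<in> W'" "\<And>k. Ck_on k W' g1" "\<And>q. q \<in> T \<inter> W' \<Longrightarrow> g1 q = g q"
    using assms(2) fp unfolding smooth_on_def by metis
  let ?V = "W \<inter> f1 -` W'"
  have "continuous_on W f1" using W(3)[of 0] by simp
  then have "open ?V" using W(1) W'(1) by (rule continuous_open_preimage)
  moreover have "Ck_on k ?V (\<lambda>x. g1 (f1 x))" for k
    by (rule Ck_on_compose[OF \<open>open ?V\<close> W'(1) _ Ck_on_subset[OF W(3)] W'(3)]) auto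
  moreover have "p \<in> ?V" using W(2) W(4)[of p] W'(2) p by auto
  moreover have "g1 (f1 q) = g (f q)" if "q \<in> S \<inter> ?V" for q
    using that W(4)[of q] W'(4)[of "f q"] assms(3) by auto
  ultimately show "\<exists>W g'. open W \<and> p \<in> W \<and> (\<forall>k. Ck_on k W g') \<and> (\<forall>q\<in>S \<inter> W. g' q = g (f q))"
    by (intro exI[of _ ?V] exI[of _ "\<lambda>x. g1 (f1 x)"]) blast
qed

named_theorems smooth_intros

lemma smooth_on_const [smooth_intros]: "smooth_on S (\<lambda>_. c)"
  unfolding smooth_on_def by (intro ballI exI[of _ UNIV] exI[of _ "\<lambda>_. c"]) (auto simp: Ck_on_const)

lemma smooth_on_bounded_linear:
  "open S \<Longrightarrow> bounded_linear L \<Longrightarrow> smooth_on S f \<Longrightarrow> smooth_on S (\<lambda>x. L (f x))"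
  by (simp add: smooth_on_open Ck_on_bounded_linear)

lemma smooth_on_id [smooth_intros]: "smooth_on S (\<lambda>x. x)"
proof -
  have "Ck_on k UNIV (\<lambda>x::'a. x)" for k
    by (cases k) (auto simp: Ck_on_const)
  then have "smooth_on UNIV (\<lambda>x::'a. x)" by (simp add: smooth_on_open)
  then show ?thesis by (rule smooth_on_subset) simp
qed

lemma smooth_on_add [smooth_intros]:
  "open S \<Longrightarrow> smooth_on S f \<Longrightarrow> smooth_on S g \<Longrightarrow> smooth_on S (\<lambda>x. f x + g x)"
  by (simp add: smooth_on_open Ck_on_add)

lemma smooth_on_sum [smooth_intros]:
  "open S \<Longrightarrow> (\<And>i. i \<in> I \<Longrightarrow> smooth_on S (f i)) \<Longrightarrow> smooth_on S (\<lambda>x. \<Sum>i\<in>I. f i x)"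
  by (simp add: smooth_on_open Ck_on_sum)

lemma smooth_on_scaleR [smooth_intros]:
  "open S \<Longrightarrow> smooth_on S f \<Longrightarrow> smooth_on S g \<Longrightarrow> smooth_on S (\<lambda>x. f x *\<^sub>R g x)"
  by (simp add: smooth_on_open Ck_on_bilinear[OF _ bounded_bilinear_scaleR])

lemma smooth_on_mult [smooth_intros]:
  fixes f g :: "'a::euclidean_space \<Rightarrow> real"
  shows "open S \<Longrightarrow> smooth_on S f \<Longrightarrow> smooth_on S g \<Longrightarrow> smooth_on S (\<lambda>x. f x * g x)"
  by (simp add: smooth_on_open Ck_on_bilinear[OF _ bounded_bilinear_mult])

lemma smooth_on_minus [smooth_intros]:
  "open S \<Longrightarrow> smooth_on S f \<Longrightarrow> smooth_on S (\<lambda>x. - f x)"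
  by (rule smooth_on_bounded_linear[OF _ bounded_linear_minus[OF bounded_linear_ident]])

lemma smooth_on_diff [smooth_intros]:
  "open S \<Longrightarrow> smooth_on S f \<Longrightarrow> smooth_on S g \<Longrightarrow> smooth_on S (\<lambda>x. f x - g x)"
  using smooth_on_add[of S f "\<lambda>x. - g x"] smooth_on_minus[of S g] by simp

lemma smooth_on_divide [smooth_intros]:
  fixes f g :: "'a::euclidean_space \<Rightarrow> real"
  assumes "open S" "smooth_on S f" "smooth_on S g" "\<And>x. x \<in> S \<Longrightarrow> g x \<noteq> 0"
  shows "smooth_on S (\<lambda>x. f x / g x)"
proof -
  have "open {x::real. x \<noteq> 0}" by (simp add: open_Collect_neq continuous_on_const continuous_on_id)
  then have "smooth_on {x::real. x \<noteq> 0} inverse"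
    by (simp add: smooth_on_open Ck_on_inverse)
  then have "smooth_on S (\<lambda>x. inverse (g x))"
    by (rule smooth_on_compose[OF assms(3)]) (use assms(4) in auto)
  then show ?thesis
    unfolding divide_inverse by (intro smooth_intros assms)
qed

lemma smooth_on_Pair [smooth_intros]:
  assumes "open S" "smooth_on S f" "smooth_on S g"
  shows "smooth_on S (\<lambda>x. (f x, g x))"
proof -
  have "smooth_on S (\<lambda>x. (f x, 0) + (0, g x))"
    by (intro smooth_on_add assms
        smooth_on_bounded_linear[OF _ bounded_linear_Pair[OF bounded_linear_ident bounded_linear_zero]]
        smooth_on_bounded_linear[OF _ bounded_linear_Pair[OF bounded_linear_zero bounded_linear_ident]])
  then show ?thesis by simp
qed

lemma smooth_on_fst [smooth_intros]: "open S \<Longrightarrow> smooth_on S f \<Longrightarrow> smooth_on S (\<lambda>x. fst (f x))"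
  by (rule smooth_on_bounded_linear[OF _ bounded_linear_fst])

lemma smooth_on_snd [smooth_intros]: "open S \<Longrightarrow> smooth_on S f \<Longrightarrow> smooth_on S (\<lambda>x. snd (f x))"
  by (rule smooth_on_bounded_linear[OF _ bounded_linear_snd])

lemma smooth_on_vec_nth [smooth_intros]: "open S \<Longrightarrow> smooth_on S f \<Longrightarrow> smooth_on S (\<lambda>x. f x $ i)"
  by (rule smooth_on_bounded_linear[OF _ bounded_linear_vec_nth])

lemma smooth_on_inner [smooth_intros]:
  "open S \<Longrightarrow> smooth_on S f \<Longrightarrow> smooth_on S g \<Longrightarrow> smooth_on S (\<lambda>x. f x \<bullet> g x)"
  by (simp add: smooth_on_open Ck_on_bilinear[OF _ bounded_bilinear_inner])

lemma smooth_on_imp_continuous_on: "open S \<Longrightarrow> smooth_on S f \<Longrightarrow> continuous_on S f"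
  using smooth_on_open[of S f] Ck_on.simps(1) by blast

text \<open>
  The direction comes first, so that \<open>dirderiv v\<close> is an operator on functions.
\<close>

definition dirderiv :: "'a::euclidean_space \<Rightarrow> ('a \<Rightarrow> 'b::euclidean_space) \<Rightarrow> 'a \<Rightarrow> 'b" where
  "dirderiv v f x = frechet_derivative f (at x) v"

lemma dirderiv_eq: "(f has_derivative f') (at x) \<Longrightarrow> dirderiv v f x = f' v"
  unfolding dirderiv_def by (metis frechet_derivative_at)

lemma smooth_on_has_derivative:
  "open S \<Longrightarrow> smooth_on S f \<Longrightarrow> x \<in> S \<Longrightarrow> (f has_derivative (\<lambda>v. dirderiv v f x)) (at x)"
  unfolding dirderiv_def using Ck_on_Suc_has_derivative[of 0 S f x] smooth_on_open[of S f] by blast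

lemma dirderiv_cong:
  assumes "open S" "x \<in> S" "\<And>y. y \<in> S \<Longrightarrow> f y = g y" "smooth_on S f"
  shows "dirderiv v f x = dirderiv v g x"
  using has_derivative_transform_within_open[OF smooth_on_has_derivative[OF assms(1,4,2)] assms(1,2)]
    assms(3) by (metis dirderiv_eq)

lemma linear_dirderiv: "open S \<Longrightarrow> smooth_on S f \<Longrightarrow> x \<in> S \<Longrightarrow> linear (\<lambda>v. dirderiv v f x)"
  using smooth_on_has_derivative has_derivative_linear by blast

lemma smooth_on_dirderiv_const:
  assumes "open S" "smooth_on S f"
  shows "smooth_on S (dirderiv v f)"
proof -
  have "Ck_on k S (\<lambda>x. frechet_derivative f (at x) v)" for k
    using assms smooth_on_open[of S f] Ck_on.simps(2) by blast
  moreover have "dirderiv v f = (\<lambda>x. frechet_derivative f (at x) v)"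
    by (simp add: fun_eq_iff dirderiv_def)
  ultimately show ?thesis using assms(1) by (simp add: smooth_on_open)
qed

text \<open>
  The derivative along a variable direction is a combination of the derivatives along a basis, with
  smooth coefficients; this reduces the claim to constant directions.
\<close>

lemma smooth_on_dirderiv_at [smooth_intros]:
  assumes S: "open S" and T: "open T" and f: "smooth_on T f" and A: "smooth_on S A"
    and h: "smooth_on S h" "h ` S \<subseteq> T"
  shows "smooth_on S (\<lambda>x. dirderiv (A x) f (h x))"
proof -
  have "smooth_on S (\<lambda>x. \<Sum>b\<in>Basis. (A x \<bullet> b) *\<^sub>R dirderiv b f (h x))"
    by (intro smooth_intros S A smooth_on_compose[OF h(1) smooth_on_dirderiv_const[OF T f]] h)
  moreover have "(\<Sum>b\<in>Basis. (A x \<bullet> b) *\<^sub>R dirderiv b f (h x)) = dirderiv (A x) f (h x)" if "x \<in> S" for x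
    using that h(2) linear_eq_sum_Basis[OF linear_dirderiv[OF T f, of "h x"]]
    by (metis image_subset_iff)
  ultimately show ?thesis by (rule smooth_on_cong)
qed

lemma dirderiv_compose:
  assumes "open S" "smooth_on S f" "x \<in> S" "open T" "smooth_on T g" "f x \<in> T"
  shows "dirderiv v (\<lambda>x. g (f x)) x = dirderiv (dirderiv v f x) g (f x)"
  by (rule dirderiv_eq[OF has_derivative_compose[OF smooth_on_has_derivative[OF assms(1,2,3)]
        smooth_on_has_derivative[OF assms(4,5,6)]]])

lemma dirderiv_bounded_linear:
  assumes "open S" "smooth_on S f" "x \<in> S" "bounded_linear L"
  shows "dirderiv v (\<lambda>x. L (f x)) x = L (dirderiv v f x)"
  by (rule dirderiv_eq[OF bounded_linear.has_derivative[OF assms(4)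
        smooth_on_has_derivative[OF assms(1,2,3)]]])

lemma dirderiv_const [simp]: "dirderiv v (\<lambda>_. c) x = 0"
  by (rule dirderiv_eq) simp

lemma dirderiv_mult:
  fixes f g :: "'a::euclidean_space \<Rightarrow> real"
  assumes "open S" "smooth_on S f" "smooth_on S g" "x \<in> S"
  shows "dirderiv v (\<lambda>x. f x * g x) x = f x * dirderiv v g x + dirderiv v f x * g x"
  by (rule dirderiv_eq[OF has_derivative_mult[OF smooth_on_has_derivative[OF assms(1,2,4)]
        smooth_on_has_derivative[OF assms(1,3,4)]]])

lemma dirderiv_diff:
  assumes "open S" "smooth_on S f" "smooth_on S g" "x \<in> S"
  shows "dirderiv v (\<lambda>x. f x - g x) x = dirderiv v f x - dirderiv v g x"
  by (rule dirderiv_eq[OF has_derivative_diff[OF smooth_on_has_derivative[OF assms(1,2,4)]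
        smooth_on_has_derivative[OF assms(1,3,4)]]])

section \<open>Mean values and second derivatives\<close>

lemma has_vector_derivative_compose_smooth:
  assumes "(c has_vector_derivative c') (at t)" "open S" "smooth_on S f" "c t \<in> S"
  shows "((\<lambda>t. f (c t)) has_vector_derivative dirderiv c' f (c t)) (at t)"
proof -
  have "(c has_derivative (\<lambda>h. h *\<^sub>R c')) (at t)"
    using assms(1) by (simp add: has_vector_derivative_def)
  from has_derivative_compose[OF this smooth_on_has_derivative[OF assms(2-4)]] show ?thesis
    using linear_scale[OF linear_dirderiv[OF assms(2-4)]] by (simp add: has_vector_derivative_def)
qed

lemma has_vector_derivative_along_line:
  assumes "open S" "smooth_on S f" "x + t *\<^sub>R v \<in> S"
  shows "((\<lambda>t. f (x + t *\<^sub>R v)) has_vector_derivative dirderiv v f (x + t *\<^sub>R v)) (at t)"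
proof -
  have "((\<lambda>t. x + t *\<^sub>R v) has_derivative (\<lambda>h. h *\<^sub>R v)) (at t)"
    by (auto intro!: derivative_eq_intros)
  from has_derivative_compose[OF this smooth_on_has_derivative[OF assms]]
  show ?thesis
    using linear_scale[OF linear_dirderiv[OF assms]] by (simp add: has_vector_derivative_def)
qed

text \<open>
  The mean value theorem is applied twice: to the difference of \<open>f\<close> along two parallel sides of a
  parallelogram, and then to the derivative of \<open>f\<close> on a segment that joins them.
\<close>

lemma second_difference_mean_value:
  fixes f :: "'a::euclidean_space \<Rightarrow> real"
  assumes S: "open S" and f: "smooth_on S f" and "0 < s"
    and inS: "\<And>a b. a \<in> {0..s} \<Longrightarrow> b \<in> {0..s} \<Longrightarrow> p + a *\<^sub>R v + b *\<^sub>R w \<in> S"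
  shows "\<exists>a\<in>{0..s}. \<exists>b\<in>{0..s}.
    f (p + s *\<^sub>R v + s *\<^sub>R w) - f (p + s *\<^sub>R v) - f (p + s *\<^sub>R w) + f p
      = s * s * dirderiv w (dirderiv v f) (p + a *\<^sub>R v + b *\<^sub>R w)"
proof -
  let ?G = "\<lambda>a. f ((p + s *\<^sub>R w) + a *\<^sub>R v) - f (p + a *\<^sub>R v)"
  let ?G' = "\<lambda>a. dirderiv v f ((p + s *\<^sub>R w) + a *\<^sub>R v) - dirderiv v f (p + a *\<^sub>R v)"
  have "(?G has_real_derivative ?G' a) (at a)" if "0 \<le> a" "a \<le> s" for a
    using inS[of a s] inS[of a 0] that
    by (intro DERIV_diff has_vector_derivative_along_line[OF S f, folded has_real_derivative_iff_has_vector_derivative])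
      (auto simp: algebra_simps)
  from MVT2[OF \<open>0 < s\<close> this] obtain a where a: "0 < a" "a < s" "?G s - ?G 0 = s * ?G' a"
    by auto
  let ?H = "\<lambda>b. dirderiv v f ((p + a *\<^sub>R v) + b *\<^sub>R w)"
  have "(?H has_real_derivative dirderiv w (dirderiv v f) ((p + a *\<^sub>R v) + b *\<^sub>R w)) (at b)"
    if "0 \<le> b" "b \<le> s" for b
    using inS[of a b] that a
    by (intro has_vector_derivative_along_line[OF S smooth_on_dirderiv_const[OF S f],
          folded has_real_derivative_iff_has_vector_derivative]) auto
  from MVT2[OF \<open>0 < s\<close> this] obtain b where
    b: "0 < b" "b < s" "?H s - ?H 0 = s * dirderiv w (dirderiv v f) ((p + a *\<^sub>R v) + b *\<^sub>R w)"
    by auto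
  have "?G' a = ?H s - ?H 0" by (simp add: algebra_simps)
  then have "?G s - ?G 0 = s * (s * dirderiv w (dirderiv v f) ((p + a *\<^sub>R v) + b *\<^sub>R w))"
    using a(3) b(3) by simp
  then show ?thesis
    using a b by (intro bexI[of _ a] bexI[of _ b]) (auto simp: algebra_simps)
qed

text \<open>
  The second difference is symmetric in \<open>v\<close> and \<open>w\<close>, so both mixed derivatives take a common value
  on every small parallelogram at \<open>p\<close>.  They are continuous, hence they cannot differ at \<open>p\<close>.
\<close>

lemma dirderiv_commute_real:
  fixes f :: "'a::euclidean_space \<Rightarrow> real"
  assumes S: "open S" and f: "smooth_on S f" and p: "p \<in> S"
  shows "dirderiv w (dirderiv v f) p = dirderiv v (dirderiv w f) p"
proof (rule ccontr)
  let ?A = "dirderiv w (dirderiv v f)" and ?B = "dirderiv v (dirderiv w f)"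
  assume "?A p \<noteq> ?B p"
  then have \<eta>: "\<bar>?A p - ?B p\<bar> / 2 > 0" by simp
  have cont: "isCont (dirderiv a (dirderiv b f)) p" for a b
    using smooth_on_imp_continuous_on[OF S smooth_on_dirderiv_const[OF S smooth_on_dirderiv_const[OF S f]]]
      continuous_on_eq_continuous_at[OF S] p by blast
  obtain d1 where d1: "d1 > 0" "\<And>x. dist x p < d1 \<Longrightarrow> \<bar>?A x - ?A p\<bar> < \<bar>?A p - ?B p\<bar> / 2"
    using cont[of w v] \<eta> unfolding continuous_at_eps_delta dist_real_def by metis
  obtain d2 where d2: "d2 > 0" "\<And>x. dist x p < d2 \<Longrightarrow> \<bar>?B x - ?B p\<bar> < \<bar>?A p - ?B p\<bar> / 2"
    using cont[of v w] \<eta> unfolding continuous_at_eps_delta dist_real_def by metis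
  obtain d3 where d3: "d3 > 0" "ball p d3 \<subseteq> S" using S p openE by blast
  define d where "d = min d1 (min d2 d3)"
  define s where "s = d / (2 * (norm v + norm w + 1))"
  have "d > 0" using d1 d2 d3 by (simp add: d_def)
  have nz: "norm v + norm w + 1 > 0" by (simp add: add_nonneg_pos)
  then have "s > 0" using \<open>d > 0\<close> by (simp add: s_def)
  have near: "dist (p + a *\<^sub>R v + b *\<^sub>R w) p < d" if "a \<in> {0..s}" "b \<in> {0..s}" for a b
  proof -
    have "norm (a *\<^sub>R v + b *\<^sub>R w) \<le> a * norm v + b * norm w"
      using that norm_triangle_ineq[of "a *\<^sub>R v" "b *\<^sub>R w"] by simp
    also have "\<dots> \<le> s * norm v + s * norm w"
      using that by (intro add_mono mult_right_mono) auto
    also have "\<dots> \<le> s * (norm v + norm w + 1)" using \<open>s > 0\<close> by (simp add: algebra_simps)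
    also have "\<dots> = d / 2" using nz by (simp add: s_def field_simps)
    finally show ?thesis using \<open>d > 0\<close> by (simp add: dist_norm add.assoc)
  qed
  have inS: "p + a *\<^sub>R v + b *\<^sub>R w \<in> S" if "a \<in> {0..s}" "b \<in> {0..s}" for a b
    using near[OF that] d3(2) by (auto simp: d_def dist_commute subset_iff)
  obtain a b where ab: "a \<in> {0..s}" "b \<in> {0..s}"
    "f (p + s *\<^sub>R v + s *\<^sub>R w) - f (p + s *\<^sub>R v) - f (p + s *\<^sub>R w) + f p
      = s * s * ?A (p + a *\<^sub>R v + b *\<^sub>R w)"
    using second_difference_mean_value[OF S f \<open>s > 0\<close> inS] by blast
  have inS': "p + a *\<^sub>R w + b *\<^sub>R v \<in> S" if "a \<in> {0..s}" "b \<in> {0..s}" for a b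
    using inS[OF that(2,1)] by (simp add: algebra_simps)
  obtain a' b' where ab': "a' \<in> {0..s}" "b' \<in> {0..s}"
    "f (p + s *\<^sub>R w + s *\<^sub>R v) - f (p + s *\<^sub>R w) - f (p + s *\<^sub>R v) + f p
      = s * s * ?B (p + a' *\<^sub>R w + b' *\<^sub>R v)"
    using second_difference_mean_value[OF S f \<open>s > 0\<close> inS'] by blast
  have "s * s * ?A (p + a *\<^sub>R v + b *\<^sub>R w) = s * s * ?B (p + b' *\<^sub>R v + a' *\<^sub>R w)"
    using ab(3) ab'(3) by (simp add: algebra_simps)
  then have "?A (p + a *\<^sub>R v + b *\<^sub>R w) = ?B (p + b' *\<^sub>R v + a' *\<^sub>R w)"
    using \<open>s > 0\<close> by simp
  moreover have "\<bar>?A (p + a *\<^sub>R v + b *\<^sub>R w) - ?A p\<bar> < \<bar>?A p - ?B p\<bar> / 2"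
    by (rule d1(2)) (use near[OF ab(1,2)] in \<open>simp add: d_def\<close>)
  moreover have "\<bar>?B (p + b' *\<^sub>R v + a' *\<^sub>R w) - ?B p\<bar> < \<bar>?A p - ?B p\<bar> / 2"
    by (rule d2(2)) (use near[OF ab'(2,1)] in \<open>simp add: d_def\<close>)
  ultimately show False by (simp add: abs_if split: if_splits)
qed

lemma dirderiv_commute:
  fixes f :: "'a::euclidean_space \<Rightarrow> 'b::euclidean_space"
  assumes S: "open S" and f: "smooth_on S f" and p: "p \<in> S"
  shows "dirderiv w (dirderiv v f) p = dirderiv v (dirderiv w f) p"
proof (rule euclidean_eqI)
  fix b :: 'b
  note L = bounded_linear_inner_left[of b]
  have fb: "smooth_on S (\<lambda>x. f x \<bullet> b)" by (rule smooth_on_bounded_linear[OF S L f])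
  have inner: "dirderiv w' (dirderiv v' f) p \<bullet> b = dirderiv w' (dirderiv v' (\<lambda>x. f x \<bullet> b)) p" for v' w'
  proof -
    have "dirderiv w' (dirderiv v' f) p \<bullet> b = dirderiv w' (\<lambda>x. dirderiv v' f x \<bullet> b) p"
      by (rule dirderiv_bounded_linear[OF S smooth_on_dirderiv_const[OF S f] p L, symmetric])
    also have "\<dots> = dirderiv w' (dirderiv v' (\<lambda>x. f x \<bullet> b)) p"
      by (rule dirderiv_cong[OF S p])
        (auto intro!: dirderiv_bounded_linear[OF S f _ L, symmetric]
          smooth_on_bounded_linear[OF S L] smooth_on_dirderiv_const S f)
    finally show ?thesis .
  qed
  show "dirderiv w (dirderiv v f) p \<bullet> b = dirderiv v (dirderiv w f) p \<bullet> b"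
    unfolding inner by (rule dirderiv_commute_real[OF S fb p])
qed

lemma dirderiv_sum_Basis:
  "open S \<Longrightarrow> smooth_on S f \<Longrightarrow> x \<in> S \<Longrightarrow> dirderiv v f x = (\<Sum>b\<in>Basis. (v \<bullet> b) *\<^sub>R dirderiv b f x)"
  by (rule linear_eq_sum_Basis[OF linear_dirderiv])

text \<open>
  The bracket of the constant field \<open>w\<close> with the field \<open>A\<close> is the derivative of \<open>A\<close> along \<open>w\<close>,
  so the last term is the action of the bracket on \<open>h\<close>.
\<close>

lemma dirderiv_along_field:
  fixes h :: "'a::euclidean_space \<Rightarrow> 'b::euclidean_space"
  assumes S: "open S" and h: "smooth_on S h" and A: "smooth_on S A" and q: "q \<in> S"
  shows "dirderiv w (\<lambda>q. dirderiv (A q) h q) q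
    = dirderiv (A q) (dirderiv w h) q + dirderiv (dirderiv w A q) h q"
proof -
  note sb = smooth_on_dirderiv_const[OF S h]
  have Ab: "smooth_on S (\<lambda>q. A q \<bullet> b)" for b
    by (intro smooth_on_inner S A smooth_on_const)
  have "dirderiv w (\<lambda>q. dirderiv (A q) h q) q
      = dirderiv w (\<lambda>q. \<Sum>b\<in>Basis. (A q \<bullet> b) *\<^sub>R dirderiv b h q) q"
    by (rule dirderiv_cong[OF S q])
      (use S h A in \<open>auto intro!: smooth_intros dirderiv_sum_Basis\<close>)
  also have "\<dots> = (\<Sum>b\<in>Basis. (A q \<bullet> b) *\<^sub>R dirderiv w (dirderiv b h) q + (dirderiv w A q \<bullet> b) *\<^sub>R dirderiv b h q)"
  proof (rule dirderiv_eq[OF has_derivative_sum[where f' = "\<lambda>b v. (A q \<bullet> b) *\<^sub>R dirderiv v (dirderiv b h) q + (dirderiv v A q \<bullet> b) *\<^sub>R dirderiv b h q"]])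
    fix b :: 'a
    have "((\<lambda>q. A q \<bullet> b) has_derivative (\<lambda>v. dirderiv v A q \<bullet> b)) (at q)"
      by (rule bounded_linear.has_derivative[OF bounded_linear_inner_left smooth_on_has_derivative[OF S A q]])
    from has_derivative_scaleR[OF this smooth_on_has_derivative[OF S sb q]]
    show "((\<lambda>q. (A q \<bullet> b) *\<^sub>R dirderiv b h q) has_derivative
        (\<lambda>v. (A q \<bullet> b) *\<^sub>R dirderiv v (dirderiv b h) q + (dirderiv v A q \<bullet> b) *\<^sub>R dirderiv b h q)) (at q)" .
  qed
  also have "\<dots> = (\<Sum>b\<in>Basis. (A q \<bullet> b) *\<^sub>R dirderiv b (dirderiv w h) q)
      + (\<Sum>b\<in>Basis. (dirderiv w A q \<bullet> b) *\<^sub>R dirderiv b h q)"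
    by (simp add: sum.distrib dirderiv_commute[OF S h q, of w])
  also have "\<dots> = dirderiv (A q) (dirderiv w h) q + dirderiv (dirderiv w A q) h q"
    using dirderiv_sum_Basis[OF S sb q] dirderiv_sum_Basis[OF S h q] by metis
  finally show ?thesis .
qed

lemma dirderiv_zero_on:
  assumes "open S" "q \<in> S" "\<And>x. x \<in> S \<Longrightarrow> f x = 0"
  shows "dirderiv v f q = 0"
  using dirderiv_cong[OF assms(1,2), of "\<lambda>_. 0" f v] assms(3) by (simp add: smooth_on_const)

lemma dirderiv_slice:
  assumes "open \<Omega>" "smooth_on \<Omega> \<Phi>" "(t, q) \<in> \<Omega>"
  shows "dirderiv (0, v) \<Phi> (t, q) = dirderiv v (\<lambda>x. \<Phi> (t, x)) q"
    "dirderiv (s, 0) \<Phi> (t, q) = dirderiv s (\<lambda>x. \<Phi> (x, q)) t"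
proof -
  note der = smooth_on_has_derivative[OF assms]
  have "((\<lambda>x. (t, x)) has_derivative (\<lambda>v. (0, v))) (at q)"
    by (intro has_derivative_Pair has_derivative_const has_derivative_ident)
  from has_derivative_compose[OF this der] show "dirderiv (0, v) \<Phi> (t, q) = dirderiv v (\<lambda>x. \<Phi> (t, x)) q"
    by (rule dirderiv_eq[symmetric])
  have "((\<lambda>x. (x, q)) has_derivative (\<lambda>s. (s, 0))) (at t)"
    by (intro has_derivative_Pair has_derivative_const has_derivative_ident)
  from has_derivative_compose[OF this der] show "dirderiv (s, 0) \<Phi> (t, q) = dirderiv s (\<lambda>x. \<Phi> (x, q)) t"
    by (rule dirderiv_eq[symmetric])
qed

lemma has_vector_derivative_slice:
  assumes "open \<Omega>" "smooth_on \<Omega> \<Phi>" "(t::real, q) \<in> \<Omega>"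
  shows "((\<lambda>s. \<Phi> (s, q)) has_vector_derivative dirderiv (1, 0) \<Phi> (t, q)) (at t)"
proof -
  have "((\<lambda>s. (s, q)) has_vector_derivative (1, 0)) (at t)"
    by (intro has_vector_derivative_Pair has_vector_derivative_const has_vector_derivative_id)
  from has_vector_derivative_compose_smooth[OF this assms] show ?thesis .
qed

lemma smooth_on_locally_lipschitz:
  fixes f :: "'a::euclidean_space \<Rightarrow> 'b::euclidean_space"
  assumes S: "open S" and f: "smooth_on S f" and p: "p \<in> S"
  obtains r K where "0 < r" "ball p r \<subseteq> S"
    "\<And>x y. x \<in> ball p r \<Longrightarrow> y \<in> ball p r \<Longrightarrow> norm (f x - f y) \<le> K * norm (x - y)"
proof -
  obtain r where r: "0 < r" "cball p r \<subseteq> S" using S p open_contains_cball by blast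
  have "\<exists>M. \<forall>x\<in>cball p r. norm (dirderiv b f x) \<le> M" for b
  proof -
    have "continuous_on (cball p r) (dirderiv b f)"
      using smooth_on_imp_continuous_on[OF S smooth_on_dirderiv_const[OF S f]] r(2)
      by (rule continuous_on_subset)
    from compact_imp_bounded[OF compact_continuous_image[OF this compact_cball]]
    show ?thesis by (auto simp: bounded_iff)
  qed
  then obtain M where M: "\<And>b x. x \<in> cball p r \<Longrightarrow> norm (dirderiv b f x) \<le> M b" by metis
  have bound: "onorm (\<lambda>v. dirderiv v f x) \<le> (\<Sum>b\<in>Basis. M b)" if "x \<in> ball p r" for x
  proof (rule onorm_le)
    fix v
    have xS: "x \<in> S" and xc: "x \<in> cball p r" using that r(2) by auto
    have "norm (dirderiv v f x) \<le> (\<Sum>b\<in>Basis. norm ((v \<bullet> b) *\<^sub>R dirderiv b f x))"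
      unfolding dirderiv_sum_Basis[OF S f xS, of v] by (rule norm_sum)
    also have "\<dots> \<le> (\<Sum>b\<in>Basis. norm v * M b)"
      using M[OF xc] by (intro sum_mono) (auto intro!: mult_mono Basis_le_norm)
    finally show "norm (dirderiv v f x) \<le> (\<Sum>b\<in>Basis. M b) * norm v"
      by (simp add: sum_distrib_left mult.commute)
  qed
  have "norm (f x - f y) \<le> (\<Sum>b\<in>Basis. M b) * norm (x - y)"
    if "x \<in> ball p r" "y \<in> ball p r" for x y
    by (rule differentiable_bound[OF convex_ball _ bound that])
      (use r(2) in \<open>auto intro!: has_derivative_at_withinI smooth_on_has_derivative[OF S f]\<close>)
  moreover have "ball p r \<subseteq> S" using r(2) ball_subset_cball by blast
  ultimately show thesis using that r(1) by blast
qed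

section \<open>Uniqueness of integral curves\<close>

text \<open>
  The function \<open>exp (- 2 * K * t) * (u t \<bullet> u t)\<close> is nonnegative, decreases, and starts at \<open>0\<close>.
\<close>

lemma zero_if_derivative_bounded_forward:
  fixes u :: "real \<Rightarrow> 'a::real_inner"
  assumes "a \<le> b" and "u a = 0"
    and der: "\<And>t. t \<in> {a..b} \<Longrightarrow> (u has_vector_derivative u' t) (at t)"
    and bound: "\<And>t. t \<in> {a..b} \<Longrightarrow> norm (u' t) \<le> K * norm (u t)"
  shows "u b = 0"
proof -
  let ?v = "\<lambda>t. exp (- 2 * K * t) * (u t \<bullet> u t)"
  have "\<exists>y. (?v has_real_derivative y) (at t) \<and> y \<le> 0" if "a \<le> t" "t \<le> b" for t
  proof -
    have t: "t \<in> {a..b}" using that by simp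
    have "((\<lambda>t. u t \<bullet> u t) has_derivative (\<lambda>h. u t \<bullet> (h *\<^sub>R u' t) + (h *\<^sub>R u' t) \<bullet> u t)) (at t)"
      using der[OF t] unfolding has_vector_derivative_def by (intro has_derivative_inner)
    then have "((\<lambda>t. u t \<bullet> u t) has_derivative (*) (2 * (u t \<bullet> u' t))) (at t)"
      by (rule has_derivative_eq_rhs) (auto simp: fun_eq_iff inner_commute algebra_simps)
    then have "((\<lambda>t. u t \<bullet> u t) has_real_derivative 2 * (u t \<bullet> u' t)) (at t)"
      by (simp add: has_field_derivative_def)
    then have "(?v has_real_derivative
        exp (- 2 * K * t) * (2 * (u t \<bullet> u' t) - 2 * K * (u t \<bullet> u t))) (at t)"
      by (auto intro!: derivative_eq_intros simp: algebra_simps)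
    moreover have "u t \<bullet> u' t \<le> norm (u t) * (K * norm (u t))"
      using norm_cauchy_schwarz[of "u t" "u' t"] mult_left_mono[OF bound[OF t] norm_ge_zero[of "u t"]]
      by linarith
    then have "2 * (u t \<bullet> u' t) - 2 * K * (u t \<bullet> u t) \<le> 0"
      by (simp add: power2_norm_eq_inner[symmetric] power2_eq_square algebra_simps)
    ultimately show ?thesis using mult_nonneg_nonpos[OF exp_ge_zero] by blast
  qed
  from DERIV_nonpos_imp_nonincreasing[OF \<open>a \<le> b\<close> this]
  have "?v b \<le> ?v a" .
  then have "exp (- 2 * K * b) * (u b \<bullet> u b) \<le> 0" using \<open>u a = 0\<close> by simp
  then have "u b \<bullet> u b \<le> 0" by (simp add: mult_le_0_iff)
  then show ?thesis using inner_ge_zero[of "u b"] by (metis antisym inner_eq_zero_iff)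
qed

lemma zero_if_derivative_bounded:
  fixes u :: "real \<Rightarrow> 'a::real_inner"
  assumes "u a = 0"
    and der: "\<And>t. t \<in> closed_segment a b \<Longrightarrow> (u has_vector_derivative u' t) (at t)"
    and bound: "\<And>t. t \<in> closed_segment a b \<Longrightarrow> norm (u' t) \<le> K * norm (u t)"
  shows "u b = 0"
proof (cases "a \<le> b")
  case True
  then show ?thesis
    using zero_if_derivative_bounded_forward[of a b u u' K] assms by (simp add: closed_segment_eq_real_ivl)
next
  case False
  have seg: "- t \<in> closed_segment a b" if "t \<in> {- a..- b}" for t
    using that False by (auto simp: closed_segment_eq_real_ivl)
  have "(u \<circ> uminus) (- b) = 0"
  proof (rule zero_if_derivative_bounded_forward[of "- a" "- b" "u \<circ> uminus" "\<lambda>t. - u' (- t)" K])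
    fix t assume "t \<in> {- a..- b}"
    have "(uminus has_vector_derivative - 1) (at t)"
      by (auto intro!: derivative_eq_intros)
    from vector_diff_chain_at[OF this der[OF seg[OF \<open>t \<in> {- a..- b}\<close>]]]
    show "(u \<circ> uminus has_vector_derivative - u' (- t)) (at t)" by simp
  qed (use False assms seg in auto)
  then show ?thesis by simp
qed

lemma zero_derivative_along_segment:
  fixes h :: "'a::euclidean_space \<Rightarrow> 'b::euclidean_space"
  assumes B: "open B" "convex B" and h: "smooth_on B h" and q: "q \<in> B" "q + s *\<^sub>R v \<in> B"
    and 0: "\<And>x. x \<in> B \<Longrightarrow> dirderiv v h x = 0"
  shows "h (q + s *\<^sub>R v) = h q"
proof -
  have "(\<lambda>a. h (q + a *\<^sub>R v) - h q) s = 0"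
  proof (rule zero_if_derivative_bounded[of _ 0 s "\<lambda>_. 0" 0])
    fix a assume a: "a \<in> closed_segment 0 s"
    then obtain \<theta> where \<theta>: "0 \<le> \<theta>" "\<theta> \<le> 1" "a = \<theta> * s" by (auto simp: in_segment)
    have "(1 - \<theta>) *\<^sub>R q + \<theta> *\<^sub>R (q + s *\<^sub>R v) \<in> B"
      using B(2) q \<theta> by (intro convexD) auto
    then have "q + a *\<^sub>R v \<in> B" using \<theta>(3) by (simp add: algebra_simps)
    from has_vector_derivative_along_line[OF B(1) h this]
    show "((\<lambda>a. h (q + a *\<^sub>R v) - h q) has_vector_derivative 0) (at a)"
      using 0[OF \<open>q + a *\<^sub>R v \<in> B\<close>] by (auto intro!: derivative_eq_intros)
  qed auto
  then show ?thesis by simp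
qed

lemma integral_curves_agree:
  fixes c d :: "real \<Rightarrow> 'a::euclidean_space"
  assumes "c a = d a"
    and lip: "\<And>x y. x \<in> B \<Longrightarrow> y \<in> B \<Longrightarrow> norm (Y x - Y y) \<le> K * norm (x - y)"
    and c: "\<And>t. t \<in> closed_segment a b \<Longrightarrow> c t \<in> B \<and> (c has_vector_derivative Y (c t)) (at t)"
    and d: "\<And>t. t \<in> closed_segment a b \<Longrightarrow> d t \<in> B \<and> (d has_vector_derivative Y (d t)) (at t)"
  shows "c b = d b"
proof -
  have "(\<lambda>t. c t - d t) b = 0"
    by (rule zero_if_derivative_bounded[of _ a b "\<lambda>t. Y (c t) - Y (d t)" K])
      (use assms in \<open>auto intro!: has_vector_derivative_diff\<close>)
  then show ?thesis by simp
qed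

lemma open_contains_flow_box:
  fixes p :: "'a::topological_space"
  assumes "open \<Omega>" "(0::real, p) \<in> \<Omega>"
  obtains \<delta> N where "0 < \<delta>" "open N" "p \<in> N" "{-\<delta><..<\<delta>} \<times> N \<subseteq> \<Omega>"
proof -
  obtain J N where JN: "open J" "open N" "(0, p) \<in> J \<times> N" "J \<times> N \<subseteq> \<Omega>"
    using open_prod_elim[OF assms] by metis
  obtain \<delta> where \<delta>: "0 < \<delta>" "ball 0 \<delta> \<subseteq> J" using JN(1,3) openE by blast
  have "{-\<delta><..<\<delta>} \<subseteq> J" using \<delta>(2) by (auto simp: dist_real_def subset_iff)
  then show thesis using JN \<delta>(1) by (intro that[of \<delta> N]) auto
qed

lemma continuous_contains_flow_box:
  assumes "0 < (\<epsilon>::real)" "open N" "p \<in> N" "continuous_on ({-\<epsilon><..<\<epsilon>} \<times> N) f" "open B" "f (0, p) \<in> B"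
  obtains \<delta> N' where "0 < \<delta>" "\<delta> \<le> \<epsilon>" "open N'" "p \<in> N'" "N' \<subseteq> N"
    "\<And>t q. \<bar>t\<bar> < \<delta> \<Longrightarrow> q \<in> N' \<Longrightarrow> f (t, q) \<in> B"
proof -
  let ?\<Omega> = "({-\<epsilon><..<\<epsilon>} \<times> N) \<inter> f -` B"
  have "open ?\<Omega>"
    using assms by (intro continuous_open_preimage open_Times open_greaterThanLessThan)
  then obtain \<delta> N' where *: "0 < \<delta>" "open N'" "p \<in> N'" "{-\<delta><..<\<delta>} \<times> N' \<subseteq> ?\<Omega>"
    using open_contains_flow_box[of ?\<Omega> p] assms by auto
  show thesis
  proof (rule that[of "min \<delta> \<epsilon>" N'])
    have box: "(t, q) \<in> ?\<Omega>" if "\<bar>t\<bar> < \<delta>" "q \<in> N'" for t q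
      using that by (intro subsetD[OF *(4)]) (auto simp: abs_less_iff)
    show "N' \<subseteq> N" using box[of 0] *(1) by auto
    show "f (t, q) \<in> B" if "\<bar>t\<bar> < min \<delta> \<epsilon>" "q \<in> N'" for t q
      using box[of t q] that by auto
  qed (use * assms(1) in auto)
qed

section \<open>Infinitesimal symmetries on open sets\<close>

lemma tangent_space_openin:
  assumes "openin (top_of_set M) V" "p \<in> V"
  shows "tangent_space V p = tangent_space M p"
proof
  have "V \<subseteq> M" using assms(1) openin_imp_subset by blast
  then show "tangent_space V p \<subseteq> tangent_space M p" unfolding tangent_space_def by blast
  obtain O' where O': "open O'" "V = M \<inter> O'" using assms(1) by (auto simp: openin_open)
  show "tangent_space M p \<subseteq> tangent_space V p"
  proof
    fix v assume "v \<in> tangent_space M p"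
    then obtain \<gamma> \<epsilon> where \<gamma>: "0 < \<epsilon>" "\<gamma> ` {-\<epsilon><..<\<epsilon>} \<subseteq> M" "\<gamma> 0 = p" "(\<gamma> has_vector_derivative v) (at (0::real))"
      unfolding tangent_space_def by blast
    have "isCont \<gamma> 0" using \<gamma>(4) by (rule has_vector_derivative_continuous)
    moreover have "\<gamma> 0 \<in> O'" using \<gamma>(3) assms(2) O'(2) by auto
    ultimately have "\<forall>\<^sub>F t in at 0. \<gamma> t \<in> O'" using O'(1) by (auto simp: isCont_def topological_tendstoD)
    then obtain d where d: "d > 0" "\<And>t. t \<noteq> 0 \<Longrightarrow> \<bar>t\<bar> < d \<Longrightarrow> \<gamma> t \<in> O'"
      unfolding eventually_at by (auto simp: dist_real_def)
    have "\<gamma> t \<in> V" if "t \<in> {- min d \<epsilon><..<min d \<epsilon>}" for t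
    proof -
      have "t \<in> {-\<epsilon><..<\<epsilon>}" "\<bar>t\<bar> < d"
        using that unfolding greaterThanLessThan_iff by linarith+
      then show ?thesis using \<gamma>(2) \<open>\<gamma> 0 \<in> O'\<close> O'(2) d(2)[of t] by (cases "t = 0") blast+
    qed
    then have "\<gamma> ` {- min d \<epsilon><..<min d \<epsilon>} \<subseteq> V"
      by blast
    then show "v \<in> tangent_space V p"
      using \<gamma> d(1) unfolding tangent_space_def by (auto intro!: exI[of _ \<gamma>] exI[of _ "min d \<epsilon>"])
  qed
qed

lemma smooth_on_flow_time:
  assumes "smooth_on (J \<times> N) (\<lambda>(t, q). \<psi> t q)" "t \<in> J"
  shows "smooth_on N (\<psi> t)"
proof -
  have "smooth_on N (\<lambda>q. (t, q))"
    by (rule smooth_on_subset[of UNIV]) (auto intro!: smooth_intros)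
  from smooth_on_compose[OF this assms(1)] show ?thesis using assms(2) by auto
qed

lemma smooth_on_slice:
  assumes "smooth_on (J \<times> N) \<Phi>" "t \<in> J"
  shows "smooth_on N (\<lambda>q. \<Phi> (t, q))"
  using smooth_on_flow_time[of J N "\<lambda>t q. \<Phi> (t, q)" t] assms by simp

lemma tangent_space_open:
  assumes "open W" "p \<in> W"
  shows "tangent_space W p = UNIV"
proof -
  have "v \<in> tangent_space UNIV p" for v
    unfolding tangent_space_def
    by (auto intro!: exI[of _ "\<lambda>t. p + t *\<^sub>R v"] exI[of _ 1] derivative_eq_intros)
  then show ?thesis using tangent_space_openin[of UNIV W p] assms by auto
qed

text \<open>
  The inverse of \<open>\<psi> t\<close> is \<open>\<psi> (- t)\<close>, because \<open>s \<mapsto> \<psi> s q\<close> and \<open>s \<mapsto> \<psi> (s - t) (\<psi> t q)\<close> are integral curves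
  that agree at \<open>s = t\<close>.  The set \<open>N'\<close> is so small that both stay where the field is Lipschitz, and
  \<open>N''\<close> so small that \<open>\<psi> t\<close> can be composed with its inverse.
\<close>

lemma local_flow_inverse:
  assumes W: "open W" and Y: "smooth_on W Y" and \<psi>: "local_flow W Y \<epsilon> N \<psi>" and p: "p \<in> N"
  obtains \<delta> N' N'' where "0 < \<delta>" "\<delta> \<le> \<epsilon>" "open N'" "N' \<subseteq> N" "open N''" "p \<in> N''" "N'' \<subseteq> N'"
    "\<And>t q. \<bar>t\<bar> < \<delta> \<Longrightarrow> q \<in> N'' \<Longrightarrow> \<psi> t q \<in> N'"
    "\<And>t q. \<bar>t\<bar> < \<delta> \<Longrightarrow> q \<in> N' \<Longrightarrow> \<psi> t q \<in> N' \<Longrightarrow> \<psi> (- t) (\<psi> t q) = q"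
proof -
  let ?f = "\<lambda>(t, q). \<psi> t q"
  have \<epsilon>: "0 < \<epsilon>" and N: "open N" "N \<subseteq> W" and sm: "smooth_on ({-\<epsilon><..<\<epsilon>} \<times> N) ?f"
    and \<psi>0: "\<And>q. q \<in> N \<Longrightarrow> \<psi> 0 q = q"
    and der: "\<And>t q. \<bar>t\<bar> < \<epsilon> \<Longrightarrow> q \<in> N \<Longrightarrow> ((\<lambda>s. \<psi> s q) has_vector_derivative Y (\<psi> t q)) (at t)"
    using \<psi> openin_open_eq[OF W] unfolding local_flow_def by (auto simp: abs_less_iff)
  have cont: "continuous_on ({-\<epsilon><..<\<epsilon>} \<times> N) ?f"
    by (rule smooth_on_imp_continuous_on[OF _ sm]) (intro open_Times N open_greaterThanLessThan)
  obtain r K where r: "0 < r" "ball p r \<subseteq> W"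
    and lip: "\<And>x y. x \<in> ball p r \<Longrightarrow> y \<in> ball p r \<Longrightarrow> norm (Y x - Y y) \<le> K * norm (x - y)"
    using smooth_on_locally_lipschitz[OF W Y, of p] N(2) p by blast
  have "?f (0, p) \<in> ball p r" using \<psi>0 p r(1) by simp
  then obtain \<delta>1 N' where N': "0 < \<delta>1" "\<delta>1 \<le> \<epsilon>" "open N'" "p \<in> N'" "N' \<subseteq> N"
      "\<And>t q. \<bar>t\<bar> < \<delta>1 \<Longrightarrow> q \<in> N' \<Longrightarrow> \<psi> t q \<in> ball p r"
    using continuous_contains_flow_box[OF \<epsilon> N(1) p cont open_ball] by (metis case_prod_conv)
  have "?f (0, p) \<in> N'" using \<psi>0 p N'(4) by simp
  moreover have "continuous_on ({-\<delta>1<..<\<delta>1} \<times> N') ?f"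
    by (rule continuous_on_subset[OF cont]) (use N'(2,5) in auto)
  ultimately obtain \<delta>2 N'' where N'': "0 < \<delta>2" "\<delta>2 \<le> \<delta>1" "open N''" "p \<in> N''" "N'' \<subseteq> N'"
      "\<And>t q. \<bar>t\<bar> < \<delta>2 \<Longrightarrow> q \<in> N'' \<Longrightarrow> \<psi> t q \<in> N'"
    using continuous_contains_flow_box[OF N'(1) N'(3,4) _ N'(3), of ?f] by (metis case_prod_conv)
  show thesis
  proof (rule that[of \<delta>2 N' N''])
    fix t q assume t: "\<bar>t\<bar> < \<delta>2" and q: "q \<in> N'" "\<psi> t q \<in> N'"
    have seg: "\<bar>s\<bar> < \<delta>1 \<and> \<bar>s - t\<bar> < \<delta>1" if "s \<in> closed_segment t 0" for s
      using that t N''(2) by (auto simp: closed_segment_eq_real_ivl split: if_splits)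
    have "(\<lambda>s. \<psi> (s - t) (\<psi> t q)) 0 = (\<lambda>s. \<psi> s q) 0"
    proof (rule integral_curves_agree[where a = t and B = "ball p r" and Y = Y and K = K])
      show "\<psi> (t - t) (\<psi> t q) = \<psi> t q" using q(2) N'(5) \<psi>0 by auto
      fix s assume s: "s \<in> closed_segment t 0"
      have "((\<lambda>s. \<psi> s q) has_vector_derivative Y (\<psi> s q)) (at s)"
        using der[of s q] seg[OF s] N'(2,5) q(1) by auto
      then show "\<psi> s q \<in> ball p r \<and> ((\<lambda>s. \<psi> s q) has_vector_derivative Y (\<psi> s q)) (at s)"
        using N'(6) q(1) seg[OF s] by auto
      have d: "((\<lambda>s. \<psi> s (\<psi> t q)) has_vector_derivative Y (\<psi> (s - t) (\<psi> t q))) (at (s - t))"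
        using der[of "s - t" "\<psi> t q"] seg[OF s] N'(2,5) q(2) by auto
      have "((\<lambda>s. s - t) has_vector_derivative 1) (at s)"
        by (auto intro!: derivative_eq_intros)
      from vector_diff_chain_at[OF this d]
      have "((\<lambda>s. \<psi> (s - t) (\<psi> t q)) has_vector_derivative Y (\<psi> (s - t) (\<psi> t q))) (at s)"
        by (simp add: o_def)
      then show "\<psi> (s - t) (\<psi> t q) \<in> ball p r \<and>
          ((\<lambda>s. \<psi> (s - t) (\<psi> t q)) has_vector_derivative Y (\<psi> (s - t) (\<psi> t q))) (at s)"
        using N'(6) q(2) seg[OF s] by auto
    qed (rule lip)
    then show "\<psi> (- t) (\<psi> t q) = q" using \<psi>0 q(1) N'(5) by auto
  qed (use N' N'' in auto)
qed

lemma local_flow_shrink: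
  assumes "local_flow M Y \<epsilon> N \<psi>" "0 < \<delta>" "\<delta> \<le> \<epsilon>" "openin (top_of_set M) N'" "N' \<subseteq> N"
  shows "local_flow M Y \<delta> N' \<psi>"
proof -
  have "smooth_on ({-\<delta><..<\<delta>} \<times> N') (\<lambda>(t, q). \<psi> t q)"
    by (rule smooth_on_subset[of "{-\<epsilon><..<\<epsilon>} \<times> N"]) (use assms in \<open>auto simp: local_flow_def\<close>)
  then show ?thesis using assms unfolding local_flow_def by auto
qed

text \<open>
  On an open set it suffices that the differentials of the flow map the distribution into itself.
  The flow maps are local diffeomorphisms after shrinking, with inverses in the flow; as the inverse
  also maps the distribution into itself, the inclusion is an equality.
\<close>

lemma infinitesimal_symmetry_openI:
  assumes W: "open W" and Y: "smooth_on W Y"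
    and flow: "\<And>p. p \<in> W \<Longrightarrow> \<exists>\<epsilon> N \<psi>. p \<in> N \<and> local_flow W Y \<epsilon> N \<psi> \<and>
      (\<forall>t\<in>{-\<epsilon><..<\<epsilon>}. \<forall>q\<in>N. \<forall>v\<in>D q. dirderiv v (\<psi> t) q \<in> D (\<psi> t q))"
  shows "infinitesimal_symmetry W D Y"
  unfolding infinitesimal_symmetry_def
proof (intro conjI ballI)
  show "vector_field_on W Y"
    using Y tangent_space_open[OF W] by (auto simp: vector_field_on_def)
  fix p assume "p \<in> W"
  then obtain \<epsilon> N \<psi> where p: "p \<in> N" and \<psi>: "local_flow W Y \<epsilon> N \<psi>"
    and D: "\<And>t q v. \<bar>t\<bar> < \<epsilon> \<Longrightarrow> q \<in> N \<Longrightarrow> v \<in> D q \<Longrightarrow> dirderiv v (\<psi> t) q \<in> D (\<psi> t q)"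
    using flow by (metis abs_less_iff greaterThanLessThan_iff minus_less_iff)
  have N: "open N" "N \<subseteq> W" and sm: "smooth_on ({-\<epsilon><..<\<epsilon>} \<times> N) (\<lambda>(t, q). \<psi> t q)"
    using \<psi> openin_open_eq[OF W] unfolding local_flow_def by auto
  obtain \<delta> N' N'' where \<delta>: "0 < \<delta>" "\<delta> \<le> \<epsilon>"
    and N': "open N'" "N' \<subseteq> N" "open N''" "p \<in> N''" "N'' \<subseteq> N'"
    and into: "\<And>t q. \<bar>t\<bar> < \<delta> \<Longrightarrow> q \<in> N'' \<Longrightarrow> \<psi> t q \<in> N'"
    and inv: "\<And>t q. \<bar>t\<bar> < \<delta> \<Longrightarrow> q \<in> N' \<Longrightarrow> \<psi> t q \<in> N' \<Longrightarrow> \<psi> (- t) (\<psi> t q) = q"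
    using local_flow_inverse[OF W Y \<psi> p] by metis
  have smt: "smooth_on N (\<psi> t)" if "\<bar>t\<bar> < \<delta>" for t
    using that \<delta>(2) by (intro smooth_on_flow_time[OF sm]) (auto simp: abs_less_iff)
  have "local_symmetry W D N'' (\<psi> t)" if t: "\<bar>t\<bar> < \<delta>" for t
  proof -
    have t': "\<bar>- t\<bar> < \<delta>" using t by simp
    have inv1: "\<psi> (- t) (\<psi> t q) = q" if "q \<in> N''" for q
      using inv[OF t _ into[OF t that]] that N'(5) by auto
    have inv2: "\<psi> t (\<psi> (- t) q) = q" if "q \<in> N'" "\<psi> (- t) q \<in> N''" for q
      using inv[OF t' that(1)] that(2) N'(5) by auto
    \<comment> \<open>The image is a preimage under the inverse flow map, hence open.\<close>
    have img: "\<psi> t ` N'' = N' \<inter> \<psi> (- t) -` N''"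
      using into[OF t] inv1 inv2 by (auto simp: image_iff) (metis inv2)
    have "open (\<psi> t ` N'')"
      unfolding img
      using smooth_on_imp_continuous_on[OF N(1) smt[OF t']] N'
      by (intro continuous_open_preimage) (auto intro: continuous_on_subset)
    moreover have sub: "\<psi> t ` N'' \<subseteq> N" "N'' \<subseteq> N" using img N' by auto
    ultimately have "local_diffeo W N'' (\<psi> t)"
      unfolding local_diffeo_def
      using N N' sub smooth_on_subset[OF smt[OF t] sub(2)] smooth_on_subset[OF smt[OF t'] sub(1)] inv1
      by (auto simp: openin_open_eq[OF W] intro!: exI[of _ "\<psi> (- t)"])
    moreover have "\<exists>A. (\<psi> t has_derivative A) (at q within N'') \<and> A ` D q = D (\<psi> t q)"
      if q: "q \<in> N''" for q
    proof (intro exI conjI)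
      have qN: "q \<in> N" and q': "\<psi> t q \<in> N" using q sub by auto
      show "(\<psi> t has_derivative (\<lambda>v. dirderiv v (\<psi> t) q)) (at q within N'')"
        by (rule has_derivative_at_withinI[OF smooth_on_has_derivative[OF N(1) smt[OF t] qN]])
      show "(\<lambda>v. dirderiv v (\<psi> t) q) ` D q = D (\<psi> t q)"
      proof
        show "(\<lambda>v. dirderiv v (\<psi> t) q) ` D q \<subseteq> D (\<psi> t q)"
          using D[of t q] t \<delta>(2) qN by auto
        show "D (\<psi> t q) \<subseteq> (\<lambda>v. dirderiv v (\<psi> t) q) ` D q"
        proof
          fix v assume v: "v \<in> D (\<psi> t q)"
          have "dirderiv v (\<psi> (- t)) (\<psi> t q) \<in> D q"
            using D[of "- t" "\<psi> t q" v] t \<delta>(2) q' v inv1[OF q] by auto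
          moreover have "dirderiv (dirderiv v (\<psi> (- t)) (\<psi> t q)) (\<psi> t) q = v"
          proof -
            have "dirderiv (dirderiv v (\<psi> (- t)) (\<psi> t q)) (\<psi> t) (\<psi> (- t) (\<psi> t q))
                = dirderiv v (\<lambda>x. \<psi> t (\<psi> (- t) x)) (\<psi> t q)"
              using inv1[OF q] qN
              by (intro dirderiv_compose[OF N(1) smt[OF t'] q' N(1) smt[OF t], symmetric]) simp
            also have "\<dots> = dirderiv v (\<lambda>x. x) (\<psi> t q)"
              by (rule dirderiv_cong[OF \<open>open (\<psi> t ` N'')\<close>, symmetric])
                (use q inv1 in \<open>auto intro: smooth_on_id\<close>)
            also have "\<dots> = v" by (rule dirderiv_eq) simp
            finally show ?thesis using inv1[OF q] by simp
          qed
          ultimately show "v \<in> (\<lambda>v. dirderiv v (\<psi> t) q) ` D q" by force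
        qed
      qed
    qed
    ultimately show ?thesis unfolding local_symmetry_def by blast
  qed
  moreover have "local_flow W Y \<delta> N'' \<psi>"
    using local_flow_shrink[OF \<psi> \<delta>] N N' by (auto simp: openin_open_eq[OF W])
  ultimately show "\<exists>\<epsilon> N \<phi>. p \<in> N \<and> local_flow W Y \<epsilon> N \<phi> \<and>
      (\<forall>t\<in>{-\<epsilon><..<\<epsilon>}. local_symmetry W D N (\<phi> t))"
    using N'(4) by (intro exI[of _ \<delta>] exI[of _ N''] exI[of _ \<psi>]) (auto simp: abs_less_iff)
qed

section \<open>Restricting external symmetries\<close>

lemma monge_equation_iff: "a \<in> monge_equation U F \<longleftrightarrow> fst a \<in> U \<and> snd a = F (fst a)"
  by (cases a) (simp add: monge_equation_def)

lemma tangent_space_monge_equation: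
  assumes U: "open U" and F: "smooth_on U F" and a: "a \<in> monge_equation U F"
  shows "v \<in> tangent_space (monge_equation U F) a \<longleftrightarrow> snd v = dirderiv (fst v) F (fst a)"
proof -
  have aU: "fst a \<in> U" and sa: "snd a = F (fst a)" using a by (auto simp: monge_equation_iff)
  show ?thesis
  proof
    assume "v \<in> tangent_space (monge_equation U F) a"
    then obtain \<gamma> \<epsilon> where \<gamma>: "0 < \<epsilon>" "\<gamma> ` {-\<epsilon><..<\<epsilon>} \<subseteq> monge_equation U F" "\<gamma> 0 = a"
        "(\<gamma> has_vector_derivative v) (at (0::real))"
      unfolding tangent_space_def by blast
    have 1: "((\<lambda>t. fst (\<gamma> t)) has_vector_derivative fst v) (at 0)"
      "((\<lambda>t. snd (\<gamma> t)) has_vector_derivative snd v) (at 0)"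
      using bounded_linear.has_vector_derivative[OF bounded_linear_fst \<gamma>(4)]
        bounded_linear.has_vector_derivative[OF bounded_linear_snd \<gamma>(4)] by auto
    have "((\<lambda>t. F (fst (\<gamma> t))) has_vector_derivative dirderiv (fst v) F (fst a)) (at 0)"
      using has_vector_derivative_compose_smooth[OF 1(1) U F] \<gamma>(3) aU by simp
    moreover have "0 \<in> {-\<epsilon><..<\<epsilon>}" using \<gamma>(1) by simp
    moreover have "F (fst (\<gamma> t)) = snd (\<gamma> t)" if "t \<in> {-\<epsilon><..<\<epsilon>}" for t
      using \<gamma>(2) that by (auto simp: monge_equation_iff image_subset_iff)
    ultimately have "((\<lambda>t. snd (\<gamma> t)) has_vector_derivative dirderiv (fst v) F (fst a)) (at 0)"
      by (rule has_vector_derivative_transform_within_open[OF _ open_greaterThanLessThan])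
    then show "snd v = dirderiv (fst v) F (fst a)"
      using 1(2) vector_derivative_unique_at by blast
  next
    assume v: "snd v = dirderiv (fst v) F (fst a)"
    let ?l = "\<lambda>t. fst a + t *\<^sub>R fst v"
    have l: "(?l has_vector_derivative fst v) (at t)" for t
      by (auto intro!: derivative_eq_intros)
    have "isCont ?l 0" by (intro continuous_intros)
    then have "\<forall>\<^sub>F t in at 0. ?l t \<in> U" using U aU by (auto simp: isCont_def intro!: topological_tendstoD)
    then obtain d where d: "d > 0" "\<And>t. t \<noteq> 0 \<Longrightarrow> \<bar>t\<bar> < d \<Longrightarrow> ?l t \<in> U"
      unfolding eventually_at by (auto simp: dist_real_def)
    have "?l t \<in> U" if "\<bar>t\<bar> < d" for t using d(2)[of t] that aU by (cases "t = 0") auto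
    then have "(\<lambda>t. (?l t, F (?l t))) ` {-d<..<d} \<subseteq> monge_equation U F"
      by (auto simp: monge_equation_iff abs_less_iff)
    moreover have "((\<lambda>t. (?l t, F (?l t))) has_vector_derivative v) (at 0)"
    proof -
      have "(fst v, dirderiv (fst v) F (fst a)) = v" using v by (simp add: prod_eq_iff)
      then show ?thesis
        using has_vector_derivative_Pair[OF l has_vector_derivative_compose_smooth[OF l U F], of 0] aU
        by simp
    qed
    moreover have "(?l 0, F (?l 0)) = a" using sa by (simp add: prod_eq_iff)
    ultimately show "v \<in> tangent_space (monge_equation U F) a"
      unfolding tangent_space_def using d(1)
      by (auto intro!: exI[of _ "\<lambda>t. (?l t, F (?l t))"] exI[of _ d])
  qed
qed

text \<open>
  Let \<open>G = y\<^sub>m - F\<close>.  The field is tangent to the equation, so the derivative \<open>H\<close> of \<open>G\<close> along it vanishes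
  where \<open>G\<close> does, and therefore \<open>\<bar>H\<bar> \<le> K \<bar>G\<bar>\<close> locally.  Along an integral curve \<open>H\<close> is the derivative
  of \<open>G\<close>.  So if \<open>G\<close> vanishes at one point of the curve, it vanishes on the whole curve.
\<close>

lemma flow_preserves_monge_equation:
  fixes F :: "real ^ 'e \<Rightarrow> real"
  assumes U: "open U" and F: "smooth_on U F" and W: "open W" and Y: "smooth_on W Y"
    and tangent: "\<And>a. a \<in> monge_equation U F \<inter> W \<Longrightarrow> Y a \<in> tangent_space (monge_equation U F) a"
    and \<psi>: "local_flow W Y \<epsilon> N \<psi>" and p: "p \<in> N" "p \<in> monge_equation U F"
  obtains \<delta> N' where "0 < \<delta>" "\<delta> \<le> \<epsilon>" "open N'" "p \<in> N'" "N' \<subseteq> N"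
    "\<And>t a. \<bar>t\<bar> < \<delta> \<Longrightarrow> a \<in> N' \<Longrightarrow> \<psi> t a \<in> monge_equation U F \<longleftrightarrow> a \<in> monge_equation U F"
proof -
  let ?E = "monge_equation U F" and ?f = "\<lambda>(t, q). \<psi> t q"
  let ?G = "\<lambda>a. snd a - F (fst a)"
  define H where "H = (\<lambda>a. dirderiv (Y a) ?G a)"
  have \<epsilon>: "0 < \<epsilon>" and N: "open N" "N \<subseteq> W" and sm: "smooth_on ({-\<epsilon><..<\<epsilon>} \<times> N) ?f"
    and \<psi>0: "\<And>q. q \<in> N \<Longrightarrow> \<psi> 0 q = q"
    and der: "\<And>t q. \<bar>t\<bar> < \<epsilon> \<Longrightarrow> q \<in> N \<Longrightarrow> ((\<lambda>s. \<psi> s q) has_vector_derivative Y (\<psi> t q)) (at t)"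
    using \<psi> openin_open_eq[OF W] unfolding local_flow_def by (auto simp: abs_less_iff)
  let ?O = "W \<inter> (U \<times> UNIV)"
  have O: "open ?O" using U W by (intro open_Int open_Times) auto
  have F': "smooth_on ?O (\<lambda>a. F (fst a))"
    by (rule smooth_on_compose[OF _ F]) (auto intro!: smooth_intros O)
  have G: "smooth_on ?O ?G" by (intro smooth_intros O F')
  have H: "smooth_on ?O H"
    unfolding H_def by (intro smooth_on_dirderiv_at[OF O O G] smooth_on_id smooth_on_subset[OF Y]) auto
  have H0: "H a = 0" if "a \<in> ?E" "a \<in> W" for a
  proof -
    have aO: "a \<in> ?O" using that by (cases a) (auto simp: monge_equation_iff)
    have "dirderiv v ?G a = snd v - dirderiv (fst v) F (fst a)" for v
    proof (rule dirderiv_eq)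
      have "(fst has_derivative fst) (at a)" by (rule bounded_linear_imp_has_derivative[OF bounded_linear_fst])
      from has_derivative_compose[OF this smooth_on_has_derivative[OF U F]] aO
      have "((\<lambda>a. F (fst a)) has_derivative (\<lambda>v. dirderiv (fst v) F (fst a))) (at a)" by auto
      then show "(?G has_derivative (\<lambda>v. snd v - dirderiv (fst v) F (fst a))) (at a)"
        by (intro has_derivative_diff bounded_linear_imp_has_derivative[OF bounded_linear_snd])
    qed
    then show ?thesis
      using tangent[of a] that tangent_space_monge_equation[OF U F] by (simp add: H_def)
  qed
  have pO: "p \<in> ?O" using p N by (cases p) (auto simp: monge_equation_iff)
  obtain r K where r: "0 < r" "ball p r \<subseteq> ?O"
    and lip: "\<And>x y. x \<in> ball p r \<Longrightarrow> y \<in> ball p r \<Longrightarrow> norm (H x - H y) \<le> K * norm (x - y)"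
    using smooth_on_locally_lipschitz[OF O H pO] by blast
  \<comment> \<open>The estimate compares a point with the point of the equation above the same \<open>q\<close>, so both
    have to lie in the ball on which \<open>H\<close> is Lipschitz.\<close>
  define B where "B = ball p r \<inter> (\<lambda>a. (fst a, F (fst a))) -` ball p r"
  have "continuous_on (ball p r) (\<lambda>a. (fst a, F (fst a)))"
    using smooth_on_imp_continuous_on[OF O F'] r(2)
    by (auto intro!: continuous_intros intro: continuous_on_subset)
  then have B: "open B" unfolding B_def by (intro continuous_open_preimage open_ball)
  have "(fst p, F (fst p)) = p" using p(2) by (simp add: monge_equation_iff prod_eq_iff)
  then have pB: "p \<in> B" using r(1) by (simp add: B_def)
  have HG: "\<bar>H a\<bar> \<le> K * \<bar>?G a\<bar>" if "a \<in> B" for a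
  proof -
    let ?a = "(fst a, F (fst a))"
    have "?a \<in> ?O" using that r(2) by (auto simp: B_def)
    then have "H ?a = 0" by (intro H0) (auto simp: monge_equation_iff)
    moreover have "norm (H a - H ?a) \<le> K * norm (a - ?a)"
      using that by (intro lip) (auto simp: B_def)
    ultimately show ?thesis by (cases a) (simp add: norm_Pair)
  qed
  have cont: "continuous_on ({-\<epsilon><..<\<epsilon>} \<times> N) ?f"
    by (rule smooth_on_imp_continuous_on[OF _ sm]) (intro open_Times N open_greaterThanLessThan)
  have "?f (0, p) \<in> B" using \<psi>0 p(1) pB by simp
  then obtain \<delta> N' where N': "0 < \<delta>" "\<delta> \<le> \<epsilon>" "open N'" "p \<in> N'" "N' \<subseteq> N"
      "\<And>t q. \<bar>t\<bar> < \<delta> \<Longrightarrow> q \<in> N' \<Longrightarrow> \<psi> t q \<in> B"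
    using continuous_contains_flow_box[OF \<epsilon> N(1) p(1) cont B] by (metis case_prod_conv)
  show thesis
  proof (rule that[OF N'(1-5)])
    fix t a assume t: "\<bar>t\<bar> < \<delta>" and a: "a \<in> N'"
    have zero: "?G (\<psi> s' a) = 0" if "?G (\<psi> s a) = 0" "\<bar>s\<bar> < \<delta>" "\<bar>s'\<bar> < \<delta>" for s s'
    proof (rule zero_if_derivative_bounded[of "\<lambda>s. ?G (\<psi> s a)", OF that(1)])
      fix x assume "x \<in> closed_segment s s'"
      then have x: "\<bar>x\<bar> < \<delta>" using that by (auto simp: closed_segment_eq_real_ivl split: if_splits)
      then have xB: "\<psi> x a \<in> B" using N'(6) a by blast
      then have xO: "\<psi> x a \<in> ?O" using r(2) by (auto simp: B_def)
      have "((\<lambda>s. \<psi> s a) has_vector_derivative Y (\<psi> x a)) (at x)"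
        using der[of x a] x N'(2,5) a by auto
      from has_vector_derivative_compose_smooth[OF this O G xO]
      show "((\<lambda>s. ?G (\<psi> s a)) has_vector_derivative H (\<psi> x a)) (at x)" by (simp add: H_def)
      show "norm (H (\<psi> x a)) \<le> K * norm (?G (\<psi> x a))" using HG[OF xB] by simp
    qed
    have "\<psi> s a \<in> ?E \<longleftrightarrow> ?G (\<psi> s a) = 0" if "\<bar>s\<bar> < \<delta>" for s
      using N'(6)[OF that a] r(2) by (cases "\<psi> s a") (auto simp: B_def monge_equation_iff)
    moreover have "\<psi> 0 a = a" using \<psi>0 a N'(5) by blast
    ultimately show "\<psi> t a \<in> ?E \<longleftrightarrow> a \<in> ?E"
      using zero[of 0 t] zero[of t 0] t N'(1) by (metis abs_zero)
  qed
qed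

text \<open>
  The flow of the external symmetry preserves the equation in both time directions.  So its
  restriction has an open image in the equation, and its differential maps the tangent space of the
  equation, and with it the induced distribution, onto the one at the image point.
\<close>

lemma induced_symmetry_is_internal:
  fixes F :: "real ^ 'e::finite \<Rightarrow> real"
  assumes U: "open U" and F: "smooth_on U F"
    and V: "openin (top_of_set (monge_equation U F)) V"
    and X: "X \<in> induced_symmetries m n l (monge_equation U F) V"
  shows "X \<in> internal_symmetries m n l (monge_equation U F) V"
proof -
  let ?E = "monge_equation U F" and ?C = "cartan m n l"
  have VE: "V \<subseteq> ?E" using V openin_imp_subset by blast
  have extension: "\<exists>W Y. p \<in> W \<and> ?E \<inter> W \<subseteq> V \<and> open W \<and> infinitesimal_symmetry W ?C Y \<and>
      (\<forall>q\<in>?E \<inter> W. Y q \<in> tangent_space ?E q) \<and> (\<forall>q\<in>?E \<inter> W. X q = Y q)" if "p \<in> V" for p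
    using X that unfolding induced_symmetries_def external_symmetry_def lie_field_def by blast
  have "smooth_on V X"
  proof (rule smooth_onI_local)
    fix p assume "p \<in> V"
    then obtain W Y where "p \<in> W" "open W" "infinitesimal_symmetry W ?C Y" "\<forall>q\<in>?E \<inter> W. X q = Y q"
      using extension[OF \<open>p \<in> V\<close>] by blast
    then show "\<exists>W g. open W \<and> p \<in> W \<and> smooth_on W g \<and> (\<forall>q\<in>V \<inter> W. g q = X q)"
      using VE unfolding infinitesimal_symmetry_def vector_field_on_def
      by (intro exI[of _ W] exI[of _ Y]) auto
  qed
  moreover have "X p \<in> tangent_space V p" if "p \<in> V" for p
    using extension[OF that] tangent_space_openin[OF V that] that VE by auto
  moreover have "\<exists>\<epsilon> N \<phi>. p \<in> N \<and> local_flow V X \<epsilon> N \<phi> \<and>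
      (\<forall>t\<in>{-\<epsilon><..<\<epsilon>}. local_symmetry V (monge_distribution m n l ?E) N (\<phi> t))" if pV: "p \<in> V" for p
  proof -
    obtain W Y where W: "p \<in> W" "?E \<inter> W \<subseteq> V" "open W" "infinitesimal_symmetry W ?C Y"
      and tangent: "\<And>q. q \<in> ?E \<inter> W \<Longrightarrow> Y q \<in> tangent_space ?E q"
      and XY: "\<And>q. q \<in> ?E \<inter> W \<Longrightarrow> X q = Y q"
      using extension[OF pV] by blast
    have Y: "smooth_on W Y" using W(4) by (simp add: infinitesimal_symmetry_def vector_field_on_def)
    obtain \<epsilon> N \<psi> where p: "p \<in> N" and \<psi>: "local_flow W Y \<epsilon> N \<psi>"
      and sym: "\<And>t. t \<in> {-\<epsilon><..<\<epsilon>} \<Longrightarrow> local_symmetry W ?C N (\<psi> t)"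
      using W(1,4) unfolding infinitesimal_symmetry_def by blast
    have N: "open N" "N \<subseteq> W" using \<psi> openin_open_eq[OF W(3)] by (auto simp: local_flow_def)
    have "p \<in> ?E" using pV VE by blast
    from flow_preserves_monge_equation[OF U F W(3) Y tangent \<psi> p this]
    obtain \<delta> N' where \<delta>: "0 < \<delta>" "\<delta> \<le> \<epsilon>" and N': "open N'" "p \<in> N'" "N' \<subseteq> N"
      and inE: "\<And>t a. \<bar>t\<bar> < \<delta> \<Longrightarrow> a \<in> N' \<Longrightarrow> \<psi> t a \<in> ?E \<longleftrightarrow> a \<in> ?E"
      by blast
    define M where "M = ?E \<inter> N'"
    have MV: "M = V \<inter> N'" using VE W(2) N N' by (auto simp: M_def)
    have MN: "M \<subseteq> N" using N' by (auto simp: M_def)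
    have openM: "openin (top_of_set V) M" unfolding MV using N'(1) by (rule openin_open_Int)
    have into: "\<psi> t a \<in> ?E \<inter> W" if "\<bar>t\<bar> < \<delta>" "a \<in> M" for t a
      using that inE[of t a] N' \<psi> \<delta>(2) by (auto simp: M_def local_flow_def abs_less_iff)
    have flow: "local_flow V X \<delta> M \<psi>"
      unfolding local_flow_def
    proof (intro conjI ballI)
      show "smooth_on ({-\<delta><..<\<delta>} \<times> M) (\<lambda>(t, q). \<psi> t q)"
        by (rule smooth_on_subset[of "{-\<epsilon><..<\<epsilon>} \<times> N"]) (use \<psi> \<delta> MN in \<open>auto simp: local_flow_def\<close>)
      show "\<psi> 0 q = q" if "q \<in> M" for q using \<psi> MN that unfolding local_flow_def by blast
      fix q t assume qt: "q \<in> M" "t \<in> {-\<delta><..<\<delta>}"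
      then have *: "\<psi> t q \<in> ?E \<inter> W" by (intro into) (auto simp: abs_less_iff)
      then show "\<psi> t q \<in> V" using W(2) by blast
      show "((\<lambda>s. \<psi> s q) has_vector_derivative X (\<psi> t q)) (at t)"
        unfolding XY[OF *] using \<psi> qt \<delta>(2) MN by (auto simp: local_flow_def)
    qed (use \<delta> openM in auto)
    have "local_symmetry V (monge_distribution m n l ?E) M (\<psi> t)" if t: "t \<in> {-\<delta><..<\<delta>}" for t
    proof -
      have t': "\<bar>t\<bar> < \<delta>" "t \<in> {-\<epsilon><..<\<epsilon>}" using t \<delta>(2) by auto
      obtain g where img: "open (\<psi> t ` N)" "\<psi> t ` N \<subseteq> W" and sm: "smooth_on N (\<psi> t)"
        and g: "smooth_on (\<psi> t ` N) g" "\<And>q. q \<in> N \<Longrightarrow> g (\<psi> t q) = q"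
        using sym[OF t'(2)] openin_open_eq[OF W(3)] unfolding local_symmetry_def local_diffeo_def by auto
      have der: "\<exists>A. (\<psi> t has_derivative A) (at q within N) \<and> A ` ?C q = ?C (\<psi> t q)" if "q \<in> N" for q
        using sym[OF t'(2)] that unfolding local_symmetry_def by blast
      have "\<psi> t ` M = V \<inter> (\<psi> t ` N \<inter> g -` N')"
      proof
        show "\<psi> t ` M \<subseteq> V \<inter> (\<psi> t ` N \<inter> g -` N')"
          using into[OF t'(1)] W(2) MN g(2) by (auto simp: M_def)
        show "V \<inter> (\<psi> t ` N \<inter> g -` N') \<subseteq> \<psi> t ` M"
        proof
          fix a assume a: "a \<in> V \<inter> (\<psi> t ` N \<inter> g -` N')"
          then obtain q where q: "q \<in> N" "a = \<psi> t q" by blast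
          then have "q \<in> N'" using a g(2) by auto
          moreover have "a \<in> ?E" using a VE by blast
          ultimately show "a \<in> \<psi> t ` M" using q inE[OF t'(1), of q] by (auto simp: M_def)
        qed
      qed
      moreover have "open (\<psi> t ` N \<inter> g -` N')"
        using smooth_on_imp_continuous_on[OF img(1) g(1)] img(1) N'(1) by (rule continuous_open_preimage)
      ultimately have openimg: "openin (top_of_set V) (\<psi> t ` M)" by (simp add: openin_open_Int)
      have "local_diffeo V M (\<psi> t)"
        unfolding local_diffeo_def
        using openM openimg smooth_on_subset[OF sm MN] smooth_on_subset[OF g(1) image_mono[OF MN]] g(2) MN
        by blast
      moreover have "\<exists>A. (\<psi> t has_derivative A) (at q within M) \<and>
          A ` monge_distribution m n l ?E q = monge_distribution m n l ?E (\<psi> t q)" if q: "q \<in> M" for q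
      proof -
        have qN: "q \<in> N" "q \<in> V" and tq: "\<psi> t q \<in> ?E \<inter> W"
          using q MN MV into[OF t'(1) q] by auto
        obtain A where A: "(\<psi> t has_derivative A) (at q within N)" "A ` ?C q = ?C (\<psi> t q)"
          using der[OF qN(1)] by blast
        have A': "A = (\<lambda>v. dirderiv v (\<psi> t) q)"
          using A(1) at_within_open[OF qN(1) N(1)]
          by (metis has_derivative_unique smooth_on_has_derivative[OF N(1) sm qN(1)])
        have left_inverse: "dirderiv (A v) g (\<psi> t q) = v" for v
        proof -
          have "dirderiv (A v) g (\<psi> t q) = dirderiv v (\<lambda>x. g (\<psi> t x)) q"
            unfolding A' using qN(1) by (intro dirderiv_compose[OF N(1) sm qN(1) img(1) g(1), symmetric]) simp
          also have "\<dots> = dirderiv v (\<lambda>x. x) q"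
            by (rule dirderiv_cong[OF N(1) qN(1), symmetric]) (auto simp: g(2) intro: smooth_on_id)
          also have "\<dots> = v" by (rule dirderiv_eq) simp
          finally show ?thesis .
        qed
        \<comment> \<open>Used both for the flow map and for its inverse.\<close>
        have push: "dirderiv v f a \<in> tangent_space B (f a)"
          if "open S" "smooth_on S f" "a \<in> S" "openin (top_of_set V) M'" "M' \<subseteq> S" "f ` M' \<subseteq> B" "a \<in> M'"
            "v \<in> tangent_space V a"
          for f :: "'e jet \<Rightarrow> 'e jet" and S M' B a v
        proof -
          have "v \<in> tangent_space M' a" using tangent_space_openin[OF that(4,7)] that(8) by simp
          then obtain \<gamma> \<epsilon> where \<gamma>: "0 < \<epsilon>" "\<gamma> ` {-\<epsilon><..<\<epsilon>} \<subseteq> M'" "\<gamma> 0 = a"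
              "(\<gamma> has_vector_derivative v) (at (0::real))"
            unfolding tangent_space_def by blast
          have "((\<lambda>s. f (\<gamma> s)) has_vector_derivative dirderiv v f a) (at 0)"
            using has_vector_derivative_compose_smooth[OF \<gamma>(4) that(1,2)] \<gamma>(3) that(3) by simp
          then show ?thesis
            unfolding tangent_space_def using \<gamma> that(6)
            by (auto intro!: exI[of _ "\<lambda>s. f (\<gamma> s)"] exI[of _ \<epsilon>] simp: image_subset_iff)
        qed
        have TV: "tangent_space ?E a = tangent_space V a" if "a \<in> V" for a
          using tangent_space_openin[OF V that] by simp
        have tqV: "\<psi> t q \<in> V" using tq W(2) by blast
        have "A ` monge_distribution m n l ?E q = monge_distribution m n l ?E (\<psi> t q)"
        proof
          show "A ` monge_distribution m n l ?E q \<subseteq> monge_distribution m n l ?E (\<psi> t q)"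
          proof
            fix w assume "w \<in> A ` monge_distribution m n l ?E q"
            then obtain v where v: "w = A v" "v \<in> ?C q" "v \<in> tangent_space V q"
              unfolding monge_distribution_def TV[OF qN(2)] by auto
            have "dirderiv v (\<psi> t) q \<in> tangent_space V (\<psi> t q)"
              by (rule push[OF N(1) sm qN(1) openM MN _ q v(3)]) (use into[OF t'(1)] W(2) in blast)
            then show "w \<in> monge_distribution m n l ?E (\<psi> t q)"
              using v A(2) unfolding monge_distribution_def TV[OF tqV] A' by blast
          qed
          show "monge_distribution m n l ?E (\<psi> t q) \<subseteq> A ` monge_distribution m n l ?E q"
          proof
            fix w assume "w \<in> monge_distribution m n l ?E (\<psi> t q)"
            then have w: "w \<in> ?C (\<psi> t q)" "w \<in> tangent_space V (\<psi> t q)"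
              unfolding monge_distribution_def TV[OF tqV] by auto
            then obtain v where v: "w = A v" "v \<in> ?C q" using A(2) by blast
            have "dirderiv w g (\<psi> t q) \<in> tangent_space V (g (\<psi> t q))"
              by (rule push[OF img(1) g(1) _ openimg _ _ _ w(2)])
                (use MN MV g(2) q qN in auto)
            then have "v \<in> tangent_space V q" using left_inverse v(1) g(2)[OF qN(1)] by simp
            then show "w \<in> A ` monge_distribution m n l ?E q"
              using v unfolding monge_distribution_def TV[OF qN(2)] by blast
          qed
        qed
        then show ?thesis using has_derivative_subset[OF A(1) MN] by blast
      qed
      ultimately show ?thesis unfolding local_symmetry_def by blast
    qed
    then show ?thesis
      using flow pV N'(2) MV by (intro exI[of _ \<delta>] exI[of _ M] exI[of _ \<psi>]) auto
  qed
  ultimately show ?thesis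
    unfolding internal_symmetries_def infinitesimal_symmetry_def vector_field_on_def by blast
qed

section \<open>The Monge equation in coordinates\<close>

text \<open>
  The Cartan distribution consists of the vectors whose \<open>c\<close>-component is the coordinate \<open>next_coord c\<close>
  times their \<open>x\<close>-component.  This holds for all \<open>c\<close> other than \<open>x\<close> and the two top ones.
\<close>

fun next_coord :: "jet_coord \<Rightarrow> jet_coord" where
  "next_coord CX = CX"
| "next_coord (CY i) = CY (Suc i)"
| "next_coord (CZ j) = CZ (Suc j)"

locale monge =
  fixes m n :: nat and l :: "jet_coord \<Rightarrow> 'e::finite" and U :: "(real ^ 'e) set" and F :: "real ^ 'e \<Rightarrow> real"
  assumes m0: "0 < m" and mn: "m \<le> n" and labelling: "jet_labelling m n l"
    and U: "open U" and F: "smooth_on U F"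
    and hessian: "\<And>q. q \<in> U \<Longrightarrow> dirderiv (axis (l (CZ n)) 1) (dirderiv (axis (l (CZ n)) 1) F) q \<noteq> 0"
begin

abbreviation (input) "u \<equiv> jet_coordinate m l"

definition coords where "coords = {CX} \<union> CY ` {..<m} \<union> CZ ` {..n}"
definition base_coords where "base_coords = CY ` {..<m} \<union> CZ ` {..<n}"

definition unit :: "jet_coord \<Rightarrow> real ^ 'e" where "unit c = axis (l c) 1"

lemma finite_base_coords [simp]: "finite base_coords" by (simp add: base_coords_def)

lemma coords_split: "c \<in> coords \<longleftrightarrow> c = CX \<or> c \<in> base_coords \<or> c = CZ n"
  by (auto simp: coords_def base_coords_def)

lemma coord_distinct [simp]: "CX \<notin> base_coords" "CZ n \<notin> base_coords"
  by (auto simp: base_coords_def)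

lemma unit_nth: "c \<in> coords \<Longrightarrow> c' \<in> coords \<Longrightarrow> unit c $ l c' = (if c = c' then 1 else 0)"
  using labelling unfolding jet_labelling_def coords_def[symmetric] unit_def bij_betw_def
  by (auto simp: axis_def inj_on_def)

lemma vec_eq_coordsI:
  assumes "\<And>c. c \<in> coords \<Longrightarrow> v $ l c = w $ l c"
  shows "v = (w :: real ^ 'e)"
proof (rule vec_eq_iff[THEN iffD2], rule allI)
  fix i
  have "i \<in> l ` coords"
    using labelling unfolding jet_labelling_def coords_def[symmetric] bij_betw_def by simp
  then show "v $ i = w $ i" using assms by auto
qed

text \<open>
  The total derivative at a point of the mixed jet space, modulo the two top directions: its
  component along \<open>\<partial>/\<partial>z\<^sub>n\<close> is chosen to be \<open>0\<close>, and \<open>real ^ 'e\<close> has no direction \<open>\<partial>/\<partial>y\<^sub>m\<close>.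
\<close>

definition total_vec :: "'e jet \<Rightarrow> real ^ 'e" where
  "total_vec p = unit CX + (\<Sum>c\<in>base_coords. u (next_coord c) p *\<^sub>R unit c)"

lemma sum_base_nth:
  assumes "c' \<in> coords"
  shows "(\<Sum>c\<in>base_coords. a c *\<^sub>R unit c) $ l c' = (if c' \<in> base_coords then a c' else 0)"
proof -
  have "(\<Sum>c\<in>base_coords. a c *\<^sub>R unit c) $ l c' = (\<Sum>c\<in>base_coords. a c * (if c = c' then 1 else 0))"
    using assms by (simp add: unit_nth coords_split)
  also have "\<dots> = (\<Sum>c\<in>base_coords. if c = c' then a c' else 0)" by (rule sum.cong) auto
  finally show ?thesis by simp
qed

lemma total_nth:
  "total_vec p $ l CX = 1" "total_vec p $ l (CZ n) = 0"
  "c \<in> base_coords \<Longrightarrow> total_vec p $ l c = u (next_coord c) p"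
proof -
  have *: "total_vec p $ l c = (if CX = c then 1 else 0) + (if c \<in> base_coords then u (next_coord c) p else 0)"
    if "c \<in> coords" for c
    unfolding total_vec_def vector_add_component sum_base_nth[OF that]
    using that by (simp add: unit_nth coords_split)
  show "total_vec p $ l CX = 1" "total_vec p $ l (CZ n) = 0"
    using *[of CX] *[of "CZ n"] by (auto simp: coords_split)
  show "total_vec p $ l c = u (next_coord c) p" if "c \<in> base_coords"
    using *[of c] that by (auto simp: coords_split)
qed

lemma cartan_iff: "v \<in> cartan m n l p \<longleftrightarrow>
    (\<forall>c\<in>base_coords. fst v $ l c = u (next_coord c) p * fst v $ l CX)"
  unfolding cartan_def Let_def base_coords_def by (auto simp: jet_coordinate_def)

lemma cartan_vec_iff: "v \<in> cartan m n l p \<longleftrightarrow>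
    fst v = (fst v $ l CX) *\<^sub>R total_vec p + (fst v $ l (CZ n)) *\<^sub>R unit (CZ n)"
proof
  assume v: "v \<in> cartan m n l p"
  show "fst v = (fst v $ l CX) *\<^sub>R total_vec p + (fst v $ l (CZ n)) *\<^sub>R unit (CZ n)"
  proof (rule vec_eq_coordsI)
    fix c assume c: "c \<in> coords"
    have "unit (CZ n) $ l c = (if CZ n = c then 1 else 0)" using c by (simp add: unit_nth coords_split)
    then have "((fst v $ l CX) *\<^sub>R total_vec p + (fst v $ l (CZ n)) *\<^sub>R unit (CZ n)) $ l c
        = fst v $ l CX * total_vec p $ l c + fst v $ l (CZ n) * (if CZ n = c then 1 else 0)"
      by simp
    also have "\<dots> = fst v $ l c"
    proof -
      consider "c = CX" | "c \<in> base_coords" | "c = CZ n" using c coords_split by blast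
      then show ?thesis
      proof cases
        case 2
        then have "CZ n \<noteq> c" by auto
        moreover have "fst v $ l c = u (next_coord c) p * fst v $ l CX" using v 2 cartan_iff by blast
        ultimately show ?thesis using 2 by (simp add: total_nth)
      qed (simp_all add: total_nth)
    qed
    finally show "fst v $ l c = ((fst v $ l CX) *\<^sub>R total_vec p + (fst v $ l (CZ n)) *\<^sub>R unit (CZ n)) $ l c" ..
  qed
next
  assume *: "fst v = (fst v $ l CX) *\<^sub>R total_vec p + (fst v $ l (CZ n)) *\<^sub>R unit (CZ n)"
  show "v \<in> cartan m n l p"
    unfolding cartan_iff
  proof
    fix c assume c: "c \<in> base_coords"
    have "unit (CZ n) $ l c = 0" using c by (auto simp: unit_nth coords_split)
    then have "((fst v $ l CX) *\<^sub>R total_vec p + (fst v $ l (CZ n)) *\<^sub>R unit (CZ n)) $ l c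
        = u (next_coord c) p * fst v $ l CX"
      using c by (simp add: total_nth)
    then show "fst v $ l c = u (next_coord c) p * fst v $ l CX"
      using * by metis
  qed
qed

text \<open>
  The coordinate \<open>next_coord c\<close> as a function on the equation.  For \<open>c = y\<^sub>m\<^sub>-\<^sub>1\<close> it is \<open>F\<close>.
\<close>

definition val :: "jet_coord \<Rightarrow> real ^ 'e \<Rightarrow> real" where "val c q = u (next_coord c) (q, F q)"

definition total_field where "total_field q = total_vec (q, F q)"

lemma bounded_linear_coordinate: "bounded_linear (u c)"
  unfolding jet_coordinate_def
  by (cases "c = CY m") (simp_all add: bounded_linear_snd bounded_linear_compose[OF bounded_linear_vec_nth bounded_linear_fst])

lemma smooth_graph: "smooth_on U (\<lambda>q. (q, F q))"
  by (intro smooth_intros U F)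

lemma smooth_val: "smooth_on U (val c)"
  unfolding val_def[abs_def]
  by (rule smooth_on_bounded_linear[OF U bounded_linear_coordinate smooth_graph])

lemma dirderiv_val:
  assumes "q \<in> U"
  shows "dirderiv v (val c) q = u (next_coord c) (v, dirderiv v F q)"
proof -
  have "((\<lambda>q. (q, F q)) has_derivative (\<lambda>v. (v, dirderiv v F q))) (at q)"
    by (intro has_derivative_Pair has_derivative_ident smooth_on_has_derivative[OF U F assms])
  from bounded_linear.has_derivative[OF bounded_linear_coordinate this] show ?thesis
    unfolding val_def[abs_def] by (rule dirderiv_eq)
qed

lemma smooth_total: "smooth_on S (total_vec :: 'e jet \<Rightarrow> _)"
proof -
  have "smooth_on UNIV (total_vec :: 'e jet \<Rightarrow> _)"
    unfolding total_vec_def[abs_def]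
    by (intro smooth_on_add smooth_on_sum smooth_on_scaleR smooth_on_const
        smooth_on_bounded_linear[OF _ bounded_linear_coordinate] smooth_on_id open_UNIV)
  then show ?thesis by (rule smooth_on_subset) simp
qed

lemma smooth_D: "smooth_on U total_field"
  unfolding total_field_def[abs_def] by (rule smooth_on_compose[OF smooth_graph smooth_total[of UNIV]]) simp

lemma dirderiv_D:
  assumes "q \<in> U"
  shows "dirderiv v total_field q = (\<Sum>c\<in>base_coords. dirderiv v (val c) q *\<^sub>R unit c)"
proof -
  have "((\<lambda>q. unit CX + (\<Sum>c\<in>base_coords. val c q *\<^sub>R unit c)) has_derivative
      (\<lambda>v. 0 + (\<Sum>c\<in>base_coords. dirderiv v (val c) q *\<^sub>R unit c))) (at q)"
    by (intro has_derivative_add has_derivative_const has_derivative_sum has_derivative_scaleR_left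
        smooth_on_has_derivative[OF U smooth_val assms])
  then show ?thesis
    using dirderiv_eq unfolding total_field_def[abs_def] total_vec_def val_def by fastforce
qed

definition Fz where "Fz = dirderiv (unit (CZ n)) F"
definition Fzz where "Fzz = dirderiv (unit (CZ n)) Fz"

lemma Fzz_nonzero: "q \<in> U \<Longrightarrow> Fzz q \<noteq> 0"
  using hessian by (simp add: Fzz_def Fz_def unit_def)

lemma smooth_Fz: "smooth_on U Fz"
  unfolding Fz_def by (rule smooth_on_dirderiv_const[OF U F])

text \<open>
  The bracket of \<open>\<partial>/\<partial>z\<^sub>n\<close> with the total derivative on the equation.
\<close>

definition bracket_field where "bracket_field q = unit (CZ (n - 1)) + Fz q *\<^sub>R unit (CY (m - 1))"

lemma n0: "0 < n" using m0 mn by simp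

lemma dirderiv_val_unit:
  assumes "q \<in> U" "c \<in> base_coords" "c' \<in> coords"
  shows "dirderiv (unit c') (val c) q =
    (if c = CY (m - 1) then dirderiv (unit c') F q else if next_coord c = c' then 1 else 0)"
  unfolding dirderiv_val[OF assms(1)] jet_coordinate_def
  using assms(2,3) m0
  by (auto simp: base_coords_def coords_def unit_nth)

lemma dirderiv_zn_D:
  assumes "q \<in> U"
  shows "dirderiv (unit (CZ n)) total_field q = bracket_field q"
proof -
  have "dirderiv (unit (CZ n)) total_field q = (\<Sum>c\<in>base_coords.
      (if c = CY (m - 1) then Fz q *\<^sub>R unit c else 0) + (if c = CZ (n - 1) then unit c else 0))"
    unfolding dirderiv_D[OF assms]
  proof (rule sum.cong[OF refl])
    fix c assume c: "c \<in> base_coords"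
    then have "next_coord c = CZ n \<longleftrightarrow> c = CZ (n - 1)" using n0 by (auto simp: base_coords_def)
    then show "dirderiv (unit (CZ n)) (val c) q *\<^sub>R unit c
        = (if c = CY (m - 1) then Fz q *\<^sub>R unit c else 0) + (if c = CZ (n - 1) then unit c else 0)"
      using dirderiv_val_unit[OF assms c, of "CZ n"] by (auto simp: Fz_def coords_split)
  qed
  also have "\<dots> = Fz q *\<^sub>R unit (CY (m - 1)) + unit (CZ (n - 1))"
    using m0 n0 by (simp add: sum.distrib) (auto simp: base_coords_def)
  finally show ?thesis by (simp add: bracket_field_def)
qed

lemma smooth_E1: "smooth_on U bracket_field"
  unfolding bracket_field_def[abs_def] by (intro smooth_intros U smooth_Fz)

lemma dirderiv_zn_E1:
  assumes "q \<in> U"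
  shows "dirderiv (unit (CZ n)) bracket_field q = Fzz q *\<^sub>R unit (CY (m - 1))"
proof -
  have "(bracket_field has_derivative (\<lambda>v. 0 + dirderiv v Fz q *\<^sub>R unit (CY (m - 1)))) (at q)"
    unfolding bracket_field_def[abs_def]
    by (intro has_derivative_add has_derivative_const has_derivative_scaleR_left
        smooth_on_has_derivative[OF U smooth_Fz assms])
  then show ?thesis by (simp add: dirderiv_eq Fzz_def)
qed

lemma dirderiv_P_D:
  assumes "q \<in> U" "m = 1"
  shows "dirderiv (unit (CY (m - 1))) total_field q = dirderiv (unit (CY (m - 1))) F q *\<^sub>R unit (CY (m - 1))"
proof -
  have "dirderiv (unit (CY (m - 1))) total_field q = (\<Sum>c\<in>base_coords.
      (if c = CY (m - 1) then dirderiv (unit (CY (m - 1))) F q *\<^sub>R unit c else 0))"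
    unfolding dirderiv_D[OF assms(1)]
  proof (rule sum.cong[OF refl])
    fix c assume c: "c \<in> base_coords"
    have "next_coord c \<noteq> CY (m - 1)" using assms(2) by (cases c) auto
    moreover have "CY (m - 1) \<in> coords" using m0 by (simp add: coords_def)
    ultimately show "dirderiv (unit (CY (m - 1))) (val c) q *\<^sub>R unit c
        = (if c = CY (m - 1) then dirderiv (unit (CY (m - 1))) F q *\<^sub>R unit c else 0)"
      using dirderiv_val_unit[OF assms(1) c, of "CY (m - 1)"] by auto
  qed
  also have "\<dots> = dirderiv (unit (CY (m - 1))) F q *\<^sub>R unit (CY (m - 1))"
    using m0 by simp (auto simp: base_coords_def)
  finally show ?thesis .
qed

section \<open>Brackets of the fields spanning the distribution\<close>

abbreviation "Dz h \<equiv> dirderiv (unit (CZ n)) h"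
abbreviation "Dp h \<equiv> dirderiv (unit (CY (m - 1))) h"
definition total_deriv :: "(real ^ 'e \<Rightarrow> real) \<Rightarrow> real ^ 'e \<Rightarrow> real" where "total_deriv h q = dirderiv (total_field q) h q"
definition bracket_deriv :: "(real ^ 'e \<Rightarrow> real) \<Rightarrow> real ^ 'e \<Rightarrow> real" where "bracket_deriv h q = dirderiv (bracket_field q) h q"

context
  fixes S :: "(real ^ 'e) set"
  assumes S: "open S" "S \<subseteq> U"
begin

lemma smooth_T: "smooth_on S h \<Longrightarrow> smooth_on S (total_deriv h)"
  unfolding total_deriv_def[abs_def]
  by (intro smooth_on_dirderiv_at[OF S(1) S(1)] smooth_on_id smooth_on_subset[OF smooth_D S(2)]) auto

lemma smooth_E: "smooth_on S h \<Longrightarrow> smooth_on S (bracket_deriv h)"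
  unfolding bracket_deriv_def[abs_def]
  by (intro smooth_on_dirderiv_at[OF S(1) S(1)] smooth_on_id smooth_on_subset[OF smooth_E1 S(2)]) auto

lemma Dz_T: "smooth_on S h \<Longrightarrow> q \<in> S \<Longrightarrow> Dz (total_deriv h) q = total_deriv (Dz h) q + bracket_deriv h q"
  unfolding total_deriv_def[abs_def] bracket_deriv_def
  using dirderiv_along_field[OF S(1) _ smooth_on_subset[OF smooth_D S(2)], of h q "unit (CZ n)"]
    dirderiv_zn_D[of q] S(2) by auto

lemma Dz_E:
  assumes h: "smooth_on S h" and q: "q \<in> S"
  shows "Dz (bracket_deriv h) q = bracket_deriv (Dz h) q + Fzz q * Dp h q"
proof -
  have qU: "q \<in> U" using q S(2) by blast
  have "dirderiv (Fzz q *\<^sub>R unit (CY (m - 1))) h q = Fzz q * Dp h q"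
    using linear_scale[OF linear_dirderiv[OF S(1) h q]] by simp
  then show ?thesis
    unfolding bracket_deriv_def[abs_def]
    using dirderiv_along_field[OF S(1) h smooth_on_subset[OF smooth_E1 S(2)] q, of "unit (CZ n)"]
      dirderiv_zn_E1[OF qU] by auto
qed

lemma Dp_T:
  assumes h: "smooth_on S h" and q: "q \<in> S" and "m = 1"
  shows "Dp (total_deriv h) q = total_deriv (Dp h) q + Dp F q * Dp h q"
proof -
  have qU: "q \<in> U" using q S(2) by blast
  have "dirderiv (Dp F q *\<^sub>R unit (CY (m - 1))) h q = Dp F q * Dp h q"
    using linear_scale[OF linear_dirderiv[OF S(1) h q]] by simp
  then show ?thesis
    unfolding total_deriv_def[abs_def]
    using dirderiv_along_field[OF S(1) h smooth_on_subset[OF smooth_D S(2)] q, of "unit (CY (m - 1))"]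
      dirderiv_P_D[OF qU assms(3)] by auto
qed

lemma T_zero: "(\<And>q. q \<in> S \<Longrightarrow> h q = 0) \<Longrightarrow> q \<in> S \<Longrightarrow> total_deriv h q = 0"
  unfolding total_deriv_def by (rule dirderiv_zero_on[OF S(1)])

lemma E_zero: "(\<And>q. q \<in> S \<Longrightarrow> h q = 0) \<Longrightarrow> q \<in> S \<Longrightarrow> bracket_deriv h q = 0"
  unfolding bracket_deriv_def by (rule dirderiv_zero_on[OF S(1)])

lemma E_of_T:
  assumes h: "smooth_on S h" and 0: "\<And>q. q \<in> S \<Longrightarrow> Dz h q = 0" and q: "q \<in> S"
  shows "bracket_deriv h q = Dz (total_deriv h) q"
  using Dz_T[OF h q] T_zero[OF 0 q] by simp

lemma Fzz_Dp:
  assumes h: "smooth_on S h" and 0: "\<And>q. q \<in> S \<Longrightarrow> Dz h q = 0" and q: "q \<in> S"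
  shows "Dz (bracket_deriv h) q = Fzz q * Dp h q"
  using Dz_E[OF h q] E_zero[OF 0 q] by simp

lemma Dz_cong:
  assumes "\<And>q. q \<in> S \<Longrightarrow> f q = g q" "smooth_on S f" "q \<in> S"
  shows "dirderiv v f q = dirderiv v g q"
  using dirderiv_cong[OF S(1) assms(3,1,2)] .

text \<open>
  At a fixed point of \<open>J\<^bsup>m-1,n-1\<^esup>\<close>, the direction of the total derivative describes a curved line as \<open>z\<^sub>n\<close>
  varies, because \<open>Fzz\<close> is not \<open>0\<close>.  A linear relation that does not depend on \<open>z\<^sub>n\<close> and holds along
  the curve holds on its span, which contains \<open>\<partial>/\<partial>y\<^sub>m\<^sub>-\<^sub>1\<close>.
\<close>

lemma transversal_ratio:
  assumes a: "smooth_on S a" and b: "smooth_on S b" and x: "smooth_on S x"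
    and 0: "\<And>q. q \<in> S \<Longrightarrow> Dz a q = 0" "\<And>q. q \<in> S \<Longrightarrow> Dz b q = 0" "\<And>q. q \<in> S \<Longrightarrow> Dz x q = 0"
    and total_deriv: "\<And>q. q \<in> S \<Longrightarrow> total_deriv a q = b q * total_deriv x q"
    and q: "q \<in> S"
  shows "Dp a q = b q * Dp x q"
proof -
  have bracket_deriv: "bracket_deriv a q = b q * bracket_deriv x q" if q: "q \<in> S" for q
  proof -
    have "bracket_deriv a q = Dz (total_deriv a) q" by (rule E_of_T[OF a 0(1) q])
    also have "\<dots> = Dz (\<lambda>q. b q * total_deriv x q) q" by (rule Dz_cong[OF total_deriv smooth_T[OF a] q])
    also have "\<dots> = b q * bracket_deriv x q"
      using dirderiv_mult[OF S(1) b smooth_T[OF x] q] 0(2)[OF q] E_of_T[OF x 0(3) q] by simp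
    finally show ?thesis .
  qed
  have "Fzz q * Dp a q = Dz (bracket_deriv a) q" by (rule Fzz_Dp[OF a 0(1) q, symmetric])
  also have "\<dots> = Dz (\<lambda>q. b q * bracket_deriv x q) q" by (rule Dz_cong[OF bracket_deriv smooth_E[OF a] q])
  also have "\<dots> = b q * (Fzz q * Dp x q)"
    using dirderiv_mult[OF S(1) b smooth_E[OF x] q] 0(2)[OF q] Fzz_Dp[OF x 0(3) q] by simp
  finally show ?thesis using Fzz_nonzero[of q] q S(2) by auto
qed

text \<open>
  Two applications of \<open>\<partial>/\<partial>z\<^sub>n\<close> to the chain of \<open>z\<close> give \<open>Fzz * Dp g1 = - Dz x\<close>.  The same for the chain
  of \<open>y\<close> gives \<open>Dp f1 = Fz * Dp g1 - x\<close>.  The left side of the latter is killed by \<open>\<partial>/\<partial>z\<^sub>n\<close>, whereas the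
  right side yields \<open>Fzz * Dp g1 - Dz x = - 2 * Dz x\<close>.
\<close>

lemma fibre_preserved_if_two_dependent:
  assumes sm: "smooth_on S f1" "smooth_on S g1" "smooth_on S x"
    and 0: "\<And>q. q \<in> S \<Longrightarrow> Dz f1 q = 0" "\<And>q. q \<in> S \<Longrightarrow> Dz g1 q = 0"
    and f: "\<And>q. q \<in> S \<Longrightarrow> Dz (total_deriv f1) q = - Fz q * x q"
    and g: "\<And>q. q \<in> S \<Longrightarrow> Dz (total_deriv g1) q = - x q"
    and q: "q \<in> S"
  shows "Dz x q = 0"
proof -
  have Fz: "smooth_on S Fz" by (rule smooth_on_subset[OF smooth_Fz S(2)])
  have Eg: "bracket_deriv g1 q = - x q" if "q \<in> S" for q using E_of_T[OF sm(2) 0(2) that] g[OF that] by simp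
  have Ef: "bracket_deriv f1 q = - Fz q * x q" if "q \<in> S" for q using E_of_T[OF sm(1) 0(1) that] f[OF that] by simp
  have gx: "Fzz q * Dp g1 q = - Dz x q" if q: "q \<in> S" for q
  proof -
    have "Dz (bracket_deriv g1) q = Dz (\<lambda>q. - x q) q" by (rule Dz_cong[OF Eg smooth_E[OF sm(2)] q])
    also have "\<dots> = - Dz x q"
      by (rule dirderiv_bounded_linear[OF S(1) sm(3) q bounded_linear_minus[OF bounded_linear_ident]])
    finally show ?thesis using Fzz_Dp[OF sm(2) 0(2) q] by simp
  qed
  have P: "Dp f1 q = Fz q * Dp g1 q - x q" if q: "q \<in> S" for q
  proof -
    have "Dz (bracket_deriv f1) q = Dz (\<lambda>q. - Fz q * x q) q" by (rule Dz_cong[OF Ef smooth_E[OF sm(1)] q])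
    also have "\<dots> = - (Fz q * Dz x q + Fzz q * x q)"
      using dirderiv_mult[OF S(1) smooth_on_minus[OF S(1) Fz] sm(3) q]
        dirderiv_bounded_linear[OF S(1) Fz q bounded_linear_minus[OF bounded_linear_ident]]
      by (simp add: Fzz_def)
    finally have "Fzz q * Dp f1 q = - (Fz q * Dz x q + Fzz q * x q)"
      using Fzz_Dp[OF sm(1) 0(1) q] by simp
    also have "\<dots> = Fzz q * (Fz q * Dp g1 q - x q)"
      using gx[OF q] by (simp add: algebra_simps)
    finally show ?thesis using Fzz_nonzero[of q] q S(2) by auto
  qed
  have ZP: "Dz (Dp h) q = 0" if "smooth_on S h" "\<And>q. q \<in> S \<Longrightarrow> Dz h q = 0"
    for h :: "real ^ 'e \<Rightarrow> real"
  proof -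
    have "Dz (Dp h) q = Dp (Dz h) q" by (rule dirderiv_commute[OF S(1) that(1) q])
    also have "\<dots> = 0" by (rule dirderiv_zero_on[OF S(1) q that(2)])
    finally show ?thesis .
  qed
  have "0 = Dz (\<lambda>q. Fz q * Dp g1 q - x q) q"
    using ZP[OF sm(1) 0(1)] Dz_cong[OF P smooth_on_dirderiv_const[OF S(1) sm(1)] q] by simp
  also have "\<dots> = Fzz q * Dp g1 q - Dz x q"
    using dirderiv_diff[OF S(1) smooth_on_mult[OF S(1) Fz smooth_on_dirderiv_const[OF S(1) sm(2)]] sm(3) q]
      dirderiv_mult[OF S(1) Fz smooth_on_dirderiv_const[OF S(1) sm(2)] q] ZP[OF sm(2) 0(2)]
    by (simp add: Fzz_def)
  finally show ?thesis using gx[OF q] by simp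
qed

text \<open>
  Here \<open>y\<close> has no chain to compare with, but the bracket of \<open>\<partial>/\<partial>y\<^sub>0\<close> with the total derivative is a multiple
  of \<open>\<partial>/\<partial>y\<^sub>0\<close>.  So \<open>Dp g0 = 0\<close>, which follows from \<open>bracket_deriv g0 = 0\<close>, implies
  \<open>Dp (total_deriv g0) = 0\<close>, and \<open>Fzz\<close> times the latter is \<open>- Dz x\<close>.  The argument needs
  three consecutive functions in the chain of \<open>z\<close>, hence \<open>n \<ge> 3\<close> when it is applied.
\<close>

lemma fibre_preserved_if_one_dependent:
  assumes sm: "smooth_on S g0" "smooth_on S x" and "m = 1"
    and 0: "\<And>q. q \<in> S \<Longrightarrow> Dz g0 q = 0" "\<And>q. q \<in> S \<Longrightarrow> Dz (total_deriv g0) q = 0"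
    and g: "\<And>q. q \<in> S \<Longrightarrow> Dz (total_deriv (total_deriv g0)) q = - x q"
    and q: "q \<in> S"
  shows "Dz x q = 0"
proof -
  have P0: "Dp g0 q = 0" if q: "q \<in> S" for q
  proof -
    have "bracket_deriv g0 q = 0" if "q \<in> S" for q using E_of_T[OF sm(1) 0(1) that] 0(2)[OF that] by simp
    then have "Dz (bracket_deriv g0) q = 0" by (rule dirderiv_zero_on[OF S(1) q])
    then show ?thesis using Fzz_Dp[OF sm(1) 0(1) q] Fzz_nonzero[of q] q S(2) by auto
  qed
  have "Dp (total_deriv g0) q = 0"
    using Dp_T[OF sm(1) q \<open>m = 1\<close>] P0[OF q] T_zero[OF P0 q] by simp
  then have "Dz (bracket_deriv (total_deriv g0)) q = 0" using Fzz_Dp[OF smooth_T[OF sm(1)] 0(2) q] by simp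
  moreover have "bracket_deriv (total_deriv g0) q = - x q" if "q \<in> S" for q
    using E_of_T[OF smooth_T[OF sm(1)] 0(2) that] g[OF that] by simp
  then have "Dz (bracket_deriv (total_deriv g0)) q = Dz (\<lambda>q. - x q) q"
    by (rule Dz_cong[OF _ smooth_E[OF smooth_T[OF sm(1)]] q])
  moreover have "\<dots> = - Dz x q"
    by (rule dirderiv_bounded_linear[OF S(1) sm(2) q bounded_linear_minus[OF bounded_linear_ident]])
  ultimately show ?thesis by simp
qed

end

end

section \<open>Internal symmetries in coordinates\<close>

context monge
begin

definition Delta :: "real ^ 'e \<Rightarrow> (real ^ 'e) set" where
  "Delta q = {v. \<forall>c\<in>base_coords. v $ l c = val c q * v $ l CX}"

lemma Delta_iff_cartan: "fst v \<in> Delta q \<longleftrightarrow> v \<in> cartan m n l (q, F q)"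
  by (simp add: Delta_def cartan_iff val_def)

lemma Delta_expand: "v \<in> Delta q \<Longrightarrow> v = (v $ l CX) *\<^sub>R total_field q + (v $ l (CZ n)) *\<^sub>R unit (CZ n)"
  using Delta_iff_cartan[of "(v, 0)" q] cartan_vec_iff[of "(v, 0)" "(q, F q)"] by (simp add: total_field_def)

lemma D_in_Delta: "total_field q \<in> Delta q"
  by (simp add: Delta_def total_field_def total_nth val_def)

lemma unit_zn_nth: "c \<in> base_coords \<Longrightarrow> unit (CZ n) $ l c = 0" "unit (CZ n) $ l CX = 0"
    "unit (CZ n) $ l (CZ n) = 1"
  by (auto simp: unit_nth coords_split)

lemma unit_zn_in_Delta: "unit (CZ n) \<in> Delta q"
  by (simp add: Delta_def unit_zn_nth)

text \<open>
  Internal symmetries and their flows in the coordinates of \<open>U\<close>, where \<open>S\<close> corresponds to an open part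
  of the equation.
\<close>

definition reduced_flow where
  "reduced_flow S Z \<epsilon> N \<Phi> \<longleftrightarrow> 0 < \<epsilon> \<and> open N \<and> N \<subseteq> S \<and> smooth_on ({-\<epsilon><..<\<epsilon>} \<times> N) \<Phi> \<and>
    (\<forall>q\<in>N. \<Phi> (0::real, q) = q) \<and>
    (\<forall>t q. \<bar>t\<bar> < \<epsilon> \<longrightarrow> q \<in> N \<longrightarrow> \<Phi> (t, q) \<in> S \<and>
      ((\<lambda>s. \<Phi> (s, q)) has_vector_derivative Z (\<Phi> (t, q))) (at t) \<and>
      (\<forall>v\<in>Delta q. dirderiv (0, v) \<Phi> (t, q) \<in> Delta (\<Phi> (t, q))))"

definition reduced_symmetry where
  "reduced_symmetry S Z \<longleftrightarrow> open S \<and> S \<subseteq> U \<and> smooth_on S Z \<and>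
    (\<forall>q\<in>S. \<exists>\<epsilon> N \<Phi>. q \<in> N \<and> reduced_flow S Z \<epsilon> N \<Phi>)"

lemma open_graph_preimage:
  assumes "openin (top_of_set (monge_equation U F)) V"
  shows "open {q \<in> U. (q, F q) \<in> V}"
proof -
  obtain O' where O': "open O'" "V = monge_equation U F \<inter> O'" using assms by (auto simp: openin_open)
  have "{q \<in> U. (q, F q) \<in> V} = U \<inter> (\<lambda>q. (q, F q)) -` O'"
    using O'(2) by (auto simp: monge_equation_iff)
  then show ?thesis
    using continuous_open_preimage[OF smooth_on_imp_continuous_on[OF U smooth_graph] U O'(1)] by simp
qed

lemma internal_symmetry_reduced:
  assumes V: "openin (top_of_set (monge_equation U F)) V"
    and X: "X \<in> internal_symmetries m n l (monge_equation U F) V"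
  shows "reduced_symmetry {q \<in> U. (q, F q) \<in> V} (\<lambda>q. fst (X (q, F q)))"
    and "\<And>q. q \<in> U \<Longrightarrow> (q, F q) \<in> V \<Longrightarrow>
      snd (X (q, F q)) = dirderiv (fst (X (q, F q))) F q"
proof -
  let ?E = "monge_equation U F" and ?J = "\<lambda>q. (q, F q)"
  let ?S = "{q \<in> U. ?J q \<in> V}" and ?Z = "\<lambda>q. fst (X (?J q))"
  have VE: "V \<subseteq> ?E" using V openin_imp_subset by blast
  have S: "open ?S" by (rule open_graph_preimage[OF V])
  have sym: "infinitesimal_symmetry V (monge_distribution m n l ?E) X"
    using X by (simp add: internal_symmetries_def)
  then have Xs: "smooth_on V X" and Xt: "\<And>p. p \<in> V \<Longrightarrow> X p \<in> tangent_space V p"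
    unfolding infinitesimal_symmetry_def vector_field_on_def by auto
  show "snd (X (q, F q)) = dirderiv (fst (X (q, F q))) F q" if "q \<in> U" "(q, F q) \<in> V" for q
    using Xt[OF that(2)] tangent_space_openin[OF V that(2)]
      tangent_space_monge_equation[OF U F, of "(q, F q)"] that(1) by (simp add: monge_equation_iff)
  have Z: "smooth_on ?S ?Z"
    by (rule smooth_on_fst[OF S smooth_on_compose[OF smooth_on_subset[OF smooth_graph] Xs]]) auto
  have "\<exists>\<epsilon> N \<Phi>. q0 \<in> N \<and> reduced_flow ?S ?Z \<epsilon> N \<Phi>" if q0: "q0 \<in> ?S" for q0
  proof -
    have "?J q0 \<in> V" using q0 by blast
    then obtain \<epsilon> N \<phi> where p: "?J q0 \<in> N" and flow: "local_flow V X \<epsilon> N \<phi>"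
      and sym: "\<And>t. t \<in> {-\<epsilon><..<\<epsilon>} \<Longrightarrow> local_symmetry V (monge_distribution m n l ?E) N (\<phi> t)"
      using sym unfolding infinitesimal_symmetry_def by blast
    have \<epsilon>: "0 < \<epsilon>" and N: "openin (top_of_set V) N"
      and sm: "smooth_on ({-\<epsilon><..<\<epsilon>} \<times> N) (\<lambda>(t, q). \<phi> t q)"
      and \<phi>0: "\<And>p. p \<in> N \<Longrightarrow> \<phi> 0 p = p"
      and \<phi>V: "\<And>t p. t \<in> {-\<epsilon><..<\<epsilon>} \<Longrightarrow> p \<in> N \<Longrightarrow> \<phi> t p \<in> V"
      and der: "\<And>t p. t \<in> {-\<epsilon><..<\<epsilon>} \<Longrightarrow> p \<in> N \<Longrightarrow>
        ((\<lambda>s. \<phi> s p) has_vector_derivative X (\<phi> t p)) (at t)"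
      using flow unfolding local_flow_def by blast+
    have NV: "N \<subseteq> V" using N openin_imp_subset by blast
    let ?N = "{q \<in> U. ?J q \<in> N}"
    have N': "open ?N" by (rule open_graph_preimage[OF openin_trans[OF N V]])
    define \<Phi> where "\<Phi> = (\<lambda>(t, q). fst (\<phi> t (?J q)))"
    let ?\<Omega> = "{-\<epsilon><..<\<epsilon>} \<times> ?N"
    have \<Omega>: "open ?\<Omega>" by (intro open_Times N' open_greaterThanLessThan)
    have graph: "\<phi> t (?J q) = ?J (\<Phi> (t, q))" "\<Phi> (t, q) \<in> ?S" if "t \<in> {-\<epsilon><..<\<epsilon>}" "q \<in> ?N" for t q
    proof -
      have V': "\<phi> t (?J q) \<in> V" using \<phi>V that by blast
      then have "\<phi> t (?J q) \<in> ?E" using VE by blast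
      then show eq: "\<phi> t (?J q) = ?J (\<Phi> (t, q))"
        by (simp add: \<Phi>_def monge_equation_iff prod_eq_iff)
      show "\<Phi> (t, q) \<in> ?S"
        using V' \<open>\<phi> t (?J q) \<in> ?E\<close> unfolding eq by (simp add: monge_equation_iff)
    qed
    have sm\<Phi>: "smooth_on ?\<Omega> \<Phi>"
    proof -
      have "smooth_on ?\<Omega> (\<lambda>x. F (snd x))"
        by (rule smooth_on_compose[OF smooth_on_snd[OF \<Omega> smooth_on_id] F]) auto
      then have "smooth_on ?\<Omega> (\<lambda>x. (fst x, ?J (snd x)))"
        by (intro smooth_on_Pair smooth_on_fst smooth_on_snd smooth_on_id \<Omega>)
      moreover have "(\<lambda>x. (fst x, ?J (snd x))) ` ?\<Omega> \<subseteq> {-\<epsilon><..<\<epsilon>} \<times> N" by auto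
      ultimately have "smooth_on ?\<Omega> (\<lambda>x. fst (case (fst x, ?J (snd x)) of (t, q) \<Rightarrow> \<phi> t q))"
        by (intro smooth_on_fst[OF \<Omega>] smooth_on_compose[OF _ sm])
      then show ?thesis by (simp add: \<Phi>_def case_prod_beta')
    qed
    have pres: "dirderiv (0, v) \<Phi> (t, q) \<in> Delta (\<Phi> (t, q))"
      if t: "t \<in> {-\<epsilon><..<\<epsilon>}" and q: "q \<in> ?N" and v: "v \<in> Delta q" for t q v
    proof -
      have qU: "q \<in> U" and qN: "?J q \<in> N" using q by auto
      obtain A where A: "(\<phi> t has_derivative A) (at (?J q) within N)"
          "A ` monge_distribution m n l ?E (?J q) = monge_distribution m n l ?E (\<phi> t (?J q))"
        using sym[OF t] qN unfolding local_symmetry_def by blast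
      let ?v = "(v, dirderiv v F q)"
      have "?v \<in> monge_distribution m n l ?E (?J q)"
        unfolding monge_distribution_def
        using v Delta_iff_cartan[of ?v] tangent_space_monge_equation[OF U F, of "?J q" ?v] qU
        by (simp add: monge_equation_iff)
      then have "A ?v \<in> cartan m n l (?J (\<Phi> (t, q)))"
        using A(2) graph(1)[OF t q] unfolding monge_distribution_def by auto
      then have "fst (A ?v) \<in> Delta (\<Phi> (t, q))" by (simp add: Delta_iff_cartan)
      moreover have "dirderiv (0, v) \<Phi> (t, q) = fst (A ?v)"
      proof -
        have "(?J has_derivative (\<lambda>v. (v, dirderiv v F q))) (at q within ?N)"
          by (rule has_derivative_at_withinI[OF has_derivative_Pair[OF has_derivative_ident
                smooth_on_has_derivative[OF U F qU]]])
        moreover have "(\<phi> t has_derivative A) (at (?J q) within ?J ` ?N)"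
          by (rule has_derivative_subset[OF A(1)]) auto
        ultimately have "((\<lambda>q. \<phi> t (?J q)) has_derivative (\<lambda>v. A (v, dirderiv v F q))) (at q within ?N)"
          by (rule has_derivative_in_compose)
        then have "((\<lambda>q. \<Phi> (t, q)) has_derivative (\<lambda>v. fst (A (v, dirderiv v F q)))) (at q)"
          using at_within_open[OF q N'] by (auto simp: \<Phi>_def intro!: has_derivative_fst)
        then show ?thesis
          using dirderiv_slice(1)[OF \<Omega> sm\<Phi>, of t q v] t q by (simp add: dirderiv_eq)
      qed
      ultimately show ?thesis by simp
    qed
    have "reduced_flow ?S ?Z \<epsilon> ?N \<Phi>"
      unfolding reduced_flow_def
    proof (intro conjI allI impI ballI)
      show "?N \<subseteq> ?S" using NV by blast
      show "\<Phi> (0, q) = q" if "q \<in> ?N" for q using \<phi>0 that by (simp add: \<Phi>_def)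
      fix t q assume tq: "\<bar>t\<bar> < \<epsilon>" "q \<in> ?N"
      then have t: "t \<in> {-\<epsilon><..<\<epsilon>}" by auto
      show "\<Phi> (t, q) \<in> ?S" by (rule graph(2)[OF t tq(2)])
      have "((\<lambda>s. fst (\<phi> s (?J q))) has_vector_derivative fst (X (\<phi> t (?J q)))) (at t)"
        using der[OF t] tq(2) by (intro bounded_linear.has_vector_derivative[OF bounded_linear_fst]) auto
      then show "((\<lambda>s. \<Phi> (s, q)) has_vector_derivative ?Z (\<Phi> (t, q))) (at t)"
        unfolding graph(1)[OF t tq(2)] by (simp add: \<Phi>_def)
      show "dirderiv (0, v) \<Phi> (t, q) \<in> Delta (\<Phi> (t, q))" if "v \<in> Delta q" for v
        by (rule pres[OF t tq(2) that])
    qed (use \<epsilon> N' sm\<Phi> in auto)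
    moreover have "q0 \<in> ?N" using p q0 by simp
    ultimately show ?thesis by (intro exI conjI)
  qed
  moreover have "?S \<subseteq> U" by blast
  ultimately show "reduced_symmetry ?S ?Z"
    unfolding reduced_symmetry_def using S Z by (intro conjI ballI)
qed

context
  fixes S Z \<epsilon> N \<Phi>
  assumes S: "open S" "S \<subseteq> U" and Z: "smooth_on S Z" and flow: "reduced_flow S Z \<epsilon> N \<Phi>"
begin

lemma flow_box: "open ({-\<epsilon><..<\<epsilon>} \<times> N)" "smooth_on ({-\<epsilon><..<\<epsilon>} \<times> N) \<Phi>"
  using flow unfolding reduced_flow_def by (auto intro!: open_Times)

lemma flow_box_mem: "\<bar>t\<bar> < \<epsilon> \<Longrightarrow> q \<in> N \<Longrightarrow> (t, q) \<in> {-\<epsilon><..<\<epsilon>} \<times> N"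
  by auto

lemma flow_in: "\<bar>t\<bar> < \<epsilon> \<Longrightarrow> q \<in> N \<Longrightarrow> \<Phi> (t, q) \<in> S"
  and flow_der: "\<bar>t\<bar> < \<epsilon> \<Longrightarrow> q \<in> N \<Longrightarrow> ((\<lambda>s. \<Phi> (s, q)) has_vector_derivative Z (\<Phi> (t, q))) (at t)"
  and flow_Delta: "\<bar>t\<bar> < \<epsilon> \<Longrightarrow> q \<in> N \<Longrightarrow> v \<in> Delta q \<Longrightarrow> dirderiv (0, v) \<Phi> (t, q) \<in> Delta (\<Phi> (t, q))"
  and flow_0: "q \<in> N \<Longrightarrow> \<Phi> (0, q) = q"
  and flow_N: "open N" "N \<subseteq> S" and flow_eps: "0 < \<epsilon>"
  using flow unfolding reduced_flow_def by auto

text \<open>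
  The equation of first variation, by exchanging the derivatives in time and in space.
\<close>

lemma flow_variation:
  assumes t: "\<bar>t\<bar> < \<epsilon>" and q: "q \<in> N"
  shows "((\<lambda>s. dirderiv (0, v) \<Phi> (s, q)) has_vector_derivative
    dirderiv (dirderiv (0, v) \<Phi> (t, q)) Z (\<Phi> (t, q))) (at t)"
proof -
  note mem = flow_box_mem[OF t q]
  have time: "dirderiv (1, 0) \<Phi> x = Z (\<Phi> x)" if "x \<in> {-\<epsilon><..<\<epsilon>} \<times> N" for x
  proof -
    obtain s r where x: "x = (s, r)" "\<bar>s\<bar> < \<epsilon>" "r \<in> N" using \<open>x \<in> _\<close> by (cases x) (auto simp: abs_less_iff)
    show ?thesis
      using vector_derivative_unique_at[OF has_vector_derivative_slice[OF flow_box] flow_der[OF x(2,3)]]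
        \<open>x \<in> _\<close> x(1) by simp
  qed
  have "dirderiv (1, 0) (dirderiv (0, v) \<Phi>) (t, q) = dirderiv (0, v) (dirderiv (1, 0) \<Phi>) (t, q)"
    by (rule dirderiv_commute[OF flow_box mem])
  also have "\<dots> = dirderiv (0, v) (\<lambda>x. Z (\<Phi> x)) (t, q)"
    by (rule dirderiv_cong[OF flow_box(1) mem time smooth_on_dirderiv_const[OF flow_box]])
  also have "\<dots> = dirderiv (dirderiv (0, v) \<Phi> (t, q)) Z (\<Phi> (t, q))"
    by (rule dirderiv_compose[OF flow_box mem S(1) Z flow_in[OF t q]])
  finally show ?thesis
    using has_vector_derivative_slice[OF flow_box(1) smooth_on_dirderiv_const[OF flow_box] mem, of "(0, v)"]
    by simp
qed

lemma flow_variation_0: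
  assumes "q \<in> N"
  shows "dirderiv (0, v) \<Phi> (0, q) = v"
proof -
  have sm: "smooth_on N (\<lambda>x. \<Phi> (0, x))" by (rule smooth_on_slice[OF flow_box(2)]) (simp add: flow_eps)
  have "dirderiv (0, v) \<Phi> (0, q) = dirderiv v (\<lambda>x. \<Phi> (0, x)) q"
    by (rule dirderiv_slice(1)[OF flow_box]) (use assms flow_eps in simp)
  also have "\<dots> = dirderiv v (\<lambda>x. x) q"
    by (rule dirderiv_cong[OF flow_N(1) assms flow_0 sm])
  also have "\<dots> = v" by (rule dirderiv_eq) simp
  finally show ?thesis .
qed

lemma dirderiv_comp_nth:
  "q \<in> S \<Longrightarrow> dirderiv v (\<lambda>q. Z q $ i) q = dirderiv v Z q $ i"
  by (rule dirderiv_bounded_linear[OF S(1) Z _ bounded_linear_vec_nth])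

text \<open>
  The derivative at time \<open>0\<close> of the equations that put the image of \<open>v\<close> into the distribution.
\<close>

lemma flow_infinitesimal:
  assumes q: "q \<in> N" and v: "v \<in> Delta q" and c: "c \<in> base_coords"
  shows "dirderiv v (\<lambda>q. Z q $ l c) q
    = dirderiv (Z q) (val c) q * v $ l CX + val c q * dirderiv v (\<lambda>q. Z q $ l CX) q"
proof -
  have qS: "q \<in> S" "q \<in> U" using q flow_N S by auto
  let ?w = "\<lambda>s. dirderiv (0, v) \<Phi> (s, q)"
  have w: "((\<lambda>s. ?w s $ i) has_vector_derivative dirderiv v Z q $ i) (at 0)" for i
    using bounded_linear.has_vector_derivative[OF bounded_linear_vec_nth flow_variation[of 0 q v]]
      flow_eps q by (simp add: flow_variation_0 flow_0)
  have "((\<lambda>s. val c (\<Phi> (s, q))) has_vector_derivative dirderiv (Z q) (val c) q) (at 0)"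
    using has_vector_derivative_compose_smooth[OF flow_der[of 0 q] U smooth_val] flow_eps q qS
    by (simp add: flow_0)
  from has_vector_derivative_mult[OF this w[of "l CX"]]
  have rhs: "((\<lambda>s. val c (\<Phi> (s, q)) * ?w s $ l CX) has_vector_derivative
      val c q * dirderiv v Z q $ l CX + dirderiv (Z q) (val c) q * v $ l CX) (at 0)"
    using q by (simp add: flow_variation_0 flow_0)
  have "((\<lambda>s. ?w s $ l c) has_vector_derivative
      val c q * dirderiv v Z q $ l CX + dirderiv (Z q) (val c) q * v $ l CX) (at 0)"
  proof (rule has_vector_derivative_transform_within_open[OF rhs open_greaterThanLessThan])
    show "0 \<in> {-\<epsilon><..<\<epsilon>}" using flow_eps by simp
    show "val c (\<Phi> (s, q)) * ?w s $ l CX = ?w s $ l c" if "s \<in> {-\<epsilon><..<\<epsilon>}" for s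
      using flow_Delta[OF _ q v, of s] that c by (auto simp: Delta_def)
  qed
  from vector_derivative_unique_at[OF w this] show ?thesis
    using qS by (simp add: dirderiv_comp_nth)
qed

end

lemma reduced_symmetry_infinitesimal:
  assumes "reduced_symmetry S Z" "q \<in> S" "v \<in> Delta q" "c \<in> base_coords"
  shows "dirderiv v (\<lambda>q. Z q $ l c) q
    = dirderiv (Z q) (val c) q * v $ l CX + val c q * dirderiv v (\<lambda>q. Z q $ l CX) q"
  using assms flow_infinitesimal unfolding reduced_symmetry_def by blast

lemma val_base: "next_coord c \<in> base_coords \<Longrightarrow> c \<in> base_coords \<Longrightarrow> val c q = q $ l (next_coord c)"
  unfolding val_def jet_coordinate_def by (auto simp: base_coords_def)

lemma dirderiv_val_base:
  assumes "next_coord c \<in> base_coords" "c \<in> base_coords" "q \<in> U"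
  shows "dirderiv v (val c) q = v $ l (next_coord c)"
  using assms unfolding dirderiv_val[OF assms(3)] jet_coordinate_def by (auto simp: base_coords_def)

text \<open>
  The functions \<open>g c\<close> are the components of the symmetry minus \<open>\<xi>\<close> times the total derivative.  By the
  infinitesimal equations the total derivative of \<open>g c\<close> is \<open>g (next_coord c)\<close> as long as the chain goes on,
  and \<open>\<partial>/\<partial>z\<^sub>n\<close> kills \<open>g c\<close> unless \<open>c\<close> is the last coordinate of its chain.
\<close>

lemma fibre_preserved:
  assumes Z: "reduced_symmetry S Z" and q: "q \<in> S" and mn': "(m, n) \<noteq> (1, 1)" "(m, n) \<noteq> (1, 2)"
  shows "Dz (\<lambda>q. Z q $ l CX) q = 0"
proof -
  have S: "open S" "S \<subseteq> U" and sm: "smooth_on S Z" using Z by (auto simp: reduced_symmetry_def)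
  let ?x = "\<lambda>q. Z q $ l CX"
  define g where "g c q = Z q $ l c - val c q * ?x q" for c q
  have smv: "smooth_on S (val c)" for c by (rule smooth_on_subset[OF smooth_val S(2)])
  have smc: "smooth_on S (\<lambda>q. Z q $ i)" for i by (rule smooth_on_vec_nth[OF S(1) sm])
  have smg: "smooth_on S (g c)" for c
    unfolding g_def[abs_def] by (intro smooth_on_diff smooth_on_mult smc smv S)
  have dg: "dirderiv v (g c) q = dirderiv v (\<lambda>q. Z q $ l c) q
      - (val c q * dirderiv v ?x q + dirderiv v (val c) q * ?x q)" if "q \<in> S" for c q v
    unfolding g_def[abs_def]
    using dirderiv_diff[OF S(1) smc smooth_on_mult[OF S(1) smv smc] that]
      dirderiv_mult[OF S(1) smv smc that] by simp
  have Dzg: "Dz (g c) q = - (Dz (val c) q * ?x q)" if "q \<in> S" "c \<in> base_coords" for c q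
    using dg[OF that(1)] reduced_symmetry_infinitesimal[OF Z that(1) unit_zn_in_Delta that(2)]
    by (simp add: unit_zn_nth)
  have Tg: "total_deriv (g c) q = g (next_coord c) q"
    if "q \<in> S" "c \<in> base_coords" "next_coord c \<in> base_coords" for c q
  proof -
    have qU: "q \<in> U" using that S by auto
    have "total_field q $ l CX = 1" "total_field q $ l (next_coord c) = val (next_coord c) q"
      using that by (simp_all add: total_field_def total_nth val_def)
    then show ?thesis
      unfolding total_deriv_def
      using dg[OF that(1)] reduced_symmetry_infinitesimal[OF Z that(1) D_in_Delta that(2)]
        dirderiv_val_base[OF that(3,2) qU] by (simp add: g_def)
  qed
  have DzT: "Dz (total_deriv (g c)) q = Dz (g (next_coord c)) q"
    if "q \<in> S" "c \<in> base_coords" "next_coord c \<in> base_coords" for c q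
    by (rule dirderiv_cong[OF S(1) that(1) Tg[OF _ that(2,3)] smooth_T[OF S smg]])
  have Dzv: "Dz (val c) q = (if c = CY (m - 1) then Fz q else if c = CZ (n - 1) then 1 else 0)"
    if "q \<in> S" "c \<in> base_coords" for c q
  proof -
    have "next_coord c = CZ n \<longleftrightarrow> c = CZ (n - 1)" using that(2) n0 by (auto simp: base_coords_def)
    then show ?thesis
      using dirderiv_val_unit[of q c "CZ n"] that S(2) by (auto simp: Fz_def coords_split)
  qed
  show ?thesis
  proof (cases "m = 1")
    case False
    then have m2: "2 \<le> m" "2 \<le> n" using m0 mn by auto
    let ?f = "CY (m - 2)" and ?g = "CZ (n - 2)"
    have b: "?f \<in> base_coords" "?g \<in> base_coords" "CY (m - 1) \<in> base_coords" "CZ (n - 1) \<in> base_coords"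
      using m2 by (auto simp: base_coords_def)
    have nx: "next_coord ?f = CY (m - 1)" "next_coord ?g = CZ (n - 1)" using m2 by auto
    have ne: "?f \<noteq> CY (m - 1)" "?g \<noteq> CZ (n - 1)" using m2 by auto
    show ?thesis
    proof (rule fibre_preserved_if_two_dependent[OF S smg[of ?f] smg[of ?g] smc _ _ _ _ q])
      fix q assume q: "q \<in> S"
      show "Dz (g ?f) q = 0" "Dz (g ?g) q = 0"
        using Dzg[OF q] Dzv[OF q] b ne by simp_all
      show "Dz (total_deriv (g ?f)) q = - Fz q * ?x q" "Dz (total_deriv (g ?g)) q = - ?x q"
        using DzT[OF q] Dzg[OF q] Dzv[OF q] b nx by simp_all
    qed
  next
    case True
    then have n3: "3 \<le> n" using mn mn' n0 by (cases n; cases "n - 1"; cases "n - 2") auto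
    let ?g = "CZ (n - 3)"
    have b: "?g \<in> base_coords" "CZ (n - 2) \<in> base_coords" "CZ (n - 1) \<in> base_coords"
      using n3 by (auto simp: base_coords_def)
    have nx: "next_coord ?g = CZ (n - 2)" "next_coord (CZ (n - 2)) = CZ (n - 1)" using n3 by auto
    have ne: "?g \<noteq> CZ (n - 1)" "CZ (n - 2) \<noteq> CZ (n - 1)" using n3 by auto
    show ?thesis
    proof (rule fibre_preserved_if_one_dependent[OF S smg[of ?g] smc True _ _ _ q])
      fix q assume q: "q \<in> S"
      show "Dz (g ?g) q = 0" using Dzg[OF q] Dzv[OF q] b ne by simp
      show "Dz (total_deriv (g ?g)) q = 0" using DzT[OF q] Dzg[OF q] Dzv[OF q] b nx ne by simp
      have "total_deriv (total_deriv (g ?g)) q = total_deriv (g (CZ (n - 2))) q" if "q \<in> S" for q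
        unfolding total_deriv_def[of "total_deriv (g ?g)"] total_deriv_def[of "g (CZ (n - 2))"]
        using dirderiv_cong[OF S(1) that _ smooth_T[OF S smg]] Tg[OF _ b(1)] b nx by metis
      then have "Dz (total_deriv (total_deriv (g ?g))) q = Dz (total_deriv (g (CZ (n - 2)))) q"
        by (rule dirderiv_cong[OF S(1) q _ smooth_T[OF S smooth_T[OF S smg]]])
      then show "Dz (total_deriv (total_deriv (g ?g))) q = - ?x q"
        using DzT[OF q b(2)] Dzg[OF q b(3)] Dzv[OF q b(3)] b nx by simp
    qed
  qed
qed

lemma fibre_independent:
  assumes Z: "reduced_symmetry S Z" and q: "q \<in> S" and mn': "(m, n) \<noteq> (1, 1)" "(m, n) \<noteq> (1, 2)"
    and c: "c \<in> coords" "c \<noteq> CZ n"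
  shows "Dz (\<lambda>q. Z q $ l c) q = 0"
  using fibre_preserved[OF Z q mn'] reduced_symmetry_infinitesimal[OF Z q unit_zn_in_Delta, of c] c
  by (auto simp: coords_split unit_zn_nth)

end

section \<open>Prolonging internal symmetries\<close>

context monge
begin

lemma total_vec_expand: "total_vec (q, y) = total_field q + (y - F q) *\<^sub>R unit (CY (m - 1))"
proof (rule vec_eq_coordsI)
  fix c assume c: "c \<in> coords"
  have cm: "CY (m - 1) \<in> coords" using m0 by (simp add: coords_def)
  then consider "c = CX" | "c = CZ n" | "c \<in> base_coords" "c = CY (m - 1)" | "c \<in> base_coords" "c \<noteq> CY (m - 1)"
    using c coords_split by blast
  then show "total_vec (q, y) $ l c = (total_field q + (y - F q) *\<^sub>R unit (CY (m - 1))) $ l c"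
  proof cases
    case 3
    then have "next_coord c = CY m" using m0 by auto
    then show ?thesis using 3 unit_nth[OF cm c] by (simp add: total_field_def total_nth jet_coordinate_def)
  next
    case 4
    then have "next_coord c \<noteq> CY m" by (auto simp: base_coords_def)
    then show ?thesis using 4 unit_nth[OF cm c] by (simp add: total_field_def total_nth jet_coordinate_def)
  qed (use unit_nth[OF cm c] in \<open>auto simp: total_field_def total_nth\<close>)
qed

text \<open>
  The image, under the flow map at time \<open>t\<close>, of the horizontal direction that a point of the jet
  space represents.  Only its components other than \<open>z\<^sub>n\<close> are meaningful on \<open>J\<^bsup>m-1,n-1\<^esup>\<close>.
\<close>

definition velocity :: "(real \<times> (real ^ 'e) \<Rightarrow> real ^ 'e) \<Rightarrow> real \<times> 'e jet \<Rightarrow> real ^ 'e" where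
  "velocity \<Phi> = (\<lambda>(t, p). dirderiv (0, total_vec p) \<Phi> (t, fst p))"

text \<open>
  The action on directions: the new top coordinates \<open>z\<^sub>n\<close> and \<open>y\<^sub>m\<close> are the slopes of the image of the
  direction.  The other coordinates are moved by the given flow, which does not depend on \<open>z\<^sub>n\<close> there.
\<close>

definition prolong :: "(real \<times> (real ^ 'e) \<Rightarrow> real ^ 'e) \<Rightarrow> real \<times> 'e jet \<Rightarrow> 'e jet" where
  "prolong \<Phi> = (\<lambda>(t, p). let w = velocity \<Phi> (t, p); q = \<Phi> (t, fst p) in
    (q + (w $ l (CZ (n - 1)) / w $ l CX - q $ l (CZ n)) *\<^sub>R unit (CZ n), w $ l (CY (m - 1)) / w $ l CX))"

text \<open>
  The derivative at time \<open>0\<close> of the slope with numerator \<open>c\<close>: the usual prolongation formula.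
\<close>

definition slope_field :: "(real ^ 'e \<Rightarrow> real ^ 'e) \<Rightarrow> jet_coord \<Rightarrow> 'e jet \<Rightarrow> real" where
  "slope_field Z c p = dirderiv (total_vec p) (\<lambda>q. Z q $ l c) (fst p)
    - u (next_coord c) p * dirderiv (total_vec p) (\<lambda>q. Z q $ l CX) (fst p)"

definition prolong_field :: "(real ^ 'e \<Rightarrow> real ^ 'e) \<Rightarrow> 'e jet \<Rightarrow> 'e jet" where
  "prolong_field Z p = (Z (fst p) + (slope_field Z (CZ (n - 1)) p - Z (fst p) $ l (CZ n)) *\<^sub>R unit (CZ n),
    slope_field Z (CY (m - 1)) p)"

lemma last_coords: "CZ (n - 1) \<in> base_coords" "CY (m - 1) \<in> base_coords"
    "next_coord (CZ (n - 1)) = CZ n" "next_coord (CY (m - 1)) = CY m"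
  using m0 n0 by (auto simp: base_coords_def)

lemma coord_add_unit_zn:
  assumes "c \<in> coords"
  shows "(q + a *\<^sub>R unit (CZ n)) $ l c = (if c = CZ n then q $ l c + a else q $ l c)"
  using assms by (auto simp: coords_split unit_zn_nth)

lemma prolong_fst_nth: "c \<in> coords \<Longrightarrow> c \<noteq> CZ n \<Longrightarrow> fst (prolong \<Phi> (t, p)) $ l c = \<Phi> (t, fst p) $ l c"
  by (simp add: prolong_def Let_def coord_add_unit_zn del: vector_add_component vector_scaleR_component)

lemma prolong_last:
  "c = CZ (n - 1) \<or> c = CY (m - 1) \<Longrightarrow>
    u (next_coord c) (prolong \<Phi> (t, p)) = velocity \<Phi> (t, p) $ l c / velocity \<Phi> (t, p) $ l CX"
  using last_coords unit_zn_nth(3) by (auto simp: prolong_def Let_def jet_coordinate_def)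

context
  fixes S Z \<epsilon> N \<Phi>
  assumes Zsym: "reduced_symmetry S Z" and flow: "reduced_flow S Z \<epsilon> N \<Phi>"
    and mn': "(m, n) \<noteq> (1, 1)" "(m, n) \<noteq> (1, 2)"
begin

private lemma S: "open S" "S \<subseteq> U" and Z: "smooth_on S Z"
  using Zsym by (auto simp: reduced_symmetry_def)

private lemmas box = flow_box[OF S Z flow]
private lemmas box_mem = flow_box_mem[OF S Z flow]
private lemmas fl_in = flow_in[OF S Z flow] and fl_der = flow_der[OF S Z flow]
  and fl_Delta = flow_Delta[OF S Z flow] and fl_0 = flow_0[OF S Z flow]
  and fl_N = flow_N[OF S Z flow] and fl_eps = flow_eps[OF S Z flow]
  and fl_var = flow_variation[OF S Z flow] and fl_var0 = flow_variation_0[OF S Z flow]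
  and Z_nth = dirderiv_comp_nth[OF S Z flow]

lemma fl_linear:
  assumes "\<bar>t\<bar> < \<epsilon>" "q \<in> N"
  shows "dirderiv (0, a *\<^sub>R v + b *\<^sub>R w) \<Phi> (t, q) = a *\<^sub>R dirderiv (0, v) \<Phi> (t, q) + b *\<^sub>R dirderiv (0, w) \<Phi> (t, q)"
proof -
  have lin: "linear (\<lambda>v. dirderiv v \<Phi> (t, q))" by (rule linear_dirderiv[OF box box_mem[OF assms]])
  have "(0, a *\<^sub>R v + b *\<^sub>R w) = a *\<^sub>R (0::real, v) + b *\<^sub>R (0, w)" by simp
  then show ?thesis using linear_add[OF lin] linear_scale[OF lin] by metis
qed

text \<open>
  The differential of the flow keeps \<open>\<partial>/\<partial>z\<^sub>n\<close> in the distribution, so only its \<open>x\<close>-component has to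
  vanish.  As \<open>\<xi>\<close> does not depend on \<open>z\<^sub>n\<close>, the equation of first variation is a scalar linear equation
  for this component.
\<close>

lemma flow_fibre:
  assumes t: "\<bar>t\<bar> < \<epsilon>" and q: "q \<in> N" and c: "c \<in> coords" "c \<noteq> CZ n"
  shows "dirderiv (0, unit (CZ n)) \<Phi> (t, q) $ l c = 0"
proof -
  let ?w = "\<lambda>s. dirderiv (0, unit (CZ n)) \<Phi> (s, q)"
  let ?x = "\<lambda>q. Z q $ l CX"
  have seg: "\<bar>s\<bar> < \<epsilon>" if "s \<in> closed_segment 0 t" for s
    using that t by (auto simp: closed_segment_eq_real_ivl split: if_splits)
  have w_in: "?w s \<in> Delta (\<Phi> (s, q))" if "\<bar>s\<bar> < \<epsilon>" for s
    by (rule fl_Delta[OF that q unit_zn_in_Delta])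
  have xs: "smooth_on S ?x" by (rule smooth_on_vec_nth[OF S(1) Z])
  have "continuous_on (closed_segment 0 t) (\<lambda>s. total_deriv ?x (\<Phi> (s, q)))"
  proof (rule continuous_on_compose2[OF smooth_on_imp_continuous_on[OF S(1) smooth_T[OF S xs]]])
    show "continuous_on (closed_segment 0 t) (\<lambda>s. \<Phi> (s, q))"
      using fl_der q seg
      by (intro continuous_at_imp_continuous_on ballI) (blast intro: has_vector_derivative_continuous)
  qed (use fl_in q seg in auto)
  from compact_imp_bounded[OF compact_continuous_image[OF this compact_segment]]
  obtain K where K: "\<And>s. s \<in> closed_segment 0 t \<Longrightarrow> \<bar>total_deriv ?x (\<Phi> (s, q))\<bar> \<le> K"
    unfolding bounded_iff by (auto simp: image_iff)
  have "?w t $ l CX = 0"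
  proof (rule zero_if_derivative_bounded[of "\<lambda>s. ?w s $ l CX" 0 t "\<lambda>s. total_deriv ?x (\<Phi> (s, q)) * ?w s $ l CX" K])
    show "?w 0 $ l CX = 0" using fl_var0[OF q] by (simp add: unit_zn_nth)
    fix s assume s: "s \<in> closed_segment 0 t"
    have in_S: "\<Phi> (s, q) \<in> S" by (rule fl_in[OF seg[OF s] q])
    have lin: "linear (\<lambda>v. dirderiv v ?x (\<Phi> (s, q)))" by (rule linear_dirderiv[OF S(1) xs in_S])
    have "dirderiv (?w s) ?x (\<Phi> (s, q)) = dirderiv ((?w s $ l CX) *\<^sub>R total_field (\<Phi> (s, q))
        + (?w s $ l (CZ n)) *\<^sub>R unit (CZ n)) ?x (\<Phi> (s, q))"
      using Delta_expand[OF w_in[OF seg[OF s]]] by simp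
    also have "\<dots> = total_deriv ?x (\<Phi> (s, q)) * ?w s $ l CX"
      using fibre_preserved[OF Zsym in_S mn'] linear_add[OF lin] linear_scale[OF lin] by (simp add: total_deriv_def)
    finally have eq: "dirderiv (?w s) ?x (\<Phi> (s, q)) = total_deriv ?x (\<Phi> (s, q)) * ?w s $ l CX" .
    show "((\<lambda>s. ?w s $ l CX) has_vector_derivative total_deriv ?x (\<Phi> (s, q)) * ?w s $ l CX) (at s)"
      using bounded_linear.has_vector_derivative[OF bounded_linear_vec_nth fl_var[OF seg[OF s] q]]
        Z_nth[OF in_S] unfolding eq[symmetric] by simp
    show "norm (total_deriv ?x (\<Phi> (s, q)) * ?w s $ l CX) \<le> K * norm (?w s $ l CX)"
      using K[OF s] by (simp add: abs_mult mult_right_mono)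
  qed
  then show ?thesis using w_in[OF t] c by (auto simp: Delta_def coords_split)
qed

text \<open>
  The image of a horizontal direction lies in the Cartan distribution.  On the equation this is the
  assumption on the flow; off the equation the direction differs by a multiple of \<open>\<partial>/\<partial>y\<^sub>m\<^sub>-\<^sub>1\<close>, for which
  \<open>transversal_ratio\<close> supplies the same relation.
\<close>

lemma velocity_slopes:
  assumes t: "\<bar>t\<bar> < \<epsilon>" and p: "fst p \<in> N" and c: "c \<in> base_coords" "velocity \<Phi> (t, p) $ l CX \<noteq> 0"
  shows "velocity \<Phi> (t, p) $ l c = u (next_coord c) (prolong \<Phi> (t, p)) * velocity \<Phi> (t, p) $ l CX"
proof (cases "c = CZ (n - 1) \<or> c = CY (m - 1)")
  case True
  then show ?thesis using prolong_last[OF True] c(2) by simp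
next
  case False
  define q where "q = fst p"
  have q: "q \<in> N" using p by (simp add: q_def)
  have NU: "N \<subseteq> U" using fl_N S by blast
  have nb: "next_coord c \<in> base_coords" using c(1) False by (auto simp: base_coords_def)
  then have ncoord: "c \<in> coords" "next_coord c \<in> coords" "CX \<in> coords"
      "c \<noteq> CZ n" "next_coord c \<noteq> CZ n" "CX \<noteq> CZ n"
    using c(1) by (auto simp: coords_split)
  let ?a = "\<lambda>c q. \<Phi> (t, q) $ l c"
  have sm\<Phi>: "smooth_on N (\<lambda>q. \<Phi> (t, q))"
    by (rule smooth_on_slice[OF box(2)]) (use t in auto)
  have sm: "smooth_on N (?a c)" for c by (rule smooth_on_vec_nth[OF fl_N(1) sm\<Phi>])
  have dir: "dirderiv v (?a c) q = dirderiv (0, v) \<Phi> (t, q) $ l c" if "q \<in> N" for v c q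
    using dirderiv_bounded_linear[OF fl_N(1) sm\<Phi> that bounded_linear_vec_nth, of v "l c"]
      dirderiv_slice(1)[OF box box_mem[OF t that], of v] by simp
  have Dz0: "Dz (?a c) q = 0" if "q \<in> N" "c \<in> coords" "c \<noteq> CZ n" for c q
    using dir[OF that(1)] flow_fibre[OF t that] by simp
  have total_deriv: "total_deriv (?a c) q = ?a (next_coord c) q * total_deriv (?a CX) q" if q: "q \<in> N" for q
    using fl_Delta[OF t q D_in_Delta] c(1) dir[OF q] val_base[OF nb c(1)] by (simp add: Delta_def total_deriv_def)
  have P: "Dp (?a c) q = ?a (next_coord c) q * Dp (?a CX) q"
    by (rule transversal_ratio[OF fl_N(1) NU sm sm sm _ _ _ total_deriv q])
      (use Dz0 ncoord in auto)
  have vel: "velocity \<Phi> (t, p) $ l c = total_deriv (?a c) q + (snd p - F q) * Dp (?a c) q" for c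
  proof -
    have "total_vec p = 1 *\<^sub>R total_field q + (snd p - F q) *\<^sub>R unit (CY (m - 1))"
      using total_vec_expand[of q "snd p"] by (simp add: q_def)
    then have "velocity \<Phi> (t, p) = dirderiv (0, total_field q) \<Phi> (t, q) + (snd p - F q) *\<^sub>R dirderiv (0, unit (CY (m - 1))) \<Phi> (t, q)"
      using fl_linear[OF t q, of 1 "total_field q" "snd p - F q"] by (simp add: velocity_def q_def)
    then show ?thesis using dir[OF q] by (simp add: total_deriv_def)
  qed
  have "u (next_coord c) (prolong \<Phi> (t, p)) = ?a (next_coord c) q"
    using prolong_fst_nth[OF ncoord(2,5)] nb by (auto simp: jet_coordinate_def base_coords_def q_def)
  then show ?thesis unfolding vel total_deriv[OF q] P by (simp add: algebra_simps)
qed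

lemma velocity_expand:
  assumes "\<bar>t\<bar> < \<epsilon>" "fst p \<in> N" "velocity \<Phi> (t, p) $ l CX \<noteq> 0"
  shows "velocity \<Phi> (t, p) = (velocity \<Phi> (t, p) $ l CX) *\<^sub>R total_vec (prolong \<Phi> (t, p))
    + (velocity \<Phi> (t, p) $ l (CZ n)) *\<^sub>R unit (CZ n)"
proof -
  have "(velocity \<Phi> (t, p), 0) \<in> cartan m n l (prolong \<Phi> (t, p))"
    unfolding cartan_iff fst_conv by (intro ballI velocity_slopes assms)
  then show ?thesis unfolding cartan_vec_iff fst_conv .
qed

context
  fixes B :: "(real ^ 'e) set"
  assumes B: "open B" "convex B" "B \<subseteq> S"
begin

text \<open>
  Convexity makes the fibres of the projection along \<open>z\<^sub>n\<close> connected.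
\<close>

lemma Z_on_fibre:
  assumes "q \<in> B" "q + s *\<^sub>R unit (CZ n) \<in> B" "c \<in> coords" "c \<noteq> CZ n"
  shows "Z (q + s *\<^sub>R unit (CZ n)) $ l c = Z q $ l c"
    "dirderiv v (\<lambda>q. Z q $ l c) (q + s *\<^sub>R unit (CZ n)) = dirderiv v (\<lambda>q. Z q $ l c) q"
proof -
  have sm: "smooth_on B (\<lambda>q. Z q $ l c)"
    by (rule smooth_on_subset[OF smooth_on_vec_nth[OF S(1) Z] B(3)])
  have 0: "Dz (\<lambda>q. Z q $ l c) x = 0" if "x \<in> B" for x
    using fibre_independent[OF Zsym _ mn' assms(3,4)] that B(3) by blast
  show "Z (q + s *\<^sub>R unit (CZ n)) $ l c = Z q $ l c"
    by (rule zero_derivative_along_segment[OF B(1,2) sm assms(1,2) 0])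
  show "dirderiv v (\<lambda>q. Z q $ l c) (q + s *\<^sub>R unit (CZ n)) = dirderiv v (\<lambda>q. Z q $ l c) q"
  proof (rule zero_derivative_along_segment[OF B(1,2) smooth_on_dirderiv_const[OF B(1) sm] assms(1,2)])
    fix x assume x: "x \<in> B"
    have "Dz (dirderiv v (\<lambda>q. Z q $ l c)) x = dirderiv v (Dz (\<lambda>q. Z q $ l c)) x"
      by (rule dirderiv_commute[OF B(1) sm x])
    also have "\<dots> = 0" by (rule dirderiv_zero_on[OF B(1) x 0])
    finally show "Dz (dirderiv v (\<lambda>q. Z q $ l c)) x = 0" .
  qed
qed

lemma prolong_derivative:
  assumes t: "\<bar>t\<bar> < \<epsilon>" and p: "fst p \<in> N" and nz: "velocity \<Phi> (t, p) $ l CX \<noteq> 0"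
    and inB: "\<Phi> (t, fst p) \<in> B" "fst (prolong \<Phi> (t, p)) \<in> B"
  shows "((\<lambda>s. prolong \<Phi> (s, p)) has_vector_derivative prolong_field Z (prolong \<Phi> (t, p))) (at t)"
proof -
  let ?q = "fst p" and ?P = "prolong \<Phi> (t, p)" and ?w = "\<lambda>s. velocity \<Phi> (s, p)"
  have w: "((\<lambda>s. ?w s $ i) has_real_derivative dirderiv (?w t) Z (\<Phi> (t, ?q)) $ i) (at t)" for i
    using bounded_linear.has_vector_derivative[OF bounded_linear_vec_nth fl_var[OF t p]]
    by (simp add: velocity_def has_real_derivative_iff_has_vector_derivative)
  define s where "s = ?w t $ l (CZ (n - 1)) / ?w t $ l CX - \<Phi> (t, ?q) $ l (CZ n)"
  have s: "fst ?P = \<Phi> (t, ?q) + s *\<^sub>R unit (CZ n)" by (simp add: prolong_def Let_def s_def)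
  note qS = subsetD[OF B(3) inB(1)]
  \<comment> \<open>By the first variation only the direction of the velocity matters, and this is the horizontal
    direction of the prolonged point; along the fibre the field does not change.\<close>
  have dw: "dirderiv (?w t) Z (\<Phi> (t, ?q)) $ l c
      = ?w t $ l CX * dirderiv (total_vec ?P) (\<lambda>q. Z q $ l c) (fst ?P)"
    if c: "c \<in> coords" "c \<noteq> CZ n" for c
  proof -
    have lin: "linear (\<lambda>v. dirderiv v (\<lambda>q. Z q $ l c) (\<Phi> (t, ?q)))"
      by (rule linear_dirderiv[OF S(1) smooth_on_vec_nth[OF S(1) Z] qS])
    have "dirderiv (?w t) Z (\<Phi> (t, ?q)) $ l c = dirderiv (?w t) (\<lambda>q. Z q $ l c) (\<Phi> (t, ?q))"
      using Z_nth[OF qS] by simp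
    also have "\<dots> = dirderiv ((?w t $ l CX) *\<^sub>R total_vec ?P + (?w t $ l (CZ n)) *\<^sub>R unit (CZ n)) (\<lambda>q. Z q $ l c) (\<Phi> (t, ?q))"
      using velocity_expand[OF t p nz] by simp
    also have "\<dots> = ?w t $ l CX * dirderiv (total_vec ?P) (\<lambda>q. Z q $ l c) (\<Phi> (t, ?q))"
      using fibre_independent[OF Zsym qS mn' c] linear_add[OF lin] linear_scale[OF lin] by simp
    also have "dirderiv (total_vec ?P) (\<lambda>q. Z q $ l c) (\<Phi> (t, ?q)) = dirderiv (total_vec ?P) (\<lambda>q. Z q $ l c) (fst ?P)"
      using Z_on_fibre(2)[OF inB(1) _ c, of s] inB(2) s by simp
    finally show ?thesis .
  qed
  have CXc: "CX \<in> coords" "CX \<noteq> CZ n" by (auto simp: coords_split)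
  have ratio: "((\<lambda>s. ?w s $ l c / ?w s $ l CX) has_vector_derivative slope_field Z c ?P) (at t)"
    if c: "c = CZ (n - 1) \<or> c = CY (m - 1)" for c
  proof -
    have cb: "c \<in> coords" "c \<noteq> CZ n" using c last_coords coords_split by auto
    let ?r = "(dirderiv (?w t) Z (\<Phi> (t, ?q)) $ l c * ?w t $ l CX
        - ?w t $ l c * dirderiv (?w t) Z (\<Phi> (t, ?q)) $ l CX) / (?w t $ l CX * ?w t $ l CX)"
    have "((\<lambda>s. ?w s $ l c / ?w s $ l CX) has_real_derivative ?r) (at t)"
      by (rule DERIV_divide[OF w w nz])
    moreover have "?r = slope_field Z c ?P"
      unfolding slope_field_def dw[OF cb] dw[OF CXc] prolong_last[OF c] using nz by (simp add: field_simps)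
    ultimately show ?thesis by (simp add: has_real_derivative_iff_has_vector_derivative)
  qed
  note \<Phi>' = fl_der[OF t p]
  have zn: "((\<lambda>s. \<Phi> (s, ?q) $ l (CZ n)) has_vector_derivative Z (\<Phi> (t, ?q)) $ l (CZ n)) (at t)"
    by (rule bounded_linear.has_vector_derivative[OF bounded_linear_vec_nth \<Phi>'])
  have scale: "((\<lambda>s. f s *\<^sub>R unit (CZ n)) has_vector_derivative f' *\<^sub>R unit (CZ n)) (at t)"
    if "(f has_vector_derivative f') (at t)" for f f'
    by (rule bounded_linear.has_vector_derivative[OF bounded_linear_scaleR_left that])
  have "((\<lambda>s. \<Phi> (s, ?q) + (?w s $ l (CZ (n - 1)) / ?w s $ l CX - \<Phi> (s, ?q) $ l (CZ n)) *\<^sub>R unit (CZ n))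
      has_vector_derivative Z (\<Phi> (t, ?q)) + (slope_field Z (CZ (n - 1)) ?P - Z (\<Phi> (t, ?q)) $ l (CZ n)) *\<^sub>R unit (CZ n)) (at t)"
    by (intro has_vector_derivative_add[OF \<Phi>'] scale has_vector_derivative_diff ratio zn disjI1 refl)
  moreover have "Z (\<Phi> (t, ?q)) + (slope_field Z (CZ (n - 1)) ?P - Z (\<Phi> (t, ?q)) $ l (CZ n)) *\<^sub>R unit (CZ n)
      = Z (fst ?P) + (slope_field Z (CZ (n - 1)) ?P - Z (fst ?P) $ l (CZ n)) *\<^sub>R unit (CZ n)"
  proof (rule vec_eq_coordsI)
    fix c assume c: "c \<in> coords"
    show "(Z (\<Phi> (t, ?q)) + (slope_field Z (CZ (n - 1)) ?P - Z (\<Phi> (t, ?q)) $ l (CZ n)) *\<^sub>R unit (CZ n)) $ l c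
      = (Z (fst ?P) + (slope_field Z (CZ (n - 1)) ?P - Z (fst ?P) $ l (CZ n)) *\<^sub>R unit (CZ n)) $ l c"
      unfolding coord_add_unit_zn[OF c]
      using Z_on_fibre(1)[OF inB(1) _ c, of s] inB(2) s by simp
  qed
  ultimately have "((\<lambda>s. (\<Phi> (s, ?q) + (?w s $ l (CZ (n - 1)) / ?w s $ l CX - \<Phi> (s, ?q) $ l (CZ n)) *\<^sub>R unit (CZ n),
      ?w s $ l (CY (m - 1)) / ?w s $ l CX)) has_vector_derivative prolong_field Z ?P) (at t)"
    using has_vector_derivative_Pair[OF _ ratio[of "CY (m - 1)"]] by (simp add: prolong_field_def)
  then show ?thesis by (simp add: prolong_def Let_def)
qed

lemma prolong_0:
  assumes "fst p \<in> N"
  shows "velocity \<Phi> (0, p) = total_vec p" "prolong \<Phi> (0, p) = p"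
proof -
  show v: "velocity \<Phi> (0, p) = total_vec p" using fl_var0[OF assms] by (simp add: velocity_def)
  have "total_vec p $ l (CZ (n - 1)) = fst p $ l (CZ n)" "total_vec p $ l (CY (m - 1)) = snd p"
    using last_coords by (simp_all add: total_nth jet_coordinate_def)
  then show "prolong \<Phi> (0, p) = p"
    using fl_0[OF assms] by (simp add: prolong_def Let_def v total_nth)
qed

lemma smooth_velocity: "smooth_on ({-\<epsilon><..<\<epsilon>} \<times> (N \<times> UNIV)) (velocity \<Phi>)"
proof -
  have op: "open ({-\<epsilon><..<\<epsilon>} \<times> (N \<times> (UNIV :: real set)))"
    by (intro open_Times fl_N(1) open_greaterThanLessThan open_UNIV)
  have "smooth_on ({-\<epsilon><..<\<epsilon>} \<times> (N \<times> UNIV))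
      (\<lambda>x::real \<times> 'e jet. dirderiv (0, total_vec (snd x)) \<Phi> (fst x, fst (snd x)))"
    by (rule smooth_on_dirderiv_at[OF op box])
      (auto intro!: smooth_on_Pair smooth_on_const smooth_on_fst smooth_on_snd smooth_on_id op
        smooth_on_compose[OF smooth_on_snd[OF op smooth_on_id] smooth_total[of UNIV]])
  then show ?thesis by (simp add: velocity_def case_prod_beta')
qed

text \<open>
  The time and the neighbourhood are so small that the image of the direction stays horizontal and
  that neither the flow nor its prolongation leaves \<open>B\<close>.
\<close>

lemma prolong_flow:
  assumes p0: "fst p0 \<in> N" "fst p0 \<in> B"
  shows "\<exists>\<delta> N' \<psi>. p0 \<in> N' \<and> local_flow (B \<times> UNIV) (prolong_field Z) \<delta> N' \<psi> \<and>
    (\<forall>t\<in>{-\<delta><..<\<delta>}. \<forall>p\<in>N'. \<forall>v\<in>cartan m n l p. dirderiv v (\<psi> t) p \<in> cartan m n l (\<psi> t p))"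
proof -
  let ?O = "{-\<epsilon><..<\<epsilon>} \<times> (N \<times> (UNIV :: real set))"
  have O: "open ?O" by (intro open_Times fl_N(1) open_greaterThanLessThan open_UNIV)
  define O1 where "O1 = ?O \<inter> velocity \<Phi> -` {w. w $ l CX \<noteq> 0}"
  have "open {w::real ^ 'e. w $ l CX \<noteq> 0}"
    by (intro open_Collect_neq continuous_on_const) (auto intro!: continuous_intros)
  then have "open O1"
    unfolding O1_def by (rule continuous_open_preimage[OF smooth_on_imp_continuous_on[OF O smooth_velocity] O])
  moreover have "O1 \<subseteq> ?O" unfolding O1_def by (rule Int_lower1)
  ultimately have O1: "open O1" "O1 \<subseteq> ?O" by auto
  have smV: "smooth_on O1 (velocity \<Phi>)" by (rule smooth_on_subset[OF smooth_velocity O1(2)])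
  have sm\<Phi>: "smooth_on O1 (\<lambda>x. \<Phi> (fst x, fst (snd x)))"
    by (rule smooth_on_compose[OF _ box(2)])
      (use O1 in \<open>auto intro!: smooth_on_Pair smooth_on_fst smooth_on_snd smooth_on_id\<close>)
  have smP: "smooth_on O1 (prolong \<Phi>)"
  proof -
    have "smooth_on O1 (\<lambda>x. (\<Phi> (fst x, fst (snd x)) + (velocity \<Phi> x $ l (CZ (n - 1)) / velocity \<Phi> x $ l CX
        - \<Phi> (fst x, fst (snd x)) $ l (CZ n)) *\<^sub>R unit (CZ n),
        velocity \<Phi> x $ l (CY (m - 1)) / velocity \<Phi> x $ l CX))"
      by (intro smooth_on_Pair smooth_on_add smooth_on_scaleR smooth_on_diff smooth_on_divide
          smooth_on_const smooth_on_vec_nth[OF O1(1)] smV sm\<Phi> O1(1)) (auto simp: O1_def)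
    then show ?thesis by (simp add: prolong_def Let_def case_prod_beta')
  qed
  let ?f = "\<lambda>x. (\<Phi> (fst x, fst (snd x)), fst (prolong \<Phi> x))"
  define \<Omega> where "\<Omega> = O1 \<inter> ?f -` (B \<times> B)"
  have "open \<Omega>"
    unfolding \<Omega>_def
    by (intro continuous_open_preimage smooth_on_imp_continuous_on smooth_on_Pair smooth_on_fst
        sm\<Phi> smP O1(1) open_Times B(1))
  moreover have "(0, p0) \<in> \<Omega>"
    using p0 prolong_0[OF p0(1)] fl_0[OF p0(1)] fl_eps
    by (cases p0) (auto simp: \<Omega>_def O1_def total_nth)
  ultimately obtain \<delta> N' where \<delta>: "0 < \<delta>" "open N'" "p0 \<in> N'" "{-\<delta><..<\<delta>} \<times> N' \<subseteq> \<Omega>"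
    by (rule open_contains_flow_box)
  have mem: "\<bar>t\<bar> < \<epsilon>" "fst p \<in> N" "velocity \<Phi> (t, p) $ l CX \<noteq> 0" "\<Phi> (t, fst p) \<in> B"
      "fst (prolong \<Phi> (t, p)) \<in> B" "(t, p) \<in> O1"
    if "t \<in> {-\<delta><..<\<delta>}" "p \<in> N'" for t p
  proof -
    have "(t, p) \<in> \<Omega>" using \<delta>(4) that by blast
    then show "\<bar>t\<bar> < \<epsilon>" "fst p \<in> N" "velocity \<Phi> (t, p) $ l CX \<noteq> 0" "\<Phi> (t, fst p) \<in> B"
      "fst (prolong \<Phi> (t, p)) \<in> B" "(t, p) \<in> O1"
      by (auto simp: \<Omega>_def O1_def)
  qed
  let ?\<psi> = "\<lambda>t p. prolong \<Phi> (t, p)"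
  have N': "N' \<subseteq> B \<times> UNIV"
  proof
    fix p assume p: "p \<in> N'"
    have "0 \<in> {-\<delta><..<\<delta>}" using \<delta>(1) by simp
    from mem(2,5)[OF this p] show "p \<in> B \<times> UNIV" using prolong_0(2)[of p] by (cases p) auto
  qed
  have sm\<delta>: "smooth_on ({-\<delta><..<\<delta>} \<times> N') (prolong \<Phi>)"
    by (rule smooth_on_subset[OF smP]) (use mem(6) in auto)
  have "local_flow (B \<times> UNIV) (prolong_field Z) \<delta> N' ?\<psi>"
    unfolding local_flow_def
  proof (intro conjI ballI)
    show "openin (top_of_set (B \<times> UNIV)) N'"
      using N' \<delta>(2) by (simp add: openin_open_eq open_Times B(1))
    show "smooth_on ({-\<delta><..<\<delta>} \<times> N') (\<lambda>(t, q). prolong \<Phi> (t, q))" using sm\<delta> by simp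
    show "prolong \<Phi> (0, p) = p" if "p \<in> N'" for p
      using mem(2)[OF _ that, of 0] \<delta>(1) prolong_0(2) by simp
    show "prolong \<Phi> (t, p) \<in> B \<times> UNIV" if "p \<in> N'" "t \<in> {-\<delta><..<\<delta>}" for p t
      using mem(5)[OF that(2,1)] by (simp add: mem_Times_iff)
    show "((\<lambda>s. prolong \<Phi> (s, p)) has_vector_derivative prolong_field Z (prolong \<Phi> (t, p))) (at t)"
      if "p \<in> N'" "t \<in> {-\<delta><..<\<delta>}" for p t
      by (rule prolong_derivative[OF mem(1-5)[OF that(2,1)]])
  qed (use \<delta> in auto)
  moreover have "dirderiv v (?\<psi> t) p \<in> cartan m n l (?\<psi> t p)"
    if t: "t \<in> {-\<delta><..<\<delta>}" and p: "p \<in> N'" and v: "v \<in> cartan m n l p" for t p v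
  proof -
    note mem = mem[OF t p]
    have smt: "smooth_on N' (?\<psi> t)" by (rule smooth_on_slice[OF sm\<delta> t])
    have nth: "fst (dirderiv v (?\<psi> t) p) $ l c = fst v $ l CX * velocity \<Phi> (t, p) $ l c"
      if c: "c \<in> coords" "c \<noteq> CZ n" for c
    proof -
      have L: "bounded_linear (\<lambda>p::'e jet. fst p $ l c)"
        by (rule bounded_linear_compose[OF bounded_linear_vec_nth bounded_linear_fst])
      have "fst (dirderiv v (?\<psi> t) p) $ l c = dirderiv v (\<lambda>p. fst (?\<psi> t p) $ l c) p"
        by (rule dirderiv_bounded_linear[OF \<delta>(2) smt p L, symmetric])
      also have "\<dots> = dirderiv v (\<lambda>p. \<Phi> (t, fst p) $ l c) p"
        using prolong_fst_nth[OF c] by simp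
      also have "\<dots> = dirderiv (0, fst v) \<Phi> (t, fst p) $ l c"
      proof (rule dirderiv_eq)
        have "((\<lambda>p::'e jet. (t, fst p)) has_derivative (\<lambda>v. (0, fst v))) (at p)"
          by (rule has_derivative_Pair[OF has_derivative_const has_derivative_fst[OF has_derivative_ident]])
        from has_derivative_compose[OF this smooth_on_has_derivative[OF box box_mem[OF mem(1,2)]]]
        show "((\<lambda>p. \<Phi> (t, fst p) $ l c) has_derivative (\<lambda>v. dirderiv (0, fst v) \<Phi> (t, fst p) $ l c)) (at p)"
          by (rule bounded_linear.has_derivative[OF bounded_linear_vec_nth])
      qed
      also have "\<dots> = fst v $ l CX * velocity \<Phi> (t, p) $ l c"
      proof -
        have "fst v = (fst v $ l CX) *\<^sub>R total_vec p + (fst v $ l (CZ n)) *\<^sub>R unit (CZ n)"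
          using v cartan_vec_iff by blast
        from arg_cong[OF this, of "\<lambda>a. dirderiv (0, a) \<Phi> (t, fst p)"]
        have "dirderiv (0, fst v) \<Phi> (t, fst p) = (fst v $ l CX) *\<^sub>R velocity \<Phi> (t, p)
            + (fst v $ l (CZ n)) *\<^sub>R dirderiv (0, unit (CZ n)) \<Phi> (t, fst p)"
          unfolding fl_linear[OF mem(1,2)] velocity_def case_prod_conv .
        then show ?thesis using flow_fibre[OF mem(1,2) c] by simp
      qed
      finally show ?thesis .
    qed
    show ?thesis
      unfolding cartan_iff
    proof
      fix c assume c: "c \<in> base_coords"
      then have "c \<in> coords" "c \<noteq> CZ n" "CX \<in> coords" "CX \<noteq> CZ n" by (auto simp: coords_split)
      then show "fst (dirderiv v (?\<psi> t) p) $ l c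
          = u (next_coord c) (?\<psi> t p) * fst (dirderiv v (?\<psi> t) p) $ l CX"
        using velocity_slopes[OF mem(1,2) c mem(3)] nth by simp
    qed
  qed
  ultimately show ?thesis using \<delta>(3) by blast
qed

end

end

lemma smooth_prolong_field:
  assumes B: "open B" and Z: "smooth_on B Z"
  shows "smooth_on (B \<times> UNIV) (prolong_field Z)"
proof -
  have O: "open (B \<times> (UNIV :: real set))" using B by (intro open_Times open_UNIV)
  have fstB: "fst ` (B \<times> (UNIV :: real set)) \<subseteq> B" by auto
  have fsts: "smooth_on (B \<times> (UNIV :: real set)) fst"
    using smooth_on_fst[OF O smooth_on_id] by simp
  have Zf: "smooth_on (B \<times> (UNIV :: real set)) (\<lambda>p. Z (fst p))" by (rule smooth_on_compose[OF fsts Z fstB])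
  have d: "smooth_on (B \<times> UNIV) (\<lambda>p. dirderiv (total_vec p) (\<lambda>q. Z q $ i) (fst p))" for i
    by (rule smooth_on_dirderiv_at[OF O B smooth_on_vec_nth[OF B Z] smooth_total fsts fstB])
  have s: "smooth_on (B \<times> UNIV) (slope_field Z c)" for c
    unfolding slope_field_def[abs_def]
    by (intro smooth_on_diff smooth_on_mult O d smooth_on_bounded_linear[OF O bounded_linear_coordinate smooth_on_id])
  show ?thesis
    unfolding prolong_field_def[abs_def]
    by (intro smooth_on_Pair smooth_on_add smooth_on_scaleR smooth_on_diff smooth_on_const
        smooth_on_vec_nth O Zf s)
qed

text \<open>
  On the equation the infinitesimal symmetry condition for the total derivative says that the slopes
  change as the top coordinates of the symmetry do.
\<close>

lemma prolong_field_on_equation: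
  assumes Z: "reduced_symmetry S Z" and q: "q \<in> S"
  shows "prolong_field Z (q, F q) = (Z q, dirderiv (Z q) F q)"
proof -
  have qU: "q \<in> U" using Z q by (auto simp: reduced_symmetry_def)
  have slope: "slope_field Z c (q, F q) = u (next_coord c) (Z q, dirderiv (Z q) F q)"
    if "c \<in> base_coords" for c
    using reduced_symmetry_infinitesimal[OF Z q D_in_Delta that] dirderiv_val[OF qU]
    by (simp add: slope_field_def total_field_def val_def total_nth)
  show ?thesis
    using last_coords slope[OF last_coords(1)] slope[OF last_coords(2)]
    by (simp add: prolong_field_def jet_coordinate_def)
qed

text \<open>
  The prolongation lives on the cylinder over a ball in \<open>U\<close>.  Off the equation its flow near a point
  comes from the internal flow near the point of the equation with the same \<open>q\<close>.
\<close>

lemma internal_symmetry_is_induced: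
  assumes mn': "(m, n) \<noteq> (1, 1)" "(m, n) \<noteq> (1, 2)"
    and V: "openin (top_of_set (monge_equation U F)) V"
    and X: "X \<in> internal_symmetries m n l (monge_equation U F) V"
  shows "X \<in> induced_symmetries m n l (monge_equation U F) V"
  unfolding induced_symmetries_def
proof (rule CollectI, rule ballI)
  let ?E = "monge_equation U F"
  fix p assume pV: "p \<in> V"
  define S where "S = {q \<in> U. (q, F q) \<in> V}"
  define Z where "Z = (\<lambda>q. fst (X (q, F q)))"
  have Z: "reduced_symmetry S Z" unfolding S_def Z_def by (rule internal_symmetry_reduced(1)[OF V X])
  then have S: "open S" "S \<subseteq> U" and smZ: "smooth_on S Z" by (auto simp: reduced_symmetry_def)
  have pE: "p \<in> ?E" using pV V openin_imp_subset by blast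
  then have p: "p = (fst p, F (fst p))" "fst p \<in> S"
    using pV by (auto simp: monge_equation_iff S_def prod_eq_iff) (metis prod.collapse)
  obtain r where r: "0 < r" "ball (fst p) r \<subseteq> S" using S(1) p(2) openE by blast
  let ?B = "ball (fst p) r"
  let ?W = "?B \<times> (UNIV :: real set)"
  have W: "open ?W" by (intro open_Times open_ball open_UNIV)
  have sym: "infinitesimal_symmetry ?W (cartan m n l) (prolong_field Z)"
  proof (rule infinitesimal_symmetry_openI[OF W smooth_prolong_field[OF open_ball smooth_on_subset[OF smZ r(2)]]])
    fix p' assume "p' \<in> ?W"
    then have p': "fst p' \<in> ?B" by auto
    then have "fst p' \<in> S" using r(2) by blast
    then obtain \<epsilon> N \<Phi> where N: "fst p' \<in> N" "reduced_flow S Z \<epsilon> N \<Phi>"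
      using Z unfolding reduced_symmetry_def by blast
    show "\<exists>\<delta> N' \<psi>. p' \<in> N' \<and> local_flow ?W (prolong_field Z) \<delta> N' \<psi> \<and>
        (\<forall>t\<in>{-\<delta><..<\<delta>}. \<forall>p\<in>N'. \<forall>v\<in>cartan m n l p. dirderiv v (\<psi> t) p \<in> cartan m n l (\<psi> t p))"
      by (rule prolong_flow[OF Z N(2) mn' open_ball convex_ball r(2) N(1) p'])
  qed
  have on_E: "X a = prolong_field Z a" "prolong_field Z a \<in> tangent_space ?E a" "a \<in> V"
    if "a \<in> ?E \<inter> ?W" for a
  proof -
    define q where "q = fst a"
    have a: "a = (q, F q)" "q \<in> ?B"
      using that by (auto simp: q_def monge_equation_iff prod_eq_iff mem_Times_iff)
    then have q: "q \<in> S" "q \<in> U" "(q, F q) \<in> V" using r(2) S(2) by (auto simp: S_def)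
    have pr: "prolong_field Z a = (Z q, dirderiv (Z q) F q)"
      unfolding a(1) by (rule prolong_field_on_equation[OF Z q(1)])
    show "X a = prolong_field Z a"
      unfolding pr using internal_symmetry_reduced(2)[OF V X q(2,3)] by (simp add: a(1) Z_def prod_eq_iff)
    show "prolong_field Z a \<in> tangent_space ?E a"
      unfolding pr using tangent_space_monge_equation[OF U F, of a] that a(1) by simp
    show "a \<in> V" using q(3) a(1) by simp
  qed
  have "p \<in> ?W" using r(1) by (cases p) auto
  then show "\<exists>W Y. p \<in> W \<and> ?E \<inter> W \<subseteq> V \<and> external_symmetry m n l ?E W Y \<and> (\<forall>q\<in>?E \<inter> W. X q = Y q)"
    using on_E W sym unfolding external_symmetry_def lie_field_def
    by (intro exI[of _ ?W] exI[of _ "prolong_field Z"]) blast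
qed

end

theorem theorem2:
  fixes m n :: nat
    and l :: "jet_coord \<Rightarrow> 'e::finite"
    and U :: "(real ^ 'e) set"
    and F :: "real ^ 'e \<Rightarrow> real"
    and V :: "'e jet set"
  assumes "0 < m" and "m \<le> n" and "(m, n) \<noteq> (1, 1)" and "(m, n) \<noteq> (1, 2)"
    and "jet_labelling m n l"
    and "open U" and "smooth_on U F"
    and "\<forall>q\<in>U. partial_deriv (l (CZ n)) (partial_deriv (l (CZ n)) F) q \<noteq> 0"
    and "openin (top_of_set (monge_equation U F)) V"
  shows "internal_symmetries m n l (monge_equation U F) V =
         induced_symmetries m n l (monge_equation U F) V"
proof -
  have "partial_deriv i f = dirderiv (axis i 1) f" for i and f :: "real ^ 'e \<Rightarrow> real"
    by (simp add: fun_eq_iff partial_deriv_def dirderiv_def)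
  then interpret monge m n l U F
    using assms by unfold_locales auto
  show ?thesis
    using internal_symmetry_is_induced[OF assms(3,4,9)] induced_symmetry_is_internal[OF assms(6,7,9)]
    by blast
qed

end
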